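(* Let $\Gamma$ be an ordered group, $\Lambda\subseteq\Gamma$ a subset, and $FR$ a $\Gamma$-filtered ring. The categories $\operatorname{Preglid}_\Lambda FR$ and $\operatorname{Prefrag}_\Lambda FR$ are Grothendieck quasi-abelian categories.
   Context: Rings are unital. An ordered group $(\Gamma,\le)$ is a group with a (partial) order such that $\alpha\le\beta$ and $\gamma\le\delta$ imply $\alpha\gamma\le\beta\delta$; its unit is $e$. A $\Gamma$-filtered ring $FR$ is a ring $R$ with additive subgroups $\{F_\gamma R\}_{\gamma\in\Gamma}$ such that $1_R\in F_eR$, $F_\alpha R\subseteq F_\beta R$ if $\alpha\le\beta$, and $(F_\alpha R)(F_\beta R)\subseteq F_{\alpha\beta}R$. The preadditive category $\mathcal F_\Lambda R$ has object set $\Lambda$ and $\operatorname{Hom}(\alpha,\beta)=F_{\beta\alpha^{-1}}R$ if $\alpha\le\beta$, and $0$ otherwise; composition is multiplication in $R$. The preadditive category $\overline{\mathcal F}_\Lambda R$ has object set $\Lambda\sqcup\{\infty\}$, contains $\mathcal F_\Lambda R$ as a full subcategory, and has $\operatorname{Hom}(\alpha,\infty)=R$ for all $\alpha\in\Lambda\sqcup\{\infty\}$ and $\operatorname{Hom}(\infty,\alpha)=0$ for $\alpha\in\Lambda$. If $\alpha\le\beta$ or $\beta=\infty$, write $1_{\alpha,\beta}$ for $1_R\in\operatorname{Hom}(\alpha,\beta)$. $\operatorname{Mod}$ denotes additive covariant functors to abelian groups. $\operatorname{Prefrag}_\Lambda FR\subseteq\operatorname{Mod}\mathcal F_\Lambda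 R$ is the full subcategory of those $M$ such that $M(1_{\alpha,\beta})$ is a monomorphism for all $\alpha\le\beta$ in $\Lambda$. $\operatorname{Preglid}_\Lambda FR\subseteq\operatorname{Mod}\overline{\mathcal F}_\Lambda R$ is the full subcategory of those $M$ such that $M(1_{\alpha,\beta})$ is a monomorphism for all $\alpha,\beta\in\Lambda\sqcup\{\infty\}$ with $\alpha\le\beta$ or $\beta=\infty$. A quasi-abelian category is an additive category with kernels and cokernels in which cokernels are stable under pullback and kernels are stable under pushout; its conflations are all kernel-cokernel pairs. In a category $\mathcal C$ with all small filtered direct limits, an object $C$ is finitely presentable if $\varinjlim\operatorname{Hom}(C,D)\to\operatorname{Hom}(C,\varinjlim D)$ is an isomorphism for all filtered diagrams $D$; $\mathcal C$ is locally presentable if it has all small filtered direct limits and every object is a filtered direct limit of finitely presentable objects. A quasi-abelian category is a Grothendieck quasi-abelian category if it is locally presentable and has exact filtered direct limits (filtered direct limits of conflations are conflations). *)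

theory Defs
  imports "HOL-Algebra.AbelCoset"
begin

unbundle cardinal_syntax

section \<open>Categories, functors, natural transformations\<close>

text \<open>
  Morphism sets are indexed by their source and target and need not be disjoint, so
  \<open>Cmp C X Y Z g f\<close> is the composite of \<open>f : X \<rightarrow> Y\<close> and \<open>g : Y \<rightarrow> Z\<close>.
\<close>

record ('o, 'm) cat =
  Ob :: "'o set"
  Hom :: "'o \<Rightarrow> 'o \<Rightarrow> 'm set"
  Idt :: "'o \<Rightarrow> 'm"
  Cmp :: "'o \<Rightarrow> 'o \<Rightarrow> 'o \<Rightarrow> 'm \<Rightarrow> 'm \<Rightarrow> 'm"

record ('o, 'm) precat = "('o, 'm) cat" +
  Plus :: "'o \<Rightarrow> 'o \<Rightarrow> 'm \<Rightarrow> 'm \<Rightarrow> 'm"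
  Zer :: "'o \<Rightarrow> 'o \<Rightarrow> 'm"

locale category =
  fixes C :: "('o, 'm, 'z) cat_scheme"
  assumes Idt_in: "X \<in> Ob C \<Longrightarrow> Idt C X \<in> Hom C X X"
    and Cmp_in: "\<lbrakk>X \<in> Ob C; Y \<in> Ob C; Z \<in> Ob C; f \<in> Hom C X Y; g \<in> Hom C Y Z\<rbrakk>
      \<Longrightarrow> Cmp C X Y Z g f \<in> Hom C X Z"
    and Cmp_Idt_right: "\<lbrakk>X \<in> Ob C; Y \<in> Ob C; f \<in> Hom C X Y\<rbrakk> \<Longrightarrow> Cmp C X X Y f (Idt C X) = f"
    and Cmp_Idt_left: "\<lbrakk>X \<in> Ob C; Y \<in> Ob C; f \<in> Hom C X Y\<rbrakk> \<Longrightarrow> Cmp C X Y Y (Idt C Y) f = f"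
    and Cmp_assoc: "\<lbrakk>W \<in> Ob C; X \<in> Ob C; Y \<in> Ob C; Z \<in> Ob C;
        f \<in> Hom C W X; g \<in> Hom C X Y; h \<in> Hom C Y Z\<rbrakk>
      \<Longrightarrow> Cmp C W Y Z h (Cmp C W X Y g f) = Cmp C W X Z (Cmp C X Y Z h g) f"

definition hom_group :: "('o, 'm, 'z) precat_scheme \<Rightarrow> 'o \<Rightarrow> 'o \<Rightarrow> 'm monoid" where
  "hom_group C X Y = \<lparr>carrier = Hom C X Y, mult = Plus C X Y, one = Zer C X Y\<rparr>"

locale preadditive_category = category C for C :: "('o, 'm, 'z) precat_scheme" +
  assumes Hom_group: "\<lbrakk>X \<in> Ob C; Y \<in> Ob C\<rbrakk> \<Longrightarrow> comm_group (hom_group C X Y)"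
    and Cmp_Plus_right: "\<lbrakk>X \<in> Ob C; Y \<in> Ob C; Z \<in> Ob C;
        f \<in> Hom C X Y; f' \<in> Hom C X Y; g \<in> Hom C Y Z\<rbrakk>
      \<Longrightarrow> Cmp C X Y Z g (Plus C X Y f f') = Plus C X Z (Cmp C X Y Z g f) (Cmp C X Y Z g f')"
    and Cmp_Plus_left: "\<lbrakk>X \<in> Ob C; Y \<in> Ob C; Z \<in> Ob C;
        f \<in> Hom C X Y; g \<in> Hom C Y Z; g' \<in> Hom C Y Z\<rbrakk>
      \<Longrightarrow> Cmp C X Y Z (Plus C Y Z g g') f = Plus C X Z (Cmp C X Y Z g f) (Cmp C X Y Z g' f)"

record ('o, 'm, 'p, 'n) func =
  fob :: "'o \<Rightarrow> 'p"
  fmor :: "'o \<Rightarrow> 'o \<Rightarrow> 'm \<Rightarrow> 'n"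

locale is_functor =
  fixes A :: "('o, 'm, 'y) cat_scheme" and B :: "('p, 'n, 'z) cat_scheme"
    and F :: "('o, 'm, 'p, 'n) func"
  assumes fob_in: "X \<in> Ob A \<Longrightarrow> fob F X \<in> Ob B"
    and fmor_in: "\<lbrakk>X \<in> Ob A; Y \<in> Ob A; f \<in> Hom A X Y\<rbrakk>
      \<Longrightarrow> fmor F X Y f \<in> Hom B (fob F X) (fob F Y)"
    and fmor_Idt: "X \<in> Ob A \<Longrightarrow> fmor F X X (Idt A X) = Idt B (fob F X)"
    and fmor_Cmp: "\<lbrakk>X \<in> Ob A; Y \<in> Ob A; Z \<in> Ob A; f \<in> Hom A X Y; g \<in> Hom A Y Z\<rbrakk>
      \<Longrightarrow> fmor F X Z (Cmp A X Y Z g f)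
        = Cmp B (fob F X) (fob F Y) (fob F Z) (fmor F Y Z g) (fmor F X Y f)"

locale is_additive_functor = is_functor A B F
  for A :: "('o, 'm, 'y) precat_scheme" and B :: "('p, 'n, 'z) precat_scheme"
    and F :: "('o, 'm, 'p, 'n) func" +
  assumes fmor_Plus: "\<lbrakk>X \<in> Ob A; Y \<in> Ob A; f \<in> Hom A X Y; g \<in> Hom A X Y\<rbrakk>
      \<Longrightarrow> fmor F X Y (Plus A X Y f g)
        = Plus B (fob F X) (fob F Y) (fmor F X Y f) (fmor F X Y g)"

definition nat_trans ::
  "('o, 'm, 'y) cat_scheme \<Rightarrow> ('p, 'n, 'z) cat_scheme \<Rightarrow> ('o, 'm, 'p, 'n) func
    \<Rightarrow> ('o, 'm, 'p, 'n) func \<Rightarrow> ('o \<Rightarrow> 'n) set" where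
  "nat_trans A B F G = {\<eta> \<in> (\<Pi>\<^sub>E X\<in>Ob A. Hom B (fob F X) (fob G X)).
     \<forall>X\<in>Ob A. \<forall>Y\<in>Ob A. \<forall>f\<in>Hom A X Y.
       Cmp B (fob F X) (fob F Y) (fob G Y) (\<eta> Y) (fmor F X Y f)
       = Cmp B (fob F X) (fob G X) (fob G Y) (fmor G X Y f) (\<eta> X)}"

definition additive_functor_category ::
  "('o, 'm, 'y) precat_scheme \<Rightarrow> ('p, 'n, 'z) precat_scheme
    \<Rightarrow> (('o, 'm, 'p, 'n) func, 'o \<Rightarrow> 'n) precat" where
  "additive_functor_category A B = \<lparr>
     Ob = {F. is_additive_functor A B F},
     Hom = nat_trans A B,
     Idt = (\<lambda>F. \<lambda>X\<in>Ob A. Idt B (fob F X)),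
     Cmp = (\<lambda>F G H \<theta> \<eta>. \<lambda>X\<in>Ob A. Cmp B (fob F X) (fob G X) (fob H X) (\<theta> X) (\<eta> X)),
     Plus = (\<lambda>F G \<eta> \<theta>. \<lambda>X\<in>Ob A. Plus B (fob F X) (fob G X) (\<eta> X) (\<theta> X)),
     Zer = (\<lambda>F G. \<lambda>X\<in>Ob A. Zer B (fob F X) (fob G X))\<rparr>"

definition full_subcategory ::
  "('o, 'm, 'z) precat_scheme \<Rightarrow> ('o \<Rightarrow> bool) \<Rightarrow> ('o, 'm, 'z) precat_scheme" where
  "full_subcategory C P = C\<lparr>Ob := {X \<in> Ob C. P X}\<rparr>"

definition monic :: "('o, 'm, 'z) cat_scheme \<Rightarrow> 'o \<Rightarrow> 'o \<Rightarrow> 'm \<Rightarrow> bool" where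
  "monic C X Y f \<longleftrightarrow> X \<in> Ob C \<and> Y \<in> Ob C \<and> f \<in> Hom C X Y \<and>
     (\<forall>W\<in>Ob C. \<forall>g\<in>Hom C W X. \<forall>h\<in>Hom C W X. Cmp C W X Y f g = Cmp C W X Y f h \<longrightarrow> g = h)"


section \<open>Quasi-abelian categories\<close>

definition zero_object :: "('o, 'm, 'z) cat_scheme \<Rightarrow> 'o \<Rightarrow> bool" where
  "zero_object C Z \<longleftrightarrow> Z \<in> Ob C \<and>
     (\<forall>X\<in>Ob C. (\<exists>!f. f \<in> Hom C Z X) \<and> (\<exists>!f. f \<in> Hom C X Z))"

definition biproduct ::
  "('o, 'm, 'z) precat_scheme \<Rightarrow> 'o \<Rightarrow> 'o \<Rightarrow> 'o \<Rightarrow> 'm \<Rightarrow> 'm \<Rightarrow> 'm \<Rightarrow> 'm \<Rightarrow> bool" where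
  "biproduct C X Y S i j p q \<longleftrightarrow> S \<in> Ob C \<and>
     i \<in> Hom C X S \<and> j \<in> Hom C Y S \<and> p \<in> Hom C S X \<and> q \<in> Hom C S Y \<and>
     Cmp C X S X p i = Idt C X \<and> Cmp C Y S Y q j = Idt C Y \<and>
     Cmp C Y S X p j = Zer C Y X \<and> Cmp C X S Y q i = Zer C X Y \<and>
     Plus C S S (Cmp C S X S i p) (Cmp C S Y S j q) = Idt C S"

definition additive_category :: "('o, 'm, 'z) precat_scheme \<Rightarrow> bool" where
  "additive_category C \<longleftrightarrow> preadditive_category C \<and> (\<exists>Z. zero_object C Z) \<and>
     (\<forall>X\<in>Ob C. \<forall>Y\<in>Ob C. \<exists>S i j p q. biproduct C X Y S i j p q)"

text \<open>\<open>k : K \<rightarrow> X\<close> is a kernel of \<open>f : X \<rightarrow> Y\<close>.\<close>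

definition is_kernel ::
  "('o, 'm, 'z) precat_scheme \<Rightarrow> 'o \<Rightarrow> 'o \<Rightarrow> 'm \<Rightarrow> 'o \<Rightarrow> 'm \<Rightarrow> bool" where
  "is_kernel C X Y f K k \<longleftrightarrow> K \<in> Ob C \<and> X \<in> Ob C \<and> Y \<in> Ob C \<and>
     f \<in> Hom C X Y \<and> k \<in> Hom C K X \<and> Cmp C K X Y f k = Zer C K Y \<and>
     (\<forall>W\<in>Ob C. \<forall>g\<in>Hom C W X. Cmp C W X Y f g = Zer C W Y
        \<longrightarrow> (\<exists>!h. h \<in> Hom C W K \<and> Cmp C W K X k h = g))"

text \<open>\<open>c : Y \<rightarrow> Q\<close> is a cokernel of \<open>f : X \<rightarrow> Y\<close>.\<close>

definition is_cokernel ::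
  "('o, 'm, 'z) precat_scheme \<Rightarrow> 'o \<Rightarrow> 'o \<Rightarrow> 'm \<Rightarrow> 'o \<Rightarrow> 'm \<Rightarrow> bool" where
  "is_cokernel C X Y f Q c \<longleftrightarrow> X \<in> Ob C \<and> Y \<in> Ob C \<and> Q \<in> Ob C \<and>
     f \<in> Hom C X Y \<and> c \<in> Hom C Y Q \<and> Cmp C X Y Q c f = Zer C X Q \<and>
     (\<forall>W\<in>Ob C. \<forall>g\<in>Hom C Y W. Cmp C X Y W g f = Zer C X W
        \<longrightarrow> (\<exists>!h. h \<in> Hom C Q W \<and> Cmp C Y Q W h c = g))"

definition kernel_map :: "('o, 'm, 'z) precat_scheme \<Rightarrow> 'o \<Rightarrow> 'o \<Rightarrow> 'm \<Rightarrow> bool" where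
  "kernel_map C K X k \<longleftrightarrow> (\<exists>Y f. is_kernel C X Y f K k)"

definition cokernel_map :: "('o, 'm, 'z) precat_scheme \<Rightarrow> 'o \<Rightarrow> 'o \<Rightarrow> 'm \<Rightarrow> bool" where
  "cokernel_map C Y Q c \<longleftrightarrow> (\<exists>X f. is_cokernel C X Y f Q c)"

text \<open>\<open>p : P \<rightarrow> X\<close> and \<open>q : P \<rightarrow> Y\<close> form a pullback of \<open>f : X \<rightarrow> Z\<close> and \<open>g : Y \<rightarrow> Z\<close>.\<close>

definition is_pullback ::
  "('o, 'm, 'z) cat_scheme \<Rightarrow> 'o \<Rightarrow> 'o \<Rightarrow> 'o \<Rightarrow> 'm \<Rightarrow> 'm \<Rightarrow> 'o \<Rightarrow> 'm \<Rightarrow> 'm \<Rightarrow> bool" where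
  "is_pullback C X Y Z f g P p q \<longleftrightarrow>
     X \<in> Ob C \<and> Y \<in> Ob C \<and> Z \<in> Ob C \<and> P \<in> Ob C \<and>
     f \<in> Hom C X Z \<and> g \<in> Hom C Y Z \<and> p \<in> Hom C P X \<and> q \<in> Hom C P Y \<and>
     Cmp C P X Z f p = Cmp C P Y Z g q \<and>
     (\<forall>W\<in>Ob C. \<forall>a\<in>Hom C W X. \<forall>b\<in>Hom C W Y. Cmp C W X Z f a = Cmp C W Y Z g b
        \<longrightarrow> (\<exists>!h. h \<in> Hom C W P \<and> Cmp C W P X p h = a \<and> Cmp C W P Y q h = b))"

text \<open>\<open>p : X \<rightarrow> P\<close> and \<open>q : Y \<rightarrow> P\<close> form a pushout of \<open>f : Z \<rightarrow> X\<close> and \<open>g : Z \<rightarrow> Y\<close>.\<close>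

definition is_pushout ::
  "('o, 'm, 'z) cat_scheme \<Rightarrow> 'o \<Rightarrow> 'o \<Rightarrow> 'o \<Rightarrow> 'm \<Rightarrow> 'm \<Rightarrow> 'o \<Rightarrow> 'm \<Rightarrow> 'm \<Rightarrow> bool" where
  "is_pushout C X Y Z f g P p q \<longleftrightarrow>
     X \<in> Ob C \<and> Y \<in> Ob C \<and> Z \<in> Ob C \<and> P \<in> Ob C \<and>
     f \<in> Hom C Z X \<and> g \<in> Hom C Z Y \<and> p \<in> Hom C X P \<and> q \<in> Hom C Y P \<and>
     Cmp C Z X P p f = Cmp C Z Y P q g \<and>
     (\<forall>W\<in>Ob C. \<forall>a\<in>Hom C X W. \<forall>b\<in>Hom C Y W. Cmp C Z X W a f = Cmp C Z Y W b g
        \<longrightarrow> (\<exists>!h. h \<in> Hom C P W \<and> Cmp C X P W h p = a \<and> Cmp C Y P W h q = b))"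

text \<open>
  Pullbacks and pushouts exist in any additive category with kernels and cokernels, so
  stability quantifies over all pullback (pushout) squares.
\<close>

definition quasi_abelian :: "('o, 'm, 'z) precat_scheme \<Rightarrow> bool" where
  "quasi_abelian C \<longleftrightarrow> additive_category C \<and>
     (\<forall>X\<in>Ob C. \<forall>Y\<in>Ob C. \<forall>f\<in>Hom C X Y.
        (\<exists>K k. is_kernel C X Y f K k) \<and> (\<exists>Q c. is_cokernel C X Y f Q c)) \<and>
     (\<forall>X Y Z f g P p q. is_pullback C X Y Z f g P p q \<and> cokernel_map C X Z f
        \<longrightarrow> cokernel_map C P Y q) \<and>
     (\<forall>X Y Z f g P p q. is_pushout C X Y Z f g P p q \<and> kernel_map C Z X f
        \<longrightarrow> kernel_map C Y P q)"

definition conflation ::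
  "('o, 'm, 'z) precat_scheme \<Rightarrow> 'o \<Rightarrow> 'o \<Rightarrow> 'o \<Rightarrow> 'm \<Rightarrow> 'm \<Rightarrow> bool" where
  "conflation C X Y Z f g \<longleftrightarrow> is_kernel C Y Z g X f \<and> is_cokernel C X Y f Z g"


section \<open>Filtered direct limits and Grothendieck quasi-abelian categories\<close>

text \<open>
  Size conventions.  The universe is given by an uncountable regular cardinal \<open>r\<close> on a type
  \<open>'u\<close>: a set is small if its cardinality is less than \<open>r\<close>.  For strongly inaccessible \<open>r\<close>
  this is smallness relative to a Grothendieck universe; for \<open>r = cardSuc |UNIV :: 'v set|\<close>
  with \<open>'v\<close> infinite, the small sets are those that embed into the type \<open>'v\<close>.  As \<open>r\<close> lives on
  \<open>'u\<close>, every small set is in bijection with a subset of \<open>'u\<close>, so that small categories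
  may be taken to have their objects and morphisms in \<open>'u\<close>.
\<close>

definition universe_card :: "'u rel \<Rightarrow> bool" where
  "universe_card r \<longleftrightarrow> Card_order r \<and> regularCard r \<and> natLeq <o r"

definition small_category :: "'u rel \<Rightarrow> ('o, 'm, 'z) cat_scheme \<Rightarrow> bool" where
  "small_category r J \<longleftrightarrow> category J \<and> |Ob J| <o r \<and> (\<forall>i\<in>Ob J. \<forall>j\<in>Ob J. |Hom J i j| <o r)"

definition filtered_category :: "('o, 'm, 'z) cat_scheme \<Rightarrow> bool" where
  "filtered_category J \<longleftrightarrow> category J \<and> Ob J \<noteq> {} \<and>
     (\<forall>i\<in>Ob J. \<forall>j\<in>Ob J. \<exists>k\<in>Ob J. Hom J i k \<noteq> {} \<and> Hom J j k \<noteq> {}) \<and>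
     (\<forall>i\<in>Ob J. \<forall>j\<in>Ob J. \<forall>u\<in>Hom J i j. \<forall>v\<in>Hom J i j.
        \<exists>k\<in>Ob J. \<exists>w\<in>Hom J j k. Cmp J i j k w u = Cmp J i j k w v)"

definition small_filtered_diagram ::
  "'u rel \<Rightarrow> ('u, 'u) cat \<Rightarrow> ('o, 'm, 'z) cat_scheme \<Rightarrow> ('u, 'u, 'o, 'm) func \<Rightarrow> bool" where
  "small_filtered_diagram r J C D \<longleftrightarrow>
     small_category r J \<and> filtered_category J \<and> is_functor J C D"

definition is_cocone ::
  "('j, 'k, 'y) cat_scheme \<Rightarrow> ('o, 'm, 'z) cat_scheme \<Rightarrow> ('j, 'k, 'o, 'm) func
    \<Rightarrow> 'o \<Rightarrow> ('j \<Rightarrow> 'm) \<Rightarrow> bool" where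
  "is_cocone J C D L \<iota> \<longleftrightarrow> L \<in> Ob C \<and> (\<forall>i\<in>Ob J. \<iota> i \<in> Hom C (fob D i) L) \<and>
     (\<forall>i\<in>Ob J. \<forall>j\<in>Ob J. \<forall>u\<in>Hom J i j.
        Cmp C (fob D i) (fob D j) L (\<iota> j) (fmor D i j u) = \<iota> i)"

definition is_colimit ::
  "('j, 'k, 'y) cat_scheme \<Rightarrow> ('o, 'm, 'z) cat_scheme \<Rightarrow> ('j, 'k, 'o, 'm) func
    \<Rightarrow> 'o \<Rightarrow> ('j \<Rightarrow> 'm) \<Rightarrow> bool" where
  "is_colimit J C D L \<iota> \<longleftrightarrow> is_cocone J C D L \<iota> \<and>
     (\<forall>X \<kappa>. is_cocone J C D X \<kappa> \<longrightarrow>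
        (\<exists>!h. h \<in> Hom C L X \<and> (\<forall>i\<in>Ob J. Cmp C (fob D i) L X h (\<iota> i) = \<kappa> i)))"

text \<open>
  The direct limit of the sets \<open>S i\<close> along the maps \<open>T i j u : S i \<rightarrow> S j\<close>: the quotient of
  the disjoint union by the equivalence relation generated by \<open>(i, x) \<sim> (j, T i j u x)\<close>.
\<close>

definition colim_step ::
  "('j, 'k, 'y) cat_scheme \<Rightarrow> ('j \<Rightarrow> 'a set) \<Rightarrow> ('j \<Rightarrow> 'j \<Rightarrow> 'k \<Rightarrow> 'a \<Rightarrow> 'a) \<Rightarrow> ('j \<times> 'a) rel" where
  "colim_step J S T =
     {((i, x), (j, T i j u x)) | i j u x. i \<in> Ob J \<and> j \<in> Ob J \<and> u \<in> Hom J i j \<and> x \<in> S i}"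

definition set_colim ::
  "('j, 'k, 'y) cat_scheme \<Rightarrow> ('j \<Rightarrow> 'a set) \<Rightarrow> ('j \<Rightarrow> 'j \<Rightarrow> 'k \<Rightarrow> 'a \<Rightarrow> 'a) \<Rightarrow> ('j \<times> 'a) set set" where
  "set_colim J S T = (SIGMA i:Ob J. S i) // (colim_step J S T \<union> (colim_step J S T)\<inverse>)\<^sup>*"

text \<open>
  The canonical map sends the class of \<open>(i, f : X \<rightarrow> D i)\<close> to \<open>\<iota> i \<circ> f\<close>, which is constant on
  classes, so \<^const>\<open>the_elem\<close> extracts the unique element of a singleton.
\<close>

definition finitely_presentable :: "'u rel \<Rightarrow> ('o, 'm, 'z) cat_scheme \<Rightarrow> 'o \<Rightarrow> bool" where
  "finitely_presentable r C X \<longleftrightarrow> X \<in> Ob C \<and>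
     (\<forall>(J :: ('u, 'u) cat) D L \<iota>. small_filtered_diagram r J C D \<and> is_colimit J C D L \<iota> \<longrightarrow>
        bij_betw (\<lambda>K. the_elem ((\<lambda>(i, f). Cmp C X (fob D i) L (\<iota> i) f) ` K))
          (set_colim J (\<lambda>i. Hom C X (fob D i))
             (\<lambda>i j u f. Cmp C X (fob D i) (fob D j) (fmor D i j u) f))
          (Hom C X L))"

definition has_filtered_colimits :: "'u rel \<Rightarrow> ('o, 'm, 'z) cat_scheme \<Rightarrow> bool" where
  "has_filtered_colimits r C \<longleftrightarrow>
     (\<forall>(J :: ('u, 'u) cat) D. small_filtered_diagram r J C D \<longrightarrow> (\<exists>L \<iota>. is_colimit J C D L \<iota>))"

definition locally_presentable :: "'u rel \<Rightarrow> ('o, 'm, 'z) cat_scheme \<Rightarrow> bool" where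
  "locally_presentable r C \<longleftrightarrow> has_filtered_colimits r C \<and>
     (\<forall>X\<in>Ob C. \<exists>(J :: ('u, 'u) cat) D \<iota>. small_filtered_diagram r J C D \<and>
        (\<forall>i\<in>Ob J. finitely_presentable r C (fob D i)) \<and> is_colimit J C D X \<iota>)"

text \<open>The hypotheses on \<open>f\<close> and \<open>g\<close> say that they are the maps induced by \<open>\<phi>\<close> and \<open>\<psi>\<close> on the limits.\<close>

definition exact_filtered_colimits :: "'u rel \<Rightarrow> ('o, 'm, 'z) precat_scheme \<Rightarrow> bool" where
  "exact_filtered_colimits r C \<longleftrightarrow>
     (\<forall>(J :: ('u, 'u) cat) D D' D'' \<phi> \<psi> L L' L'' \<iota> \<iota>' \<iota>'' f g.
        small_filtered_diagram r J C D \<and> small_filtered_diagram r J C D' \<and>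
        small_filtered_diagram r J C D'' \<and>
        \<phi> \<in> nat_trans J C D D' \<and> \<psi> \<in> nat_trans J C D' D'' \<and>
        (\<forall>i\<in>Ob J. conflation C (fob D i) (fob D' i) (fob D'' i) (\<phi> i) (\<psi> i)) \<and>
        is_colimit J C D L \<iota> \<and> is_colimit J C D' L' \<iota>' \<and> is_colimit J C D'' L'' \<iota>'' \<and>
        f \<in> Hom C L L' \<and> g \<in> Hom C L' L'' \<and>
        (\<forall>i\<in>Ob J. Cmp C (fob D i) L L' f (\<iota> i) = Cmp C (fob D i) (fob D' i) L' (\<iota>' i) (\<phi> i)) \<and>
        (\<forall>i\<in>Ob J. Cmp C (fob D' i) L' L'' g (\<iota>' i)
           = Cmp C (fob D' i) (fob D'' i) L'' (\<iota>'' i) (\<psi> i))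
        \<longrightarrow> conflation C L L' L'' f g)"

definition grothendieck_quasi_abelian :: "'u rel \<Rightarrow> ('o, 'm, 'z) precat_scheme \<Rightarrow> bool" where
  "grothendieck_quasi_abelian r C \<longleftrightarrow>
     quasi_abelian C \<and> locally_presentable r C \<and> exact_filtered_colimits r C"


section \<open>Filtered rings and the categories Prefrag and Preglid\<close>

text \<open>
  Abelian groups are written multiplicatively here, as in \<^locale>\<open>comm_group\<close>; homomorphisms are
  extensional functions, so that equality of morphisms is equality on the carrier.
\<close>

definition Ab :: "'u rel \<Rightarrow> ('u monoid, 'u \<Rightarrow> 'u) precat" where
  "Ab r = \<lparr>
     Ob = {A. comm_group A \<and> |carrier A| <o r},
     Hom = (\<lambda>A B. hom A B \<inter> extensional (carrier A)),
     Idt = (\<lambda>A. \<lambda>x\<in>carrier A. x),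
     Cmp = (\<lambda>A B C g f. \<lambda>x\<in>carrier A. g (f x)),
     Plus = (\<lambda>A B f g. \<lambda>x\<in>carrier A. f x \<otimes>\<^bsub>B\<^esub> g x),
     Zer = (\<lambda>A B. \<lambda>x\<in>carrier A. \<one>\<^bsub>B\<^esub>)\<rparr>"

locale ordered_group = group \<Gamma> for \<Gamma> :: "('g, 'a) monoid_scheme" (structure) +
  fixes leq :: "'g \<Rightarrow> 'g \<Rightarrow> bool"
  assumes leq_refl: "\<alpha> \<in> carrier \<Gamma> \<Longrightarrow> leq \<alpha> \<alpha>"
    and leq_antisym: "\<lbrakk>\<alpha> \<in> carrier \<Gamma>; \<beta> \<in> carrier \<Gamma>; leq \<alpha> \<beta>; leq \<beta> \<alpha>\<rbrakk> \<Longrightarrow> \<alpha> = \<beta>"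
    and leq_trans: "\<lbrakk>\<alpha> \<in> carrier \<Gamma>; \<beta> \<in> carrier \<Gamma>; \<gamma> \<in> carrier \<Gamma>; leq \<alpha> \<beta>; leq \<beta> \<gamma>\<rbrakk> \<Longrightarrow> leq \<alpha> \<gamma>"
    and leq_mult: "\<lbrakk>\<alpha> \<in> carrier \<Gamma>; \<beta> \<in> carrier \<Gamma>; \<gamma> \<in> carrier \<Gamma>; \<delta> \<in> carrier \<Gamma>; leq \<alpha> \<beta>; leq \<gamma> \<delta>\<rbrakk>
      \<Longrightarrow> leq (\<alpha> \<otimes> \<gamma>) (\<beta> \<otimes> \<delta>)"

locale filtered_ring = ordered_group \<Gamma> leq + R: ring R
  for \<Gamma> :: "('g, 'a) monoid_scheme" and leq :: "'g \<Rightarrow> 'g \<Rightarrow> bool" and R :: "('c, 'b) ring_scheme" +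
  fixes F :: "'g \<Rightarrow> 'c set"
  assumes F_subgroup: "\<gamma> \<in> carrier \<Gamma> \<Longrightarrow> additive_subgroup (F \<gamma>) R"
    and F_one: "\<one>\<^bsub>R\<^esub> \<in> F \<one>\<^bsub>\<Gamma>\<^esub>"
    and F_mono: "\<lbrakk>\<alpha> \<in> carrier \<Gamma>; \<beta> \<in> carrier \<Gamma>; leq \<alpha> \<beta>\<rbrakk> \<Longrightarrow> F \<alpha> \<subseteq> F \<beta>"
    and F_mult: "\<lbrakk>\<alpha> \<in> carrier \<Gamma>; \<beta> \<in> carrier \<Gamma>; x \<in> F \<alpha>; y \<in> F \<beta>\<rbrakk>
      \<Longrightarrow> x \<otimes>\<^bsub>R\<^esub> y \<in> F (\<alpha> \<otimes>\<^bsub>\<Gamma>\<^esub> \<beta>)"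

definition filt_hom ::
  "('g, 'a) monoid_scheme \<Rightarrow> ('g \<Rightarrow> 'g \<Rightarrow> bool) \<Rightarrow> ('c, 'b) ring_scheme \<Rightarrow> ('g \<Rightarrow> 'c set)
    \<Rightarrow> 'g \<Rightarrow> 'g \<Rightarrow> 'c set" where
  "filt_hom \<Gamma> leq R F \<alpha> \<beta> = (if leq \<alpha> \<beta> then F (\<beta> \<otimes>\<^bsub>\<Gamma>\<^esub> inv\<^bsub>\<Gamma>\<^esub> \<alpha>) else {\<zero>\<^bsub>R\<^esub>})"

definition filt_cat ::
  "('g, 'a) monoid_scheme \<Rightarrow> ('g \<Rightarrow> 'g \<Rightarrow> bool) \<Rightarrow> ('c, 'b) ring_scheme \<Rightarrow> ('g \<Rightarrow> 'c set)
    \<Rightarrow> 'g set \<Rightarrow> ('g, 'c) precat" where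
  "filt_cat \<Gamma> leq R F \<Lambda> = \<lparr>
     Ob = \<Lambda>,
     Hom = filt_hom \<Gamma> leq R F,
     Idt = (\<lambda>_. \<one>\<^bsub>R\<^esub>),
     Cmp = (\<lambda>_ _ _ g f. g \<otimes>\<^bsub>R\<^esub> f),
     Plus = (\<lambda>_ _ f g. f \<oplus>\<^bsub>R\<^esub> g),
     Zer = (\<lambda>_ _. \<zero>\<^bsub>R\<^esub>)\<rparr>"

text \<open>The object \<open>\<infinity>\<close> is \<^const>\<open>None\<close>.\<close>

definition filt_cat_inf ::
  "('g, 'a) monoid_scheme \<Rightarrow> ('g \<Rightarrow> 'g \<Rightarrow> bool) \<Rightarrow> ('c, 'b) ring_scheme \<Rightarrow> ('g \<Rightarrow> 'c set)
    \<Rightarrow> 'g set \<Rightarrow> ('g option, 'c) precat" where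
  "filt_cat_inf \<Gamma> leq R F \<Lambda> = \<lparr>
     Ob = insert None (Some ` \<Lambda>),
     Hom = (\<lambda>a b. case b of
         None \<Rightarrow> carrier R
       | Some \<beta> \<Rightarrow> (case a of None \<Rightarrow> {\<zero>\<^bsub>R\<^esub>} | Some \<alpha> \<Rightarrow> filt_hom \<Gamma> leq R F \<alpha> \<beta>)),
     Idt = (\<lambda>_. \<one>\<^bsub>R\<^esub>),
     Cmp = (\<lambda>_ _ _ g f. g \<otimes>\<^bsub>R\<^esub> f),
     Plus = (\<lambda>_ _ f g. f \<oplus>\<^bsub>R\<^esub> g),
     Zer = (\<lambda>_ _. \<zero>\<^bsub>R\<^esub>)\<rparr>"

definition leq_inf :: "('g \<Rightarrow> 'g \<Rightarrow> bool) \<Rightarrow> 'g option \<Rightarrow> 'g option \<Rightarrow> bool" where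
  "leq_inf leq a b \<longleftrightarrow> b = None \<or> (\<exists>\<alpha> \<beta>. a = Some \<alpha> \<and> b = Some \<beta> \<and> leq \<alpha> \<beta>)"

definition Prefrag ::
  "'u rel \<Rightarrow> ('g, 'a) monoid_scheme \<Rightarrow> ('g \<Rightarrow> 'g \<Rightarrow> bool) \<Rightarrow> ('c, 'b) ring_scheme \<Rightarrow> ('g \<Rightarrow> 'c set)
    \<Rightarrow> 'g set \<Rightarrow> (('g, 'c, 'u monoid, 'u \<Rightarrow> 'u) func, 'g \<Rightarrow> 'u \<Rightarrow> 'u) precat" where
  "Prefrag r \<Gamma> leq R F \<Lambda> =
     full_subcategory (additive_functor_category (filt_cat \<Gamma> leq R F \<Lambda>) (Ab r))
       (\<lambda>M. \<forall>\<alpha>\<in>\<Lambda>. \<forall>\<beta>\<in>\<Lambda>. leq \<alpha> \<beta> \<longrightarrow> monic (Ab r) (fob M \<alpha>) (fob M \<beta>) (fmor M \<alpha> \<beta> \<one>\<^bsub>R\<^esub>))"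

definition Preglid ::
  "'u rel \<Rightarrow> ('g, 'a) monoid_scheme \<Rightarrow> ('g \<Rightarrow> 'g \<Rightarrow> bool) \<Rightarrow> ('c, 'b) ring_scheme \<Rightarrow> ('g \<Rightarrow> 'c set)
    \<Rightarrow> 'g set \<Rightarrow> (('g option, 'c, 'u monoid, 'u \<Rightarrow> 'u) func, 'g option \<Rightarrow> 'u \<Rightarrow> 'u) precat" where
  "Preglid r \<Gamma> leq R F \<Lambda> =
     full_subcategory (additive_functor_category (filt_cat_inf \<Gamma> leq R F \<Lambda>) (Ab r))
       (\<lambda>M. \<forall>a\<in>insert None (Some ` \<Lambda>). \<forall>b\<in>insert None (Some ` \<Lambda>).
          leq_inf leq a b \<longrightarrow> monic (Ab r) (fob M a) (fob M b) (fmor M a b \<one>\<^bsub>R\<^esub>))"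

end

theory Submission
  imports Defs
begin

text \<open>
  Both categories are instances of one construction: modules over a small preadditive category
  on which a given set \<open>W\<close> of arrows acts injectively.  These modules form a torsion-free class,
  closed under submodules, extensions and filtered direct limits.  Kernel maps in it are the
  injections whose image \<open>U\<close> is saturated, that is, \<open>w x \<in> U\<close> implies \<open>x \<in> U\<close> for \<open>w \<in> W\<close>, and
  cokernel maps are the surjections.  A surjection pulls back to a surjection because
  pullbacks are computed on elements; for a kernel map, the pushout of modules is already
  torsion-free, so the pushout is again a kernel map.  Filtered direct limits are computed on
  elements, which gives exactness.  A quotient of a finitely generated free module by the
  saturated closure of finitely many relations is finitely presentable, and every module is the
  direct limit of such quotients over its finite sets of elements and relations.
\<close>

section \<open>Small sets\<close>

text \<open>Objects have carriers in the fixed type \<open>'u\<close>, while products, quotients,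
  free modules and direct limits naturally live on pairs, cosets, coefficient families and classes.
  Modules are therefore allowed any element type, and a small one is moved to \<open>'u\<close> by a
  map whose fibres are the wanted classes; the size conditions on \<open>r\<close> guarantee such a
  map. A second obstacle is that pullbacks, pushouts and colimits are given only by their universal
  property: each is compared with a concrete model through the maps which that property yields. A
  cokernel map must be onto because its image, a submodule of an object, is an object through which
  it already factors. The quotient by a submodule is torsion-free exactly when the submodule is
  saturated, so cokernels and presentations divide by a saturated closure. This closure may fail to
  be finitely generated, yet a linear map into a torsion-free module that kills the given relations
  kills all of it; hence finitely many relations still give a finitely presentable object.\<close>

locale universe =
  fixes r :: "'u rel"
  assumes universe: "universe_card r"
begin

abbreviation small :: "'x set \<Rightarrow> bool" where
  "small A \<equiv> |A| <o r"

lemma Card_order_r: "Card_order r" and natLeq_r: "natLeq <o r"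
  using universe by (auto simp: universe_card_def)

lemma infinite_Field_r: "infinite (Field r)"
  using cinfinite_mono[OF ordLess_imp_ordLeq[OF natLeq_r] natLeq_cinfinite]
  by (simp add: cinfinite_def)

text \<open>Regularity of an infinite cardinal is the same as closure of smallness under small
  dependent sums. The closure properties for sums and unions below come from it.\<close>

lemma stable_r: "stable r"
  using universe infinite_Field_r by (auto simp: universe_card_def intro: regularCard_stable)

lemma small_mono: "|A| \<le>o |B| \<Longrightarrow> small B \<Longrightarrow> small A"
  by (rule ordLeq_ordLess_trans)

lemma small_subset: "small B \<Longrightarrow> A \<subseteq> B \<Longrightarrow> small A"
  using small_mono card_of_mono1 by blast

lemma small_image: "small A \<Longrightarrow> small (f ` A)"
  using small_mono card_of_image by blast

lemma small_inj_on: "inj_on f A \<Longrightarrow> f ` A \<subseteq> B \<Longrightarrow> small B \<Longrightarrow> small A"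
  using small_mono card_of_ordLeq by blast

lemma small_finite: "finite A \<Longrightarrow> small A"
  using finite_ordLess_infinite[OF card_of_Well_order, of r A] Card_order_r infinite_Field_r
  by (simp add: Field_card_of card_order_on_def)

lemma small_nat: "small (UNIV :: nat set)"
  using card_of_nat natLeq_r ordIso_ordLess_trans by blast

lemma small_Sigma: "small A \<Longrightarrow> (\<And>a. a \<in> A \<Longrightarrow> small (B a)) \<Longrightarrow> small (Sigma A B)"
  using stable_elim[OF stable_r] by blast

lemma small_UN: "small A \<Longrightarrow> (\<And>a. a \<in> A \<Longrightarrow> small (B a)) \<Longrightarrow> small (\<Union>a\<in>A. B a)"
  using stable_UNION[OF stable_r] by blast

lemma small_Times: "small A \<Longrightarrow> small B \<Longrightarrow> small (A \<times> B)"
  by (rule small_Sigma)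

lemma small_PiE:
  assumes "finite S" "\<And>s. s \<in> S \<Longrightarrow> small (B s)"
  shows "small (Pi\<^sub>E S B)"
  using assms
proof (induction S rule: finite_induct)
  case empty
  show ?case by (simp add: small_finite)
next
  case (insert s S)
  have "Pi\<^sub>E (insert s S) B = (\<lambda>(y, g). g(s := y)) ` (B s \<times> Pi\<^sub>E S B)"
    by (rule PiE_insert_eq)
  then show ?case
    using insert by (auto intro!: small_image small_Times)
qed

text \<open>A finite subset of size n + 1 arises by inserting an element into one of size n, so each
  size contributes a small set. The union over all sizes is indexed by the natural numbers, which
  are small because \<open>r\<close> is uncountable.\<close>

lemma small_Fpow:
  assumes "small A"
  shows "small (Fpow A)"
proof -
  have *: "small {S. S \<subseteq> A \<and> finite S \<and> card S = n}" for n
  proof (induction n)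
    case 0
    have "{S. S \<subseteq> A \<and> finite S \<and> card S = 0} \<subseteq> {{}}" by auto
    then show ?case by (rule small_subset[OF small_finite, rotated]) simp
  next
    case (Suc n)
    have "{S. S \<subseteq> A \<and> finite S \<and> card S = Suc n}
        \<subseteq> (\<lambda>(x, S). insert x S) ` (A \<times> {S. S \<subseteq> A \<and> finite S \<and> card S = n})"
    proof
      fix S assume S: "S \<in> {S. S \<subseteq> A \<and> finite S \<and> card S = Suc n}"
      then obtain x T where "S = insert x T" "x \<notin> T" "card T = n"
        by (auto simp: card_Suc_eq)
      with S have "S = (\<lambda>(x, S). insert x S) (x, T)"
          "(x, T) \<in> A \<times> {S. S \<subseteq> A \<and> finite S \<and> card S = n}"
        by auto
      then show "S \<in> (\<lambda>(x, S). insert x S) ` (A \<times> {S. S \<subseteq> A \<and> finite S \<and> card S = n})"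
        by (rule image_eqI)
    qed
    then show ?case
      by (rule small_subset[OF small_image[OF small_Times[OF assms Suc.IH]]])
  qed
  have "Fpow A = (\<Union>n. {S. S \<subseteq> A \<and> finite S \<and> card S = n})"
    by (auto simp: Fpow_def)
  moreover have "small (\<Union>n. {S. S \<subseteq> A \<and> finite S \<and> card S = n})"
    by (rule small_UN[OF small_nat]) (rule *)
  ultimately show ?thesis
    by simp
qed

text \<open>\<open>r\<close> is a cardinal order on its field, a subset of \<open>'u\<close>, so a
  set of cardinality below \<open>r\<close> injects into that field. This is how constructed
  modules, and the index set of a diagram, get onto the type \<open>'u\<close>.\<close>

lemma small_embed:
  assumes "small A"
  obtains e :: "'x \<Rightarrow> 'u" where "inj_on e (A :: 'x set)"
proof -
  have "|A| \<le>o |Field r|"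
    using assms Card_order_r
    using ordLeq_ordIso_trans[OF ordLess_imp_ordLeq ordIso_symmetric[OF card_of_Field_ordIso]]
    by blast
  then show ?thesis
    using that card_of_ordLeq[of A "Field r"] by blast
qed

text \<open>Plays the role of the quotient map: \<open>e\<close> has the classes as its fibres but
  takes values in \<open>'u\<close>, where the classes themselves would have a set type. Quotient
  modules and direct limits are both built on it.\<close>

lemma small_class_map:
  assumes "small (E :: 'x set)" "equiv E R"
  shows "\<exists>e :: 'x \<Rightarrow> 'u. \<forall>x\<in>E. \<forall>y\<in>E. e x = e y \<longleftrightarrow> (x, y) \<in> R"
proof -
  have "small (E // R)"
    unfolding quotient_def by (rule small_UN[OF assms(1)]) (simp add: small_finite)
  then obtain f :: "'x set \<Rightarrow> 'u" where f: "inj_on f (E // R)"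
    using small_embed by blast
  show ?thesis
    using f by (intro exI[of _ "\<lambda>x. f (R `` {x})"])
      (simp add: inj_on_eq_iff quotientI eq_equiv_class_iff[OF assms(2)])
qed

end

section \<open>Modules over a preadditive category\<close>

lemma comm_groupI_inv:
  fixes G (structure)
  assumes "\<And>x y. x \<in> carrier G \<Longrightarrow> y \<in> carrier G \<Longrightarrow> x \<otimes> y \<in> carrier G" "\<one> \<in> carrier G"
    and "\<And>x y z. x \<in> carrier G \<Longrightarrow> y \<in> carrier G \<Longrightarrow> z \<in> carrier G
      \<Longrightarrow> (x \<otimes> y) \<otimes> z = x \<otimes> (y \<otimes> z)"
    and "\<And>x y. x \<in> carrier G \<Longrightarrow> y \<in> carrier G \<Longrightarrow> x \<otimes> y = y \<otimes> x"
    and "\<And>x. x \<in> carrier G \<Longrightarrow> \<one> \<otimes> x = x"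
    and "\<And>x. x \<in> carrier G \<Longrightarrow> i x \<in> carrier G" "\<And>x. x \<in> carrier G \<Longrightarrow> i x \<otimes> x = \<one>"
  shows "comm_group G"
proof (rule comm_groupI)
  fix x assume "x \<in> carrier G"
  then show "\<exists>y\<in>carrier G. y \<otimes> x = \<one>"
    using assms(6,7) by (intro bexI[of _ "i x"])
qed (rule assms; assumption)+

text \<open>An arrow in \<open>W\<close> carries its endpoints because the morphism sets of
  \<open>A\<close> may overlap. Smallness of \<open>A\<close> makes finitely generated free modules
  small, and likewise the set of all elements of a module.\<close>

locale torsionfree_modules = universe r + preadditive_category A
  for r :: "'u rel" and A :: "('o, 'm, 'z) precat_scheme" +
  fixes W :: "('o \<times> 'o \<times> 'm) set"
  assumes W_arrow: "(a, b, w) \<in> W \<Longrightarrow> a \<in> Ob A \<and> b \<in> Ob A \<and> w \<in> Hom A a b"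
    and small_Ob: "small (Ob A)"
    and small_Hom: "a \<in> Ob A \<Longrightarrow> b \<in> Ob A \<Longrightarrow> small (Hom A a b)"
begin

section \<open>Modules, linear maps, submodules and products on arbitrary element types\<close>

abbreviation el :: "('o, 'm, 'x monoid, 'x \<Rightarrow> 'x) func \<Rightarrow> 'o \<Rightarrow> 'x set" where
  "el M a \<equiv> carrier (fob M a)"

text \<open>An additive functor to abelian groups, except that the element type is arbitrary,
  smallness is not asked, and the action may take any values outside the carrier. Modules of pairs
  or of coefficient families fit here before they are moved to \<open>'u\<close>.\<close>

definition amod :: "('o, 'm, 'x monoid, 'x \<Rightarrow> 'x) func \<Rightarrow> bool" where
  "amod M \<longleftrightarrow> (\<forall>a\<in>Ob A. comm_group (fob M a)) \<and>
     (\<forall>a\<in>Ob A. \<forall>b\<in>Ob A. \<forall>f\<in>Hom A a b. fmor M a b f \<in> hom (fob M a) (fob M b)) \<and>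
     (\<forall>a\<in>Ob A. \<forall>x\<in>el M a. fmor M a a (Idt A a) x = x) \<and>
     (\<forall>a\<in>Ob A. \<forall>b\<in>Ob A. \<forall>c\<in>Ob A. \<forall>f\<in>Hom A a b. \<forall>g\<in>Hom A b c. \<forall>x\<in>el M a.
        fmor M a c (Cmp A a b c g f) x = fmor M b c g (fmor M a b f x)) \<and>
     (\<forall>a\<in>Ob A. \<forall>b\<in>Ob A. \<forall>f\<in>Hom A a b. \<forall>g\<in>Hom A a b. \<forall>x\<in>el M a.
        fmor M a b (Plus A a b f g) x = fmor M a b f x \<otimes>\<^bsub>fob M b\<^esub> fmor M a b g x)"

text \<open>Source and target may have different element types, and only values on carriers matter;
  a morphism of \<open>TF\<close> is a linear map that is extensional as well.\<close>

definition alin :: "('o, 'm, 'x monoid, 'x \<Rightarrow> 'x) func \<Rightarrow> ('o, 'm, 'y monoid, 'y \<Rightarrow> 'y) func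
    \<Rightarrow> ('o \<Rightarrow> 'x \<Rightarrow> 'y) \<Rightarrow> bool" where
  "alin M N \<eta> \<longleftrightarrow> (\<forall>a\<in>Ob A. \<eta> a \<in> hom (fob M a) (fob N a)) \<and>
     (\<forall>a\<in>Ob A. \<forall>b\<in>Ob A. \<forall>f\<in>Hom A a b. \<forall>x\<in>el M a. \<eta> b (fmor M a b f x) = fmor N a b f (\<eta> a x))"

definition asub :: "('o, 'm, 'x monoid, 'x \<Rightarrow> 'x) func \<Rightarrow> ('o \<Rightarrow> 'x set) \<Rightarrow> bool" where
  "asub M U \<longleftrightarrow> (\<forall>a\<in>Ob A. subgroup (U a) (fob M a)) \<and>
     (\<forall>a\<in>Ob A. \<forall>b\<in>Ob A. \<forall>f\<in>Hom A a b. \<forall>x\<in>U a. fmor M a b f x \<in> U b)"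

text \<open>Shrinking the carrier alone would leave an action that is not extensional on it; the
  \<open>restrict\<close> makes a submodule of an object of \<open>TF\<close> again an
  object.\<close>

definition submod :: "('o, 'm, 'x monoid, 'x \<Rightarrow> 'x) func \<Rightarrow> ('o \<Rightarrow> 'x set)
    \<Rightarrow> ('o, 'm, 'x monoid, 'x \<Rightarrow> 'x) func" where
  "submod M U = \<lparr>fob = (\<lambda>a. (fob M a)\<lparr>carrier := U a\<rparr>), fmor = (\<lambda>a b f. restrict (fmor M a b f) (U a))\<rparr>"

definition prodmod :: "('o, 'm, 'x monoid, 'x \<Rightarrow> 'x) func \<Rightarrow> ('o, 'm, 'y monoid, 'y \<Rightarrow> 'y) func
    \<Rightarrow> ('o, 'm, ('x \<times> 'y) monoid, 'x \<times> 'y \<Rightarrow> 'x \<times> 'y) func" where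
  "prodmod M N = \<lparr>fob = (\<lambda>a. fob M a \<times>\<times> fob N a),
     fmor = (\<lambda>a b f. map_prod (fmor M a b f) (fmor N a b f))\<rparr>"

definition tfree :: "('o, 'm, 'x monoid, 'x \<Rightarrow> 'x) func \<Rightarrow> bool" where
  "tfree M \<longleftrightarrow> (\<forall>(a, b, w)\<in>W. inj_on (fmor M a b w) (el M a))"

text \<open>For a submodule \<open>U\<close>, the condition that the quotient by \<open>U\<close> be
  torsion-free, expressed without forming the quotient.\<close>

definition saturated :: "('o, 'm, 'x monoid, 'x \<Rightarrow> 'x) func \<Rightarrow> ('o \<Rightarrow> 'x set) \<Rightarrow> bool" where
  "saturated M U \<longleftrightarrow> (\<forall>(a, b, w)\<in>W. \<forall>x\<in>el M a. fmor M a b w x \<in> U b \<longrightarrow> x \<in> U a)"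

definition TF :: "(('o, 'm, 'u monoid, 'u \<Rightarrow> 'u) func, 'o \<Rightarrow> 'u \<Rightarrow> 'u) precat" where
  "TF = full_subcategory (additive_functor_category A (Ab r)) tfree"

section \<open>Elementary calculus of elements\<close>

lemma amod_group: "amod M \<Longrightarrow> a \<in> Ob A \<Longrightarrow> comm_group (fob M a)"
  by (simp add: amod_def)

lemma amod_hom: "amod M \<Longrightarrow> a \<in> Ob A \<Longrightarrow> b \<in> Ob A \<Longrightarrow> f \<in> Hom A a b
    \<Longrightarrow> fmor M a b f \<in> hom (fob M a) (fob M b)"
  by (simp add: amod_def)

lemma mult_closed: "amod M \<Longrightarrow> a \<in> Ob A \<Longrightarrow> x \<in> el M a \<Longrightarrow> y \<in> el M a \<Longrightarrow> x \<otimes>\<^bsub>fob M a\<^esub> y \<in> el M a"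
  by (drule (1) amod_group) (simp add: comm_groupE)

lemma one_closed: "amod M \<Longrightarrow> a \<in> Ob A \<Longrightarrow> \<one>\<^bsub>fob M a\<^esub> \<in> el M a"
  by (drule (1) amod_group) (simp add: comm_groupE)

lemma inv_closed: "amod M \<Longrightarrow> a \<in> Ob A \<Longrightarrow> x \<in> el M a \<Longrightarrow> inv\<^bsub>fob M a\<^esub> x \<in> el M a"
  by (drule (1) amod_group) (simp add: comm_group_def)

lemma act_closed: "amod M \<Longrightarrow> a \<in> Ob A \<Longrightarrow> b \<in> Ob A \<Longrightarrow> f \<in> Hom A a b \<Longrightarrow> x \<in> el M a
    \<Longrightarrow> fmor M a b f x \<in> el M b"
  by (rule hom_in_carrier[OF amod_hom])

lemma act_mult: "amod M \<Longrightarrow> a \<in> Ob A \<Longrightarrow> b \<in> Ob A \<Longrightarrow> f \<in> Hom A a b \<Longrightarrow> x \<in> el M a \<Longrightarrow> y \<in> el M a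
    \<Longrightarrow> fmor M a b f (x \<otimes>\<^bsub>fob M a\<^esub> y) = fmor M a b f x \<otimes>\<^bsub>fob M b\<^esub> fmor M a b f y"
  by (rule hom_mult[OF amod_hom])

lemma act_group_hom: "amod M \<Longrightarrow> a \<in> Ob A \<Longrightarrow> b \<in> Ob A \<Longrightarrow> f \<in> Hom A a b
    \<Longrightarrow> group_hom (fob M a) (fob M b) (fmor M a b f)"
  by (simp add: group_hom_def group_hom_axioms_def amod_hom amod_group comm_group.axioms)

lemma act_one: "amod M \<Longrightarrow> a \<in> Ob A \<Longrightarrow> b \<in> Ob A \<Longrightarrow> f \<in> Hom A a b
    \<Longrightarrow> fmor M a b f \<one>\<^bsub>fob M a\<^esub> = \<one>\<^bsub>fob M b\<^esub>"
  by (rule group_hom.hom_one[OF act_group_hom])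

lemma act_inv: "amod M \<Longrightarrow> a \<in> Ob A \<Longrightarrow> b \<in> Ob A \<Longrightarrow> f \<in> Hom A a b \<Longrightarrow> x \<in> el M a
    \<Longrightarrow> fmor M a b f (inv\<^bsub>fob M a\<^esub> x) = inv\<^bsub>fob M b\<^esub> (fmor M a b f x)"
  by (rule group_hom.hom_inv[OF act_group_hom])

lemma act_Idt: "amod M \<Longrightarrow> a \<in> Ob A \<Longrightarrow> x \<in> el M a \<Longrightarrow> fmor M a a (Idt A a) x = x"
  by (simp add: amod_def)

lemma act_Cmp: "amod M \<Longrightarrow> a \<in> Ob A \<Longrightarrow> b \<in> Ob A \<Longrightarrow> c \<in> Ob A \<Longrightarrow> f \<in> Hom A a b \<Longrightarrow> g \<in> Hom A b c
    \<Longrightarrow> x \<in> el M a \<Longrightarrow> fmor M a c (Cmp A a b c g f) x = fmor M b c g (fmor M a b f x)"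
  by (simp add: amod_def)

lemma act_Plus: "amod M \<Longrightarrow> a \<in> Ob A \<Longrightarrow> b \<in> Ob A \<Longrightarrow> f \<in> Hom A a b \<Longrightarrow> g \<in> Hom A a b
    \<Longrightarrow> x \<in> el M a \<Longrightarrow> fmor M a b (Plus A a b f g) x = fmor M a b f x \<otimes>\<^bsub>fob M b\<^esub> fmor M a b g x"
  by (simp add: amod_def)

lemma Zer_in: "a \<in> Ob A \<Longrightarrow> b \<in> Ob A \<Longrightarrow> Zer A a b \<in> Hom A a b"
  and Plus_in: "a \<in> Ob A \<Longrightarrow> b \<in> Ob A \<Longrightarrow> f \<in> Hom A a b \<Longrightarrow> g \<in> Hom A a b \<Longrightarrow> Plus A a b f g \<in> Hom A a b"
  and Plus_Zer_left: "a \<in> Ob A \<Longrightarrow> b \<in> Ob A \<Longrightarrow> f \<in> Hom A a b \<Longrightarrow> Plus A a b (Zer A a b) f = f"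
  using comm_groupE[OF Hom_group[of a b]] by (simp_all add: hom_group_def)

lemma idem_one: "comm_group G \<Longrightarrow> x \<in> carrier G \<Longrightarrow> x \<otimes>\<^bsub>G\<^esub> x = x \<Longrightarrow> x = \<one>\<^bsub>G\<^esub>"
  by (simp add: comm_group_def group.l_cancel_one)

text \<open>Zero plus zero is zero, so the image is idempotent, and the only idempotent of a group
  is its unit.\<close>

lemma act_Zer: "amod M \<Longrightarrow> a \<in> Ob A \<Longrightarrow> b \<in> Ob A \<Longrightarrow> x \<in> el M a
    \<Longrightarrow> fmor M a b (Zer A a b) x = \<one>\<^bsub>fob M b\<^esub>"
  by (rule idem_one) (simp_all add: amod_group act_closed Zer_in act_Plus[symmetric] Plus_Zer_left)

lemma lin_closed: "alin M N \<eta> \<Longrightarrow> a \<in> Ob A \<Longrightarrow> x \<in> el M a \<Longrightarrow> \<eta> a x \<in> el N a"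
  by (auto simp: alin_def hom_def)

lemma lin_mult: "alin M N \<eta> \<Longrightarrow> a \<in> Ob A \<Longrightarrow> x \<in> el M a \<Longrightarrow> y \<in> el M a
    \<Longrightarrow> \<eta> a (x \<otimes>\<^bsub>fob M a\<^esub> y) = \<eta> a x \<otimes>\<^bsub>fob N a\<^esub> \<eta> a y"
  by (auto simp: alin_def hom_def)

lemma lin_act: "alin M N \<eta> \<Longrightarrow> a \<in> Ob A \<Longrightarrow> b \<in> Ob A \<Longrightarrow> f \<in> Hom A a b \<Longrightarrow> x \<in> el M a
    \<Longrightarrow> \<eta> b (fmor M a b f x) = fmor N a b f (\<eta> a x)"
  by (auto simp: alin_def)

lemma lin_group_hom: "amod M \<Longrightarrow> amod N \<Longrightarrow> alin M N \<eta> \<Longrightarrow> a \<in> Ob A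
    \<Longrightarrow> group_hom (fob M a) (fob N a) (\<eta> a)"
  by (simp add: group_hom_def group_hom_axioms_def alin_def amod_group comm_group.axioms)

lemma lin_one: "amod M \<Longrightarrow> amod N \<Longrightarrow> alin M N \<eta> \<Longrightarrow> a \<in> Ob A \<Longrightarrow> \<eta> a \<one>\<^bsub>fob M a\<^esub> = \<one>\<^bsub>fob N a\<^esub>"
  by (rule group_hom.hom_one[OF lin_group_hom])

lemma lin_inv: "amod M \<Longrightarrow> amod N \<Longrightarrow> alin M N \<eta> \<Longrightarrow> a \<in> Ob A \<Longrightarrow> x \<in> el M a
    \<Longrightarrow> \<eta> a (inv\<^bsub>fob M a\<^esub> x) = inv\<^bsub>fob N a\<^esub> (\<eta> a x)"
  by (rule group_hom.hom_inv[OF lin_group_hom])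

lemma alinI:
  assumes "\<And>a x. a \<in> Ob A \<Longrightarrow> x \<in> el M a \<Longrightarrow> \<eta> a x \<in> el N a"
    and "\<And>a x y. a \<in> Ob A \<Longrightarrow> x \<in> el M a \<Longrightarrow> y \<in> el M a
      \<Longrightarrow> \<eta> a (x \<otimes>\<^bsub>fob M a\<^esub> y) = \<eta> a x \<otimes>\<^bsub>fob N a\<^esub> \<eta> a y"
    and "\<And>a b f x. a \<in> Ob A \<Longrightarrow> b \<in> Ob A \<Longrightarrow> f \<in> Hom A a b \<Longrightarrow> x \<in> el M a
      \<Longrightarrow> \<eta> b (fmor M a b f x) = fmor N a b f (\<eta> a x)"
  shows "alin M N \<eta>"
  using assms by (auto simp: alin_def hom_def)

lemma lin_compose: "alin L M \<eta> \<Longrightarrow> alin M N \<theta> \<Longrightarrow> alin L N (\<lambda>a x. \<theta> a (\<eta> a x))"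
  by (rule alinI) (simp_all add: lin_closed lin_mult lin_act)

lemma div_eq_one_iff:
  "comm_group G \<Longrightarrow> x \<in> carrier G \<Longrightarrow> y \<in> carrier G \<Longrightarrow> x \<otimes>\<^bsub>G\<^esub> inv\<^bsub>G\<^esub> y = \<one>\<^bsub>G\<^esub> \<longleftrightarrow> x = y"
  by (metis comm_group_def group.inv_closed group.inv_equality group.inv_inv group.r_inv)

lemma lin_inj_onI:
  assumes "amod M" "amod N" "alin M N \<eta>" "a \<in> Ob A"
    and "\<And>x. x \<in> el M a \<Longrightarrow> \<eta> a x = \<one>\<^bsub>fob N a\<^esub> \<Longrightarrow> x = \<one>\<^bsub>fob M a\<^esub>"
  shows "inj_on (\<eta> a) (el M a)"
proof (rule inj_onI)
  fix x y assume x: "x \<in> el M a" and y: "y \<in> el M a" and eq: "\<eta> a x = \<eta> a y"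
  have "\<eta> a (x \<otimes>\<^bsub>fob M a\<^esub> inv\<^bsub>fob M a\<^esub> y) = \<one>\<^bsub>fob N a\<^esub>"
    using assms(1-4) x y eq
    by (simp add: lin_mult[OF assms(3)] lin_inv inv_closed div_eq_one_iff amod_group lin_closed[OF assms(3)])
  then show "x = y"
    using assms x y by (metis div_eq_one_iff amod_group inv_closed mult_closed)
qed

lemma tfreeD: "tfree M \<Longrightarrow> amod M \<Longrightarrow> (a, b, w) \<in> W \<Longrightarrow> x \<in> el M a \<Longrightarrow> fmor M a b w x = \<one>\<^bsub>fob M b\<^esub>
    \<Longrightarrow> x = \<one>\<^bsub>fob M a\<^esub>"
  using W_arrow[of a b w] act_one[of M a b w] one_closed[of M a]
  by (auto simp: tfree_def inj_on_def)

lemma tfreeI: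
  assumes "amod M"
    and "\<And>a b w x. (a, b, w) \<in> W \<Longrightarrow> x \<in> el M a \<Longrightarrow> fmor M a b w x = \<one>\<^bsub>fob M b\<^esub> \<Longrightarrow> x = \<one>\<^bsub>fob M a\<^esub>"
  shows "tfree M"
  unfolding tfree_def
proof (clarify, rule inj_onI)
  fix a b w x y
  assume w: "(a, b, w) \<in> W" and x: "x \<in> el M a" and y: "y \<in> el M a"
    and eq: "fmor M a b w x = fmor M a b w y"
  note [simp] = W_arrow[OF w, THEN conjunct1] W_arrow[OF w, THEN conjunct2, THEN conjunct1]
    W_arrow[OF w, THEN conjunct2, THEN conjunct2]
  have "fmor M a b w (x \<otimes>\<^bsub>fob M a\<^esub> inv\<^bsub>fob M a\<^esub> y) = \<one>\<^bsub>fob M b\<^esub>"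
    using assms(1) x y eq
    by (simp add: act_mult act_inv inv_closed div_eq_one_iff amod_group act_closed)
  then have "x \<otimes>\<^bsub>fob M a\<^esub> inv\<^bsub>fob M a\<^esub> y = \<one>\<^bsub>fob M a\<^esub>"
    using assms x y w by (simp add: inv_closed mult_closed)
  then show "x = y"
    using assms(1) x y by (simp add: div_eq_one_iff amod_group)
qed

section \<open>Submodules and binary products\<close>

lemma asubD:
  assumes "asub M U" "a \<in> Ob A"
  shows "x \<in> U a \<Longrightarrow> x \<in> el M a" "\<one>\<^bsub>fob M a\<^esub> \<in> U a"
    "x \<in> U a \<Longrightarrow> y \<in> U a \<Longrightarrow> x \<otimes>\<^bsub>fob M a\<^esub> y \<in> U a"
    "x \<in> U a \<Longrightarrow> inv\<^bsub>fob M a\<^esub> x \<in> U a"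
    "b \<in> Ob A \<Longrightarrow> f \<in> Hom A a b \<Longrightarrow> x \<in> U a \<Longrightarrow> fmor M a b f x \<in> U b"
  using assms subgroup.subset[of "U a" "fob M a"]
  by (auto simp: asub_def subgroup.one_closed subgroup.m_closed subgroup.m_inv_closed)

lemma asubI:
  assumes M: "amod M"
    and "\<And>a x. a \<in> Ob A \<Longrightarrow> x \<in> U a \<Longrightarrow> x \<in> el M a" "\<And>a. a \<in> Ob A \<Longrightarrow> \<one>\<^bsub>fob M a\<^esub> \<in> U a"
    and "\<And>a x y. a \<in> Ob A \<Longrightarrow> x \<in> U a \<Longrightarrow> y \<in> U a \<Longrightarrow> x \<otimes>\<^bsub>fob M a\<^esub> y \<in> U a"
    and "\<And>a x. a \<in> Ob A \<Longrightarrow> x \<in> U a \<Longrightarrow> inv\<^bsub>fob M a\<^esub> x \<in> U a"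
    and "\<And>a b f x. a \<in> Ob A \<Longrightarrow> b \<in> Ob A \<Longrightarrow> f \<in> Hom A a b \<Longrightarrow> x \<in> U a \<Longrightarrow> fmor M a b f x \<in> U b"
  shows "asub M U"
  unfolding asub_def
proof (intro conjI ballI group.subgroupI comm_group.axioms(2) amod_group)
  fix a assume "a \<in> Ob A"
  then show "U a \<noteq> {}" using assms(3) by blast
qed (use assms in auto)

lemma submod_simps [simp]:
  "el (submod M U) a = U a" "x \<otimes>\<^bsub>fob (submod M U) a\<^esub> y = x \<otimes>\<^bsub>fob M a\<^esub> y"
  "\<one>\<^bsub>fob (submod M U) a\<^esub> = \<one>\<^bsub>fob M a\<^esub>"
  "x \<in> U a \<Longrightarrow> fmor (submod M U) a b f x = fmor M a b f x"
  by (simp_all add: submod_def)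

lemma amodI:
  assumes "\<And>a. a \<in> Ob A \<Longrightarrow> comm_group (fob M a)"
    and "\<And>a b f x. a \<in> Ob A \<Longrightarrow> b \<in> Ob A \<Longrightarrow> f \<in> Hom A a b \<Longrightarrow> x \<in> el M a \<Longrightarrow> fmor M a b f x \<in> el M b"
    and "\<And>a b f x y. a \<in> Ob A \<Longrightarrow> b \<in> Ob A \<Longrightarrow> f \<in> Hom A a b \<Longrightarrow> x \<in> el M a \<Longrightarrow> y \<in> el M a
      \<Longrightarrow> fmor M a b f (x \<otimes>\<^bsub>fob M a\<^esub> y) = fmor M a b f x \<otimes>\<^bsub>fob M b\<^esub> fmor M a b f y"
    and "\<And>a x. a \<in> Ob A \<Longrightarrow> x \<in> el M a \<Longrightarrow> fmor M a a (Idt A a) x = x"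
    and "\<And>a b c f g x. a \<in> Ob A \<Longrightarrow> b \<in> Ob A \<Longrightarrow> c \<in> Ob A \<Longrightarrow> f \<in> Hom A a b \<Longrightarrow> g \<in> Hom A b c
      \<Longrightarrow> x \<in> el M a \<Longrightarrow> fmor M a c (Cmp A a b c g f) x = fmor M b c g (fmor M a b f x)"
    and "\<And>a b f g x. a \<in> Ob A \<Longrightarrow> b \<in> Ob A \<Longrightarrow> f \<in> Hom A a b \<Longrightarrow> g \<in> Hom A a b
      \<Longrightarrow> x \<in> el M a \<Longrightarrow> fmor M a b (Plus A a b f g) x = fmor M a b f x \<otimes>\<^bsub>fob M b\<^esub> fmor M a b g x"
  shows "amod M"
  using assms by (auto simp: amod_def hom_def)

lemma amod_submod:
  assumes M: "amod M" and U: "asub M U"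
  shows "amod (submod M U)"
proof (rule amodI)
  fix a assume a: "a \<in> Ob A"
  interpret G: comm_group "fob M a" by (rule amod_group[OF M a])
  show "comm_group (fob (submod M U) a)"
    by (rule comm_groupI_inv[where i = "\<lambda>x. inv\<^bsub>fob M a\<^esub> x"])
      (simp_all add: asubD[OF U a] G.m_assoc, simp add: G.m_comm asubD(1)[OF U a])
qed (simp_all add: asubD[OF U] act_mult[OF M] act_Idt[OF M] act_Cmp[OF M] act_Plus[OF M])

lemma alin_submod: "asub M U \<Longrightarrow> alin (submod M U) M (\<lambda>a x. x)"
  by (rule alinI) (simp_all add: asubD)

lemma tfree_submod:
  assumes "asub M U" "tfree M"
  shows "tfree (submod M U)"
  unfolding tfree_def
proof clarify
  fix a b w assume w: "(a, b, w) \<in> W"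
  then have "inj_on (fmor M a b w) (U a)"
    using assms asubD(1)[OF assms(1)] W_arrow[OF w]
    by (auto simp: tfree_def intro: inj_on_subset)
  then show "inj_on (fmor (submod M U) a b w) (el (submod M U) a)"
    by (simp add: submod_def inj_on_def)
qed

lemma prodmod_simps [simp]:
  "el (prodmod M N) a = el M a \<times> el N a"
  "p \<otimes>\<^bsub>fob (prodmod M N) a\<^esub> q = (fst p \<otimes>\<^bsub>fob M a\<^esub> fst q, snd p \<otimes>\<^bsub>fob N a\<^esub> snd q)"
  "\<one>\<^bsub>fob (prodmod M N) a\<^esub> = (\<one>\<^bsub>fob M a\<^esub>, \<one>\<^bsub>fob N a\<^esub>)"
  "fmor (prodmod M N) a b f p = (fmor M a b f (fst p), fmor N a b f (snd p))"
  by (simp_all add: prodmod_def mult_DirProd' map_prod_def split_beta)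

lemma amod_prodmod:
  assumes M: "amod M" and N: "amod N"
  shows "amod (prodmod M N)"
proof (rule amodI)
  fix a assume a: "a \<in> Ob A"
  interpret G: comm_group "fob M a" by (rule amod_group[OF M a])
  interpret H: comm_group "fob N a" by (rule amod_group[OF N a])
  show "comm_group (fob (prodmod M N) a)"
    by (rule comm_groupI_inv[where i = "\<lambda>p. (inv\<^bsub>fob M a\<^esub> (fst p), inv\<^bsub>fob N a\<^esub> (snd p))"])
      (auto simp: G.m_ac H.m_ac)
qed (auto simp: act_closed[OF M] act_closed[OF N] act_mult[OF M] act_Idt[OF M] act_Cmp[OF M] act_Plus[OF M]
    act_mult[OF N] act_Idt[OF N] act_Cmp[OF N] act_Plus[OF N])

lemma inv_prodmod:
  assumes M: "amod M" and N: "amod N" and a: "a \<in> Ob A" and "x \<in> el M a" "y \<in> el N a"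
  shows "inv\<^bsub>fob (prodmod M N) a\<^esub> (x, y) = (inv\<^bsub>fob M a\<^esub> x, inv\<^bsub>fob N a\<^esub> y)"
  using assms by (simp add: prodmod_def amod_group comm_group.axioms)

lemma tfree_prodmod: "tfree M \<Longrightarrow> tfree N \<Longrightarrow> tfree (prodmod M N)"
  by (fastforce simp: tfree_def inj_on_def)

text \<open>Cosets are replaced by codes in \<open>'u\<close>: \<open>e a\<close> identifies two
  elements precisely when their difference lies in \<open>N a\<close>, and operations on codes go
  through the representatives chosen by \<open>s\<close>. The element type of \<open>E\<close> is
  left behind, so one construction serves both for quotients and for a mere change of
  carrier.\<close>

lemma quotient_module:
  fixes E :: "('o, 'm, 'x monoid, 'x \<Rightarrow> 'x) func"
  assumes E: "amod E" and small: "\<And>a. a \<in> Ob A \<Longrightarrow> small (el E a)" and N: "asub E N"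
  obtains Q :: "('o, 'm, 'u monoid, 'u \<Rightarrow> 'u) func" and \<pi> where "amod Q" "alin E Q \<pi>"
    "\<And>a. a \<in> Ob A \<Longrightarrow> el Q a = \<pi> a ` el E a"
    "\<And>a x. a \<in> Ob A \<Longrightarrow> x \<in> el E a \<Longrightarrow> \<pi> a x = \<one>\<^bsub>fob Q a\<^esub> \<longleftrightarrow> x \<in> N a"
    "\<And>a b f. fmor Q a b f \<in> extensional (el Q a)"
proof -
  define D where "D a x y \<longleftrightarrow> x \<otimes>\<^bsub>fob E a\<^esub> inv\<^bsub>fob E a\<^esub> y \<in> N a" for a x y
  have "\<exists>e :: 'x \<Rightarrow> 'u. \<forall>x\<in>el E a. \<forall>y\<in>el E a. e x = e y \<longleftrightarrow> D a x y" if a: "a \<in> Ob A" for a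
  proof -
    interpret G: comm_group "fob E a" by (rule amod_group[OF E a])
    have sub: "subgroup (N a) (fob E a)" using N a by (simp add: asub_def)
    have eq: "equiv (el E a) {(x, y). x \<in> el E a \<and> y \<in> el E a \<and> D a x y}"
    proof (rule equivI)
      show "{(x, y). x \<in> el E a \<and> y \<in> el E a \<and> D a x y} \<subseteq> el E a \<times> el E a" by auto
      show "refl_on (el E a) {(x, y). x \<in> el E a \<and> y \<in> el E a \<and> D a x y}"
        using asubD(2)[OF N a] by (auto simp: refl_on_def D_def)
      show "sym {(x, y). x \<in> el E a \<and> y \<in> el E a \<and> D a x y}"
      proof (rule symI, clarify)
        fix x y assume xy: "x \<in> el E a" "y \<in> el E a" "D a x y"
        have "inv\<^bsub>fob E a\<^esub> (x \<otimes>\<^bsub>fob E a\<^esub> inv\<^bsub>fob E a\<^esub> y) = y \<otimes>\<^bsub>fob E a\<^esub> inv\<^bsub>fob E a\<^esub> x"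
          using xy by (simp add: G.inv_mult_group)
        then show "D a y x"
          using asubD(4)[OF N a] xy(3) unfolding D_def by metis
      qed
      show "trans {(x, y). x \<in> el E a \<and> y \<in> el E a \<and> D a x y}"
      proof (rule transI, clarify)
        fix x y z assume xyz: "x \<in> el E a" "y \<in> el E a" "z \<in> el E a" "D a x y" "D a y z"
        have "inv\<^bsub>fob E a\<^esub> y \<otimes>\<^bsub>fob E a\<^esub> (y \<otimes>\<^bsub>fob E a\<^esub> inv\<^bsub>fob E a\<^esub> z) = inv\<^bsub>fob E a\<^esub> z"
          using xyz(1-3) by (metis G.m_assoc G.inv_closed G.l_inv G.l_one)
        then have "(x \<otimes>\<^bsub>fob E a\<^esub> inv\<^bsub>fob E a\<^esub> y) \<otimes>\<^bsub>fob E a\<^esub> (y \<otimes>\<^bsub>fob E a\<^esub> inv\<^bsub>fob E a\<^esub> z)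
            = x \<otimes>\<^bsub>fob E a\<^esub> inv\<^bsub>fob E a\<^esub> z"
          using xyz(1-3) by (metis G.m_assoc G.inv_closed G.m_closed)
        then show "D a x z"
          using asubD(3)[OF N a] xyz(4,5) unfolding D_def by metis
      qed
    qed
    show ?thesis
      using small_class_map[OF small[OF a] eq] by simp
  qed
  then obtain e :: "'o \<Rightarrow> 'x \<Rightarrow> 'u" where
    e: "\<And>a x y. a \<in> Ob A \<Longrightarrow> x \<in> el E a \<Longrightarrow> y \<in> el E a \<Longrightarrow> e a x = e a y \<longleftrightarrow> D a x y"
    by metis
  \<comment> \<open>Any section of \<open>e a\<close> will do: only the coset of the representative
    matters, and it is the right one by the next fact.\<close>
  define s where "s a = inv_into (el E a) (e a)" for a
  have s: "s a (e a x) \<in> el E a" "D a (s a (e a x)) x" if "a \<in> Ob A" "x \<in> el E a" for a x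
    using that inv_into_into[of "e a x" "e a" "el E a"] f_inv_into_f[of "e a x" "e a" "el E a"]
      e[of a "s a (e a x)" x] by (auto simp: s_def)
  define Q :: "('o, 'm, 'u monoid, 'u \<Rightarrow> 'u) func" where
    "Q = \<lparr>fob = (\<lambda>a. \<lparr>carrier = e a ` el E a, mult = (\<lambda>p q. e a (s a p \<otimes>\<^bsub>fob E a\<^esub> s a q)), one = e a \<one>\<^bsub>fob E a\<^esub>\<rparr>),
      fmor = (\<lambda>a b f. \<lambda>p\<in>e a ` el E a. e b (fmor E a b f (s a p)))\<rparr>"
  have Q_el: "el Q a = e a ` el E a" and Q_one: "\<one>\<^bsub>fob Q a\<^esub> = e a \<one>\<^bsub>fob E a\<^esub>" for a
    by (simp_all add: Q_def)
  have Q_mult: "e a x \<otimes>\<^bsub>fob Q a\<^esub> e a y = e a (x \<otimes>\<^bsub>fob E a\<^esub> y)"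
    if a: "a \<in> Ob A" and x: "x \<in> el E a" and y: "y \<in> el E a" for a x y
  proof -
    interpret G: comm_group "fob E a" by (rule amod_group[OF E a])
    let ?x = "s a (e a x)" and ?y = "s a (e a y)"
    have *: "?x \<in> el E a" "?y \<in> el E a" by (simp_all add: s a x y)
    \<comment> \<open>The error of a product of representatives is the product of their errors,
      which lies in \<open>N a\<close>.\<close>
    then have "(?x \<otimes>\<^bsub>fob E a\<^esub> ?y) \<otimes>\<^bsub>fob E a\<^esub> inv\<^bsub>fob E a\<^esub> (x \<otimes>\<^bsub>fob E a\<^esub> y)
        = (?x \<otimes>\<^bsub>fob E a\<^esub> inv\<^bsub>fob E a\<^esub> x) \<otimes>\<^bsub>fob E a\<^esub> (?y \<otimes>\<^bsub>fob E a\<^esub> inv\<^bsub>fob E a\<^esub> y)"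
      using x y by (simp add: G.inv_mult G.m_ac)
    then have "D a (?x \<otimes>\<^bsub>fob E a\<^esub> ?y) (x \<otimes>\<^bsub>fob E a\<^esub> y)"
      using asubD(3)[OF N a] s(2)[OF a x] s(2)[OF a y] unfolding D_def by metis
    then have "e a (?x \<otimes>\<^bsub>fob E a\<^esub> ?y) = e a (x \<otimes>\<^bsub>fob E a\<^esub> y)"
      using e[OF a] * x y by simp
    then show ?thesis by (simp add: Q_def)
  qed
  have Q_act: "fmor Q a b f (e a x) = e b (fmor E a b f x)"
    if a: "a \<in> Ob A" and b: "b \<in> Ob A" and f: "f \<in> Hom A a b" and x: "x \<in> el E a" for a b f x
  proof -
    let ?x = "s a (e a x)"
    have *: "?x \<in> el E a" by (simp add: s a x)
    \<comment> \<open>The action is additive and preserves \<open>N\<close>, so it carries the error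
      of the representative into \<open>N b\<close>.\<close>
    have "D b (fmor E a b f ?x) (fmor E a b f x)"
      using asubD(5)[OF N a b f s(2)[OF a x, unfolded D_def]] * x
      unfolding D_def by (simp add: act_mult[OF E a b f] act_inv[OF E a b f] inv_closed[OF E a])
    then have "e b (fmor E a b f ?x) = e b (fmor E a b f x)"
      using e[OF b] * x act_closed[OF E a b f] by simp
    then show ?thesis using x by (simp add: Q_def)
  qed
  have "amod Q"
  proof (rule amodI)
    fix a assume a: "a \<in> Ob A"
    interpret G: comm_group "fob E a" by (rule amod_group[OF E a])
    show "comm_group (fob Q a)"
    proof (rule comm_groupI_inv[where i = "\<lambda>p. e a (inv\<^bsub>fob E a\<^esub> (s a p))"])
      fix p assume "p \<in> el Q a"
      then obtain x where x: "p = e a x" "x \<in> el E a" by (auto simp: Q_el)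
      then have "p = e a (s a p)"
        using s[OF a x(2)] e[OF a s(1)[OF a x(2)] x(2)] by simp
      moreover have "s a p \<in> el E a" using s[OF a] x by simp
      ultimately show "e a (inv\<^bsub>fob E a\<^esub> (s a p)) \<in> el Q a"
        "e a (inv\<^bsub>fob E a\<^esub> (s a p)) \<otimes>\<^bsub>fob Q a\<^esub> p = \<one>\<^bsub>fob Q a\<^esub>"
        by (auto simp: Q_el Q_one) (metis G.inv_closed G.l_inv Q_mult[OF a])
    qed (auto simp: Q_el Q_mult[OF a] Q_one G.m_ac)
  qed (auto simp: Q_el Q_mult Q_act act_closed[OF E] mult_closed[OF E] act_mult[OF E] act_Idt[OF E] Idt_in
      act_Cmp[OF E] Cmp_in act_Plus[OF E] Plus_in)
  moreover have "alin E Q e"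
    by (rule alinI) (auto simp: Q_el Q_mult Q_act)
  moreover have "e a x = \<one>\<^bsub>fob Q a\<^esub> \<longleftrightarrow> x \<in> N a" if a: "a \<in> Ob A" and x: "x \<in> el E a" for a x
  proof -
    interpret G: comm_group "fob E a" by (rule amod_group[OF E a])
    show ?thesis using x by (simp add: Q_one e[OF a] D_def)
  qed
  moreover have "fmor Q a b f \<in> extensional (el Q a)" for a b f
    by (simp add: Q_def)
  ultimately show ?thesis using that[of Q e] Q_el by blast
qed

section \<open>The category of torsion-free modules\<close>

text \<open>Morphisms of \<open>Ab\<close> are extensional functions, so a functor equation between
  them is a pointwise equation on the carrier; extensionality of each \<open>fmor X a b f\<close>
  survives as a clause of its own.\<close>

lemma TF_Ob: "X \<in> Ob TF \<longleftrightarrow> amod X \<and> (\<forall>a\<in>Ob A. small (el X a)) \<and>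
    (\<forall>a\<in>Ob A. \<forall>b\<in>Ob A. \<forall>f\<in>Hom A a b. fmor X a b f \<in> extensional (el X a)) \<and> tfree X"
proof -
  have "is_additive_functor A (Ab r) X \<longleftrightarrow> amod X \<and> (\<forall>a\<in>Ob A. small (el X a)) \<and>
    (\<forall>a\<in>Ob A. \<forall>b\<in>Ob A. \<forall>f\<in>Hom A a b. fmor X a b f \<in> extensional (el X a))" (is "_ \<longleftrightarrow> ?R")
  proof
    assume "is_additive_functor A (Ab r) X"
    then interpret is_additive_functor A "Ab r" X .
    have ob: "comm_group (fob X a)" "small (el X a)" if "a \<in> Ob A" for a
      using fob_in[OF that] by (auto simp: Ab_def)
    have mor: "fmor X a b f \<in> hom (fob X a) (fob X b)" "fmor X a b f \<in> extensional (el X a)"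
      if "a \<in> Ob A" "b \<in> Ob A" "f \<in> Hom A a b" for a b f
      using fmor_in[OF that] by (auto simp: Ab_def)
    have "amod X"
    proof (rule amodI)
      fix a b c f g x
      assume *: "a \<in> Ob A" "b \<in> Ob A" "c \<in> Ob A" "f \<in> Hom A a b" "g \<in> Hom A b c" "x \<in> el X a"
      show "fmor X a c (Cmp A a b c g f) x = fmor X b c g (fmor X a b f x)"
        using fmor_Cmp[OF *(1-5)] *(6) by (simp add: Ab_def)
    next
      fix a b f g x
      assume *: "a \<in> Ob A" "b \<in> Ob A" "f \<in> Hom A a b" "g \<in> Hom A a b" "x \<in> el X a"
      show "fmor X a b (Plus A a b f g) x = fmor X a b f x \<otimes>\<^bsub>fob X b\<^esub> fmor X a b g x"
        using fmor_Plus[OF *(1-4)] *(5) by (simp add: Ab_def)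
    qed (use ob mor fmor_Idt in \<open>auto simp: Ab_def hom_def Pi_iff\<close>)
    then show ?R using ob mor by blast
  next
    assume R: ?R
    then have X: "amod X" by blast
    show "is_additive_functor A (Ab r) X"
    proof unfold_locales
      fix a b c f g
      assume *: "a \<in> Ob A" "b \<in> Ob A" "c \<in> Ob A" "f \<in> Hom A a b" "g \<in> Hom A b c"
      have "fmor X a c (Cmp A a b c g f) \<in> extensional (el X a)"
        using R * Cmp_in by blast
      then show "fmor X a c (Cmp A a b c g f)
          = Cmp (Ab r) (fob X a) (fob X b) (fob X c) (fmor X b c g) (fmor X a b f)"
        by (intro extensionalityI[of _ "el X a"]) (simp_all add: Ab_def act_Cmp[OF X *])
    next
      fix a b f g
      assume *: "a \<in> Ob A" "b \<in> Ob A" "f \<in> Hom A a b" "g \<in> Hom A a b"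
      have "fmor X a b (Plus A a b f g) \<in> extensional (el X a)"
        using R * Plus_in by blast
      then show "fmor X a b (Plus A a b f g) = Plus (Ab r) (fob X a) (fob X b) (fmor X a b f) (fmor X a b g)"
        by (intro extensionalityI[of _ "el X a"]) (simp_all add: Ab_def act_Plus[OF X *])
    next
      fix a assume *: "a \<in> Ob A"
      have "fmor X a a (Idt A a) \<in> extensional (el X a)"
        using R * Idt_in by blast
      then show "fmor X a a (Idt A a) = Idt (Ab r) (fob X a)"
        by (intro extensionalityI[of _ "el X a"]) (simp_all add: Ab_def act_Idt[OF X *])
    qed (use R amod_group[OF X] amod_hom[OF X] in \<open>auto simp: Ab_def\<close>)
  qed
  then show ?thesis
    by (auto simp: TF_def full_subcategory_def additive_functor_category_def)
qed

lemma TF_amod [simp]: "X \<in> Ob TF \<Longrightarrow> amod X" and TF_tfree: "X \<in> Ob TF \<Longrightarrow> tfree X"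
  and TF_small: "X \<in> Ob TF \<Longrightarrow> a \<in> Ob A \<Longrightarrow> small (el X a)"
  by (simp_all add: TF_Ob)

text \<open>Naturality in \<open>Ab\<close> is linearity on elements. Extensionality occurs at two
  levels: for the family outside \<open>Ob A\<close>, and for each component outside its
  carrier.\<close>

lemma TF_Hom:
  assumes X: "X \<in> Ob TF" and Y: "Y \<in> Ob TF"
  shows "\<eta> \<in> Hom TF X Y \<longleftrightarrow> alin X Y \<eta> \<and> \<eta> \<in> extensional (Ob A) \<and> (\<forall>a\<in>Ob A. \<eta> a \<in> extensional (el X a))"
proof -
  have *: "(\<forall>a\<in>Ob A. \<forall>b\<in>Ob A. \<forall>f\<in>Hom A a b. \<forall>x\<in>el X a. \<eta> b (fmor X a b f x) = fmor Y a b f (\<eta> a x)) \<longleftrightarrow>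
    (\<forall>a\<in>Ob A. \<forall>b\<in>Ob A. \<forall>f\<in>Hom A a b. Cmp (Ab r) (fob X a) (fob X b) (fob Y b) (\<eta> b) (fmor X a b f)
      = Cmp (Ab r) (fob X a) (fob Y a) (fob Y b) (fmor Y a b f) (\<eta> a))"
    by (simp add: Ab_def restrict_def fun_eq_iff) blast
  show ?thesis
    unfolding alin_def *
    by (auto simp: TF_def full_subcategory_def additive_functor_category_def nat_trans_def PiE_iff Ab_def)
qed

lemma TF_Hom_lin: "X \<in> Ob TF \<Longrightarrow> Y \<in> Ob TF \<Longrightarrow> \<eta> \<in> Hom TF X Y \<Longrightarrow> alin X Y \<eta>"
  by (simp add: TF_Hom)

lemma TF_Hom_ext:
  assumes "X \<in> Ob TF" "Y \<in> Ob TF" "Y' \<in> Ob TF" "\<eta> \<in> Hom TF X Y" "\<theta> \<in> Hom TF X Y'"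
    and "\<And>a x. a \<in> Ob A \<Longrightarrow> x \<in> el X a \<Longrightarrow> \<eta> a x = \<theta> a x"
  shows "\<eta> = \<theta>"
proof (rule extensionalityI)
  show "\<eta> \<in> extensional (Ob A)" "\<theta> \<in> extensional (Ob A)"
    using assms TF_Hom by blast+
  fix a assume "a \<in> Ob A"
  then show "\<eta> a = \<theta> a"
    using assms by (intro extensionalityI[of _ "el X a"]) (simp_all add: TF_Hom)
qed

text \<open>Cuts a family of maps down to its extensional representative, so that a morphism can be
  given by any formula that is correct on elements.\<close>

definition mor :: "('o, 'm, 'u monoid, 'u \<Rightarrow> 'u) func \<Rightarrow> ('o \<Rightarrow> 'u \<Rightarrow> 'u) \<Rightarrow> 'o \<Rightarrow> 'u \<Rightarrow> 'u" where
  "mor X \<eta> = (\<lambda>a\<in>Ob A. \<lambda>x\<in>el X a. \<eta> a x)"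

lemma mor_apply [simp]: "a \<in> Ob A \<Longrightarrow> x \<in> el X a \<Longrightarrow> mor X \<eta> a x = \<eta> a x"
  by (simp add: mor_def)

lemma mor_in:
  assumes "X \<in> Ob TF" "Y \<in> Ob TF" "alin X Y \<eta>"
  shows "mor X \<eta> \<in> Hom TF X Y"
  unfolding TF_Hom[OF assms(1,2)]
proof (intro conjI alinI ballI)
  fix a b f x assume "a \<in> Ob A" "b \<in> Ob A" "f \<in> Hom A a b" "x \<in> el X a"
  then show "mor X \<eta> b (fmor X a b f x) = fmor Y a b f (mor X \<eta> a x)"
    using assms by (simp add: act_closed lin_act)
next
  fix a x y assume "a \<in> Ob A" "x \<in> el X a" "y \<in> el X a"
  then show "mor X \<eta> a (x \<otimes>\<^bsub>fob X a\<^esub> y) = mor X \<eta> a x \<otimes>\<^bsub>fob Y a\<^esub> mor X \<eta> a y"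
    using assms by (simp add: mult_closed lin_mult)
qed (use assms in \<open>auto simp: mor_def lin_closed\<close>)

lemma TF_Idt: "Idt TF X = mor X (\<lambda>a x. x)"
  and TF_Cmp: "Cmp TF X Y Z \<theta> \<eta> = mor X (\<lambda>a x. \<theta> a (\<eta> a x))"
  and TF_Plus: "Plus TF X Y \<eta> \<zeta> = mor X (\<lambda>a x. \<eta> a x \<otimes>\<^bsub>fob Y a\<^esub> \<zeta> a x)"
  and TF_Zer: "Zer TF X Y = mor X (\<lambda>a x. \<one>\<^bsub>fob Y a\<^esub>)"
  by (simp_all add: TF_def full_subcategory_def additive_functor_category_def Ab_def mor_def)

lemma mor_cong: "(\<And>a x. a \<in> Ob A \<Longrightarrow> x \<in> el X a \<Longrightarrow> \<eta> a x = \<theta> a x) \<Longrightarrow> mor X \<eta> = mor X \<theta>"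
  by (auto simp: mor_def restrict_def fun_eq_iff)

lemma mor_eq_iff: "mor X \<eta> = mor X \<theta> \<longleftrightarrow> (\<forall>a\<in>Ob A. \<forall>x\<in>el X a. \<eta> a x = \<theta> a x)"
  by (metis mor_apply mor_cong)

lemma eq_mor_iff:
  assumes "X \<in> Ob TF" "Y \<in> Ob TF" "\<eta> \<in> Hom TF X Y"
  shows "mor X \<theta> = \<eta> \<longleftrightarrow> (\<forall>a\<in>Ob A. \<forall>x\<in>el X a. \<theta> a x = \<eta> a x)"
proof -
  have "mor X \<eta> = \<eta>"
    by (rule TF_Hom_ext[OF assms(1,2,2) mor_in assms(3)]) (use assms in \<open>simp_all add: TF_Hom\<close>)
  then show ?thesis using mor_eq_iff by metis
qed

lemma alin_id: "alin X X (\<lambda>a x. x)" and alin_one: "amod Y \<Longrightarrow> alin X Y (\<lambda>a x. \<one>\<^bsub>fob Y a\<^esub>)"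
  by (rule alinI; simp add: one_closed act_one amod_group comm_groupE)+

lemma alin_mult:
  assumes Y: "amod Y" and "alin X Y \<eta>" "alin X Y \<theta>"
  shows "alin X Y (\<lambda>a x. \<eta> a x \<otimes>\<^bsub>fob Y a\<^esub> \<theta> a x)"
proof (rule alinI)
  fix a x y assume a: "a \<in> Ob A" and xy: "x \<in> el X a" "y \<in> el X a"
  interpret G: comm_group "fob Y a" by (rule amod_group[OF Y a])
  show "\<eta> a (x \<otimes>\<^bsub>fob X a\<^esub> y) \<otimes>\<^bsub>fob Y a\<^esub> \<theta> a (x \<otimes>\<^bsub>fob X a\<^esub> y)
      = (\<eta> a x \<otimes>\<^bsub>fob Y a\<^esub> \<theta> a x) \<otimes>\<^bsub>fob Y a\<^esub> (\<eta> a y \<otimes>\<^bsub>fob Y a\<^esub> \<theta> a y)"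
    using assms a xy by (simp add: lin_mult[of X Y] lin_closed[of X Y] G.m_ac)
qed (use assms in \<open>simp_all add: mult_closed lin_closed[of X Y] lin_act[of X Y] act_mult\<close>)

lemma alin_inv:
  assumes Y: "amod Y" and "alin X Y \<eta>"
  shows "alin X Y (\<lambda>a x. inv\<^bsub>fob Y a\<^esub> \<eta> a x)"
proof (rule alinI)
  fix a x y assume a: "a \<in> Ob A" and xy: "x \<in> el X a" "y \<in> el X a"
  interpret G: comm_group "fob Y a" by (rule amod_group[OF Y a])
  show "inv\<^bsub>fob Y a\<^esub> \<eta> a (x \<otimes>\<^bsub>fob X a\<^esub> y) = inv\<^bsub>fob Y a\<^esub> \<eta> a x \<otimes>\<^bsub>fob Y a\<^esub> inv\<^bsub>fob Y a\<^esub> \<eta> a y"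
    using assms a xy by (simp add: lin_mult[of X Y] lin_closed[of X Y] G.inv_mult)
qed (use assms in \<open>simp_all add: inv_closed lin_closed[of X Y] lin_act[of X Y] act_inv\<close>)

lemma TF_Cmp_in: "X \<in> Ob TF \<Longrightarrow> Y \<in> Ob TF \<Longrightarrow> Z \<in> Ob TF \<Longrightarrow> \<eta> \<in> Hom TF X Y \<Longrightarrow> \<theta> \<in> Hom TF Y Z
    \<Longrightarrow> Cmp TF X Y Z \<theta> \<eta> \<in> Hom TF X Z"
  unfolding TF_Cmp by (rule mor_in) (auto intro: lin_compose TF_Hom_lin)

section \<open>The preadditive structure\<close>

lemma preadditive_TF: "preadditive_category TF"
proof (intro preadditive_category.intro category.intro preadditive_category_axioms.intro)
  fix X assume "X \<in> Ob TF"
  then show "Idt TF X \<in> Hom TF X X"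
    unfolding TF_Idt by (intro mor_in alin_id)
next
  fix X Y Z \<eta> \<theta>
  assume "X \<in> Ob TF" "Y \<in> Ob TF" "Z \<in> Ob TF" "\<eta> \<in> Hom TF X Y" "\<theta> \<in> Hom TF Y Z"
  then show "Cmp TF X Y Z \<theta> \<eta> \<in> Hom TF X Z" by (rule TF_Cmp_in)
next
  fix X Y \<eta> assume *: "X \<in> Ob TF" "Y \<in> Ob TF" "\<eta> \<in> Hom TF X Y"
  then show "Cmp TF X X Y \<eta> (Idt TF X) = \<eta>"
    unfolding TF_Cmp TF_Idt by (simp add: eq_mor_iff[of X Y])
  show "Cmp TF X Y Y (Idt TF Y) \<eta> = \<eta>"
    unfolding TF_Cmp TF_Idt using * lin_closed[OF TF_Hom_lin[OF *]] by (simp add: eq_mor_iff[of X Y])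
next
  fix V X Y Z \<zeta> \<eta> \<theta>
  assume *: "V \<in> Ob TF" "X \<in> Ob TF" "Y \<in> Ob TF" "Z \<in> Ob TF" "\<zeta> \<in> Hom TF V X" "\<eta> \<in> Hom TF X Y" "\<theta> \<in> Hom TF Y Z"
  show "Cmp TF V Y Z \<theta> (Cmp TF V X Y \<eta> \<zeta>) = Cmp TF V X Z (Cmp TF X Y Z \<theta> \<eta>) \<zeta>"
    unfolding TF_Cmp mor_eq_iff using lin_closed[OF TF_Hom_lin[OF *(1,2,5)]] by simp
next
  fix X Y assume X: "X \<in> Ob TF" and Y: "Y \<in> Ob TF"
  show "comm_group (hom_group TF X Y)"
  proof (rule comm_groupI_inv[where i = "\<lambda>\<eta>. mor X (\<lambda>a x. inv\<^bsub>fob Y a\<^esub> \<eta> a x)"])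
    fix \<eta> assume "\<eta> \<in> carrier (hom_group TF X Y)"
    then have \<eta>: "\<eta> \<in> Hom TF X Y" by (simp add: hom_group_def)
    note [simp] = lin_closed[OF TF_Hom_lin[OF X Y \<eta>]]
    show "\<one>\<^bsub>hom_group TF X Y\<^esub> \<otimes>\<^bsub>hom_group TF X Y\<^esub> \<eta> = \<eta>"
      using X Y \<eta> by (simp add: hom_group_def TF_Plus TF_Zer eq_mor_iff[of X Y] comm_groupE(5)[OF amod_group])
    show "mor X (\<lambda>a x. inv\<^bsub>fob Y a\<^esub> \<eta> a x) \<in> carrier (hom_group TF X Y)"
      using X Y by (simp add: hom_group_def mor_in alin_inv TF_Hom_lin[OF X Y \<eta>])
    show "mor X (\<lambda>a x. inv\<^bsub>fob Y a\<^esub> \<eta> a x) \<otimes>\<^bsub>hom_group TF X Y\<^esub> \<eta> = \<one>\<^bsub>hom_group TF X Y\<^esub>"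
      using X Y by (simp add: hom_group_def TF_Plus TF_Zer mor_eq_iff group.l_inv[OF comm_group.axioms(2)[OF amod_group]])
  next
    fix \<eta> \<theta> assume "\<eta> \<in> carrier (hom_group TF X Y)" "\<theta> \<in> carrier (hom_group TF X Y)"
    then have *: "\<eta> \<in> Hom TF X Y" "\<theta> \<in> Hom TF X Y" by (simp_all add: hom_group_def)
    note lin = TF_Hom_lin[OF X Y *(1)] TF_Hom_lin[OF X Y *(2)]
    show "\<eta> \<otimes>\<^bsub>hom_group TF X Y\<^esub> \<theta> \<in> carrier (hom_group TF X Y)"
      using X Y by (simp add: hom_group_def TF_Plus mor_in alin_mult lin)
    show "\<eta> \<otimes>\<^bsub>hom_group TF X Y\<^esub> \<theta> = \<theta> \<otimes>\<^bsub>hom_group TF X Y\<^esub> \<eta>"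
      using Y by (simp add: hom_group_def TF_Plus mor_eq_iff comm_groupE(4)[OF amod_group] lin[THEN lin_closed])
  next
    fix \<eta> \<theta> \<zeta>
    assume "\<eta> \<in> carrier (hom_group TF X Y)" "\<theta> \<in> carrier (hom_group TF X Y)" "\<zeta> \<in> carrier (hom_group TF X Y)"
    then have *: "\<eta> \<in> Hom TF X Y" "\<theta> \<in> Hom TF X Y" "\<zeta> \<in> Hom TF X Y" by (simp_all add: hom_group_def)
    show "\<eta> \<otimes>\<^bsub>hom_group TF X Y\<^esub> \<theta> \<otimes>\<^bsub>hom_group TF X Y\<^esub> \<zeta> = \<eta> \<otimes>\<^bsub>hom_group TF X Y\<^esub> (\<theta> \<otimes>\<^bsub>hom_group TF X Y\<^esub> \<zeta>)"
      using Y *[THEN TF_Hom_lin[OF X Y], THEN lin_closed]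
      by (simp add: hom_group_def TF_Plus mor_eq_iff comm_groupE(3)[OF amod_group])
  next
    show "\<one>\<^bsub>hom_group TF X Y\<^esub> \<in> carrier (hom_group TF X Y)"
      using X Y by (simp add: hom_group_def TF_Zer mor_in alin_one)
  qed
next
  fix X Y Z \<eta> \<eta>' \<theta>
  assume *: "X \<in> Ob TF" "Y \<in> Ob TF" "Z \<in> Ob TF" "\<eta> \<in> Hom TF X Y" "\<eta>' \<in> Hom TF X Y" "\<theta> \<in> Hom TF Y Z"
  then show "Cmp TF X Y Z \<theta> (Plus TF X Y \<eta> \<eta>') = Plus TF X Z (Cmp TF X Y Z \<theta> \<eta>) (Cmp TF X Y Z \<theta> \<eta>')"
    by (simp add: TF_Cmp TF_Plus mor_eq_iff TF_Hom lin_mult[of Y Z] lin_closed[of X Y])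
next
  fix X Y Z \<eta> \<theta> \<theta>'
  assume *: "X \<in> Ob TF" "Y \<in> Ob TF" "Z \<in> Ob TF" "\<eta> \<in> Hom TF X Y" "\<theta> \<in> Hom TF Y Z" "\<theta>' \<in> Hom TF Y Z"
  then show "Cmp TF X Y Z (Plus TF Y Z \<theta> \<theta>') \<eta> = Plus TF X Z (Cmp TF X Y Z \<theta> \<eta>) (Cmp TF X Y Z \<theta>' \<eta>)"
    by (simp add: TF_Cmp TF_Plus mor_eq_iff TF_Hom lin_closed[of X Y])
qed

text \<open>Saturation of \<open>N\<close> gives torsion-freeness: if \<open>w\<close> annihilates
  the class of \<open>x\<close>, then \<open>w x\<close> lies in \<open>N\<close>, hence so does
  \<open>x\<close>, and the class was zero.\<close>

lemma quotient_object:
  fixes E :: "('o, 'm, 'x monoid, 'x \<Rightarrow> 'x) func"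
  assumes E: "amod E" and small: "\<And>a. a \<in> Ob A \<Longrightarrow> small (el E a)" and N: "asub E N" "saturated E N"
  obtains Q \<pi> where "Q \<in> Ob TF" "alin E Q \<pi>"
    "\<And>a. a \<in> Ob A \<Longrightarrow> el Q a = \<pi> a ` el E a"
    "\<And>a x. a \<in> Ob A \<Longrightarrow> x \<in> el E a \<Longrightarrow> \<pi> a x = \<one>\<^bsub>fob Q a\<^esub> \<longleftrightarrow> x \<in> N a"
proof (rule quotient_module[OF E small N(1)])
  fix Q :: "('o, 'm, 'u monoid, 'u \<Rightarrow> 'u) func" and \<pi>
  assume Q: "amod Q" "alin E Q \<pi>" "\<And>a. a \<in> Ob A \<Longrightarrow> el Q a = \<pi> a ` el E a"
    "\<And>a x. a \<in> Ob A \<Longrightarrow> x \<in> el E a \<Longrightarrow> \<pi> a x = \<one>\<^bsub>fob Q a\<^esub> \<longleftrightarrow> x \<in> N a"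
    "\<And>a b f. fmor Q a b f \<in> extensional (el Q a)"
  have "tfree Q"
  proof (rule tfreeI[OF Q(1)])
    fix a b w q assume w: "(a, b, w) \<in> W" and q: "q \<in> el Q a" "fmor Q a b w q = \<one>\<^bsub>fob Q b\<^esub>"
    note * = W_arrow[OF w]
    obtain x where x: "x \<in> el E a" "q = \<pi> a x" using q Q(3) * by auto
    have "fmor E a b w x \<in> N b"
      using q x * Q(4)[of b "fmor E a b w x"] by (simp add: act_closed[OF E] lin_act[OF Q(2)])
    then have "x \<in> N a" using N(2) w x by (auto simp: saturated_def)
    then show "q = \<one>\<^bsub>fob Q a\<^esub>" using Q(4)[of a x] x * by simp
  qed
  moreover have "small (el Q a)" if "a \<in> Ob A" for a
    using Q(3)[OF that] small[OF that] by (simp add: small_image)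
  ultimately have "Q \<in> Ob TF" using Q(1,5) by (simp add: TF_Ob)
  then show ?thesis using that Q by blast
qed

text \<open>A linear map descends along the surjection \<pi> as soon as it vanishes wherever \<pi>
  does. Since \<open>E\<close> may have any element type, this also produces maps out of products
  and free modules that were moved to \<open>'u\<close>.\<close>

lemma factor_through_quotient:
  fixes E :: "('o, 'm, 'x monoid, 'x \<Rightarrow> 'x) func"
  assumes E: "amod E" and Q: "Q \<in> Ob TF" and \<pi>: "alin E Q \<pi>"
    and surj: "\<And>a. a \<in> Ob A \<Longrightarrow> el Q a = \<pi> a ` el E a"
    and Y: "Y \<in> Ob TF" and \<psi>: "alin E Y \<psi>"
    and ker: "\<And>a x. a \<in> Ob A \<Longrightarrow> x \<in> el E a \<Longrightarrow> \<pi> a x = \<one>\<^bsub>fob Q a\<^esub> \<Longrightarrow> \<psi> a x = \<one>\<^bsub>fob Y a\<^esub>"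
  obtains h where "h \<in> Hom TF Q Y" "\<And>a x. a \<in> Ob A \<Longrightarrow> x \<in> el E a \<Longrightarrow> h a (\<pi> a x) = \<psi> a x"
proof -
  define h where "h a q = \<psi> a (inv_into (el E a) (\<pi> a) q)" for a q
  have h: "h a (\<pi> a x) = \<psi> a x" if a: "a \<in> Ob A" and x: "x \<in> el E a" for a x
  proof -
    define y where "y = inv_into (el E a) (\<pi> a) (\<pi> a x)"
    have y: "y \<in> el E a" "\<pi> a y = \<pi> a x"
      using x unfolding y_def by (auto intro: inv_into_into f_inv_into_f)
    \<comment> \<open>Two preimages of one element differ by an element of the kernel of \<pi>,
      where \<psi> vanishes.\<close>
    have "\<pi> a (y \<otimes>\<^bsub>fob E a\<^esub> inv\<^bsub>fob E a\<^esub> x) = \<one>\<^bsub>fob Q a\<^esub>"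
      using a x y Q E by (simp add: lin_mult[OF \<pi>] lin_inv[OF _ _ \<pi>] inv_closed lin_closed[OF \<pi>]
          div_eq_one_iff amod_group)
    then have "\<psi> a (y \<otimes>\<^bsub>fob E a\<^esub> inv\<^bsub>fob E a\<^esub> x) = \<one>\<^bsub>fob Y a\<^esub>"
      using a x y E by (simp add: ker inv_closed mult_closed)
    then have "\<psi> a y = \<psi> a x"
      using a x y Y E by (simp add: lin_mult[OF \<psi>] lin_inv[OF _ _ \<psi>] inv_closed lin_closed[OF \<psi>]
          div_eq_one_iff amod_group)
    then show ?thesis by (simp add: h_def y_def)
  qed
  have "alin Q Y h"
  proof (rule alinI)
    fix a p assume a: "a \<in> Ob A" and "p \<in> el Q a"
    then obtain x where x: "p = \<pi> a x" "x \<in> el E a" using surj by auto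
    then show "h a p \<in> el Y a" using a by (simp add: h lin_closed[OF \<psi>])
    { fix q assume "q \<in> el Q a"
      then obtain y where y: "q = \<pi> a y" "y \<in> el E a" using surj a by auto
      have "h a (\<pi> a (x \<otimes>\<^bsub>fob E a\<^esub> y)) = h a p \<otimes>\<^bsub>fob Y a\<^esub> h a q"
        using x y a E by (simp add: h mult_closed lin_mult[OF \<psi>])
      then show "h a (p \<otimes>\<^bsub>fob Q a\<^esub> q) = h a p \<otimes>\<^bsub>fob Y a\<^esub> h a q"
        using x y a by (simp add: lin_mult[OF \<pi>]) }
    fix b f assume bf: "b \<in> Ob A" "f \<in> Hom A a b"
    have "h b (\<pi> b (fmor E a b f x)) = fmor Y a b f (h a p)"
      using x a bf E by (simp add: h act_closed lin_act[OF \<psi>])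
    then show "h b (fmor Q a b f p) = fmor Y a b f (h a p)"
      using x a bf by (simp add: lin_act[OF \<pi>])
  qed
  then have "mor Q h \<in> Hom TF Q Y" by (rule mor_in[OF Q Y])
  moreover have "mor Q h a (\<pi> a x) = \<psi> a x" if "a \<in> Ob A" "x \<in> el E a" for a x
    using that surj by (simp add: h)
  ultimately show ?thesis using that by blast
qed

section \<open>Subobjects, images and saturated closures\<close>

lemma submod_in_TF:
  assumes X: "X \<in> Ob TF" and U: "asub X U"
  shows "submod X U \<in> Ob TF"
  using assms amod_submod[of X U] tfree_submod[OF U] asubD(1)[OF U]
  by (auto simp: TF_Ob submod_def[of X U] intro: small_subset)

definition incl :: "('o, 'm, 'u monoid, 'u \<Rightarrow> 'u) func \<Rightarrow> ('o \<Rightarrow> 'u set) \<Rightarrow> 'o \<Rightarrow> 'u \<Rightarrow> 'u" where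
  "incl X U = mor (submod X U) (\<lambda>a x. x)"

lemma incl_in: "X \<in> Ob TF \<Longrightarrow> asub X U \<Longrightarrow> incl X U \<in> Hom TF (submod X U) X"
  unfolding incl_def by (intro mor_in submod_in_TF alin_submod)

lemma incl_apply [simp]: "a \<in> Ob A \<Longrightarrow> x \<in> U a \<Longrightarrow> incl X U a x = x"
  by (simp add: incl_def)

text \<open>Extensionality of a morphism refers to its source only, so the very same function is a
  morphism into any submodule containing its values.\<close>

lemma corestrict_in:
  assumes Y: "Y \<in> Ob TF" and U: "asub Y U" and X: "X \<in> Ob TF" and \<eta>: "\<eta> \<in> Hom TF X Y"
    and im: "\<And>a x. a \<in> Ob A \<Longrightarrow> x \<in> el X a \<Longrightarrow> \<eta> a x \<in> U a"
  shows "\<eta> \<in> Hom TF X (submod Y U)"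
  using \<eta> im unfolding TF_Hom[OF X Y] TF_Hom[OF X submod_in_TF[OF Y U]]
  by (auto intro!: alinI simp: lin_mult[of X Y] lin_act[of X Y])

lemma inv_one_eq: "comm_group G \<Longrightarrow> inv\<^bsub>G\<^esub> \<one>\<^bsub>G\<^esub> = \<one>\<^bsub>G\<^esub>"
  by (simp add: comm_group_def group_def monoid.inv_one)

lemma asub_kernel:
  assumes X: "amod X" and Y: "amod Y" and \<eta>: "alin X Y \<eta>"
  shows "asub X (\<lambda>a. {x \<in> el X a. \<eta> a x = \<one>\<^bsub>fob Y a\<^esub>})"
  by (rule asubI[OF X])
    (auto simp: one_closed[OF X] mult_closed[OF X] inv_closed[OF X] act_closed[OF X]
      lin_one[OF X Y \<eta>] lin_mult[OF \<eta>] lin_inv[OF X Y \<eta>] lin_act[OF \<eta>] act_one[OF Y]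
      comm_groupE(2,5)[OF amod_group[OF Y]] inv_one_eq[OF amod_group[OF Y]])

lemma asub_image:
  assumes X: "amod X" and Y: "amod Y" and \<eta>: "alin X Y \<eta>"
  shows "asub Y (\<lambda>a. \<eta> a ` el X a)"
proof (rule asubI[OF Y])
  fix a assume "a \<in> Ob A"
  then show "\<one>\<^bsub>fob Y a\<^esub> \<in> \<eta> a ` el X a"
    using lin_one[OF X Y \<eta>] one_closed[OF X] by (metis imageI)
qed (auto simp: lin_closed[OF \<eta>] lin_mult[OF \<eta>, symmetric] lin_inv[OF X Y \<eta>, symmetric]
    lin_act[OF \<eta>, symmetric] mult_closed[OF X] inv_closed[OF X] act_closed[OF X])

text \<open>The smallest saturated submodule containing \<open>U\<close>, generated from below.
  Dividing by \<open>W\<close> once may create elements to which the submodule rules and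
  \<open>W\<close> apply again, so all rules are iterated together.\<close>

inductive clos :: "('o, 'm, 'x monoid, 'x \<Rightarrow> 'x) func \<Rightarrow> ('o \<Rightarrow> 'x set) \<Rightarrow> 'o \<Rightarrow> 'x \<Rightarrow> bool"
  for E :: "('o, 'm, 'x monoid, 'x \<Rightarrow> 'x) func" and U :: "'o \<Rightarrow> 'x set" where
  gen: "a \<in> Ob A \<Longrightarrow> x \<in> el E a \<Longrightarrow> x \<in> U a \<Longrightarrow> clos E U a x"
| one: "a \<in> Ob A \<Longrightarrow> clos E U a \<one>\<^bsub>fob E a\<^esub>"
| mult: "clos E U a x \<Longrightarrow> clos E U a y \<Longrightarrow> clos E U a (x \<otimes>\<^bsub>fob E a\<^esub> y)"
| inv: "clos E U a x \<Longrightarrow> clos E U a (inv\<^bsub>fob E a\<^esub> x)"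
| act: "clos E U a x \<Longrightarrow> b \<in> Ob A \<Longrightarrow> f \<in> Hom A a b \<Longrightarrow> clos E U b (fmor E a b f x)"
| sat: "(a, b, w) \<in> W \<Longrightarrow> x \<in> el E a \<Longrightarrow> clos E U b (fmor E a b w x) \<Longrightarrow> clos E U a x"

lemma clos_in:
  assumes "clos E U a x" "amod E"
  shows "a \<in> Ob A \<and> x \<in> el E a"
  using assms
  by induction (auto simp: one_closed mult_closed inv_closed act_closed dest: W_arrow)

lemma asub_clos: "amod E \<Longrightarrow> asub E (\<lambda>a. {x. clos E U a x})"
  by (rule asubI) (auto intro: clos.intros dest: clos_in)

lemma saturated_clos: "saturated E (\<lambda>a. {x. clos E U a x})"
  by (auto simp: saturated_def intro: clos.sat)

text \<open>The kernel of a linear map into a torsion-free module is itself a saturated submodule;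
  torsion-freeness of \<open>Y\<close> is what handles the rule \<open>sat\<close>.\<close>

lemma clos_minimal:
  assumes "clos E U a x" and E: "amod E" and Y: "amod Y" "tfree Y" and \<eta>: "alin E Y \<eta>"
    and U: "\<And>a x. a \<in> Ob A \<Longrightarrow> x \<in> el E a \<Longrightarrow> x \<in> U a \<Longrightarrow> \<eta> a x = \<one>\<^bsub>fob Y a\<^esub>"
  shows "\<eta> a x = \<one>\<^bsub>fob Y a\<^esub>"
  using assms(1)
proof induction
  case (mult a x y)
  then show ?case
    using clos_in[OF mult(1) E] clos_in[OF mult(2) E]
    by (simp add: lin_mult[OF \<eta>] comm_groupE(2,5)[OF amod_group[OF Y(1)]])
next
  case (inv a x)
  then show ?case
    using clos_in[OF inv(1) E] inv_one_eq[OF amod_group[OF Y(1)]]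
    by (simp add: lin_inv[OF E Y(1) \<eta>])
next
  case (act a x b f)
  then show ?case
    using clos_in[OF act(1) E] by (simp add: lin_act[OF \<eta>] act_one[OF Y(1)])
next
  case (sat a b w x)
  then show ?case
    using W_arrow[OF sat(1)] by (intro tfreeD[OF Y(2,1) sat(1)]) (simp_all add: lin_act[OF \<eta>, symmetric] lin_closed[OF \<eta>])
qed (simp_all add: U lin_one[OF E Y(1) \<eta>])

section \<open>Kernels and cokernels\<close>

lemma zero_object_TF: "\<exists>Z. zero_object TF Z"
proof -
  define u :: 'u where "u = undefined"
  define Z :: "('o, 'm, 'u monoid, 'u \<Rightarrow> 'u) func" where
    "Z = \<lparr>fob = (\<lambda>a. \<lparr>carrier = {u}, mult = (\<lambda>_ _. u), one = u\<rparr>), fmor = (\<lambda>a b f. \<lambda>x\<in>{u}. u)\<rparr>"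
  have Z: "el Z a = {u}" "x \<otimes>\<^bsub>fob Z a\<^esub> y = u" "\<one>\<^bsub>fob Z a\<^esub> = u" "fmor Z a b f = (\<lambda>x\<in>{u}. u)" for a b f x y
    by (simp_all add: Z_def)
  have "comm_group (fob Z a)" for a
    by (rule comm_groupI_inv[where i = "\<lambda>x. x"]) (simp_all add: Z)
  then have "Z \<in> Ob TF"
    by (auto simp: TF_Ob Z small_finite tfree_def intro!: amodI)
  moreover have "\<exists>!f. f \<in> Hom TF Z X" if X: "X \<in> Ob TF" for X
  proof (rule ex1I)
    show "mor Z (\<lambda>a x. \<one>\<^bsub>fob X a\<^esub>) \<in> Hom TF Z X"
      using \<open>Z \<in> Ob TF\<close> X by (simp add: mor_in alin_one)
    fix f assume f: "f \<in> Hom TF Z X"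
    have "f a u = \<one>\<^bsub>fob X a\<^esub>" if "a \<in> Ob A" for a
      using lin_one[OF _ _ TF_Hom_lin[OF \<open>Z \<in> Ob TF\<close> X f] that] \<open>Z \<in> Ob TF\<close> X by (simp add: Z)
    then have "mor Z (\<lambda>a x. \<one>\<^bsub>fob X a\<^esub>) = f"
      unfolding eq_mor_iff[OF \<open>Z \<in> Ob TF\<close> X f] by (simp add: Z)
    then show "f = mor Z (\<lambda>a x. \<one>\<^bsub>fob X a\<^esub>)" by simp
  qed
  moreover have "\<exists>!f. f \<in> Hom TF X Z" if X: "X \<in> Ob TF" for X
  proof (rule ex1I)
    show "mor X (\<lambda>a x. \<one>\<^bsub>fob Z a\<^esub>) \<in> Hom TF X Z"
      using \<open>Z \<in> Ob TF\<close> X by (simp add: mor_in alin_one)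
    fix f assume f: "f \<in> Hom TF X Z"
    have "mor X (\<lambda>a x. \<one>\<^bsub>fob Z a\<^esub>) = f"
      unfolding eq_mor_iff[OF X \<open>Z \<in> Ob TF\<close> f]
      using lin_closed[OF TF_Hom_lin[OF X \<open>Z \<in> Ob TF\<close> f]] by (simp add: Z)
    then show "f = mor X (\<lambda>a x. \<one>\<^bsub>fob Z a\<^esub>)" by simp
  qed
  ultimately show ?thesis unfolding zero_object_def by blast
qed

lemma asub_trivial: "amod E \<Longrightarrow> asub E (\<lambda>a. {\<one>\<^bsub>fob E a\<^esub>})"
  by (rule asubI) (auto simp: one_closed act_one amod_group inv_one_eq comm_groupE(2,5))

text \<open>The quotient by the zero submodule, which is saturated because the module is
  torsion-free. The purpose is the change of carrier: a small module on any element type gets an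
  isomorphic copy on \<open>'u\<close>.\<close>

lemma realise_object:
  fixes E :: "('o, 'm, 'x monoid, 'x \<Rightarrow> 'x) func"
  assumes E: "amod E" "tfree E" and small: "\<And>a. a \<in> Ob A \<Longrightarrow> small (el E a)"
  obtains Q \<pi> where "Q \<in> Ob TF" "alin E Q \<pi>"
    "\<And>a. a \<in> Ob A \<Longrightarrow> el Q a = \<pi> a ` el E a"
    "\<And>a x. a \<in> Ob A \<Longrightarrow> x \<in> el E a \<Longrightarrow> \<pi> a x = \<one>\<^bsub>fob Q a\<^esub> \<longleftrightarrow> x = \<one>\<^bsub>fob E a\<^esub>"
proof (rule quotient_object[OF E(1) small asub_trivial[OF E(1)]])
  show "saturated E (\<lambda>a. {\<one>\<^bsub>fob E a\<^esub>})"
    using tfreeD[OF E(2,1)] by (auto simp: saturated_def)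
qed (use that in auto)

lemma alin_fst: "alin (prodmod X Y) X (\<lambda>a. fst)"
  and alin_snd: "alin (prodmod X Y) Y (\<lambda>a. snd)"
  by (rule alinI; auto)+

lemma alin_pair: "alin V X \<eta> \<Longrightarrow> alin V Y \<theta> \<Longrightarrow> alin V (prodmod X Y) (\<lambda>a v. (\<eta> a v, \<theta> a v))"
  by (rule alinI) (simp_all add: lin_closed lin_mult lin_act)

lemma biproduct_TF:
  assumes X: "X \<in> Ob TF" and Y: "Y \<in> Ob TF"
  shows "\<exists>S i j p q. biproduct TF X Y S i j p q"
proof -
  have E: "amod (prodmod X Y)" "tfree (prodmod X Y)" "\<And>a. a \<in> Ob A \<Longrightarrow> small (el (prodmod X Y) a)"
    using X Y by (simp_all add: amod_prodmod tfree_prodmod TF_tfree small_Times TF_small)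
  show ?thesis
  proof (rule realise_object[OF E])
    fix S \<pi> assume S: "S \<in> Ob TF" and \<pi>: "alin (prodmod X Y) S \<pi>"
      and surj: "\<And>a. a \<in> Ob A \<Longrightarrow> el S a = \<pi> a ` el (prodmod X Y) a"
      and inj: "\<And>a x. a \<in> Ob A \<Longrightarrow> x \<in> el (prodmod X Y) a \<Longrightarrow> \<pi> a x = \<one>\<^bsub>fob S a\<^esub> \<longleftrightarrow> x = \<one>\<^bsub>fob (prodmod X Y) a\<^esub>"
    \<comment> \<open>The projections descend along \<pi> because it has trivial kernel; the
      injections are composites with \<pi>.\<close>
    obtain p where p: "p \<in> Hom TF S X" "\<And>a v. a \<in> Ob A \<Longrightarrow> v \<in> el (prodmod X Y) a \<Longrightarrow> p a (\<pi> a v) = fst v"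
      by (rule factor_through_quotient[OF E(1) S \<pi> surj X alin_fst]) (use inj in auto)
    obtain q where q: "q \<in> Hom TF S Y" "\<And>a v. a \<in> Ob A \<Longrightarrow> v \<in> el (prodmod X Y) a \<Longrightarrow> q a (\<pi> a v) = snd v"
      by (rule factor_through_quotient[OF E(1) S \<pi> surj Y alin_snd]) (use inj in auto)
    define i where "i = mor X (\<lambda>a x. \<pi> a (x, \<one>\<^bsub>fob Y a\<^esub>))"
    define j where "j = mor Y (\<lambda>a y. \<pi> a (\<one>\<^bsub>fob X a\<^esub>, y))"
    have ij: "i \<in> Hom TF X S" "j \<in> Hom TF Y S"
      unfolding i_def j_def using X Y S
      by (auto intro!: mor_in lin_compose[OF _ \<pi>] alin_pair alin_id alin_one)
    have plus: "\<pi> a (x, \<one>\<^bsub>fob Y a\<^esub>) \<otimes>\<^bsub>fob S a\<^esub> \<pi> a (\<one>\<^bsub>fob X a\<^esub>, y) = \<pi> a (x, y)"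
      if "a \<in> Ob A" "x \<in> el X a" "y \<in> el Y a" for a x y
      using that X Y one_closed[of X a] one_closed[of Y a]
        comm_groupE(5)[OF amod_group[of Y a]] monoid.r_one[OF comm_monoid.axioms(1)[OF comm_group.axioms(1)[OF amod_group[of X a]]]]
      by (simp flip: lin_mult[OF \<pi>])
    have pq: "p a s \<in> el X a" "q a s \<in> el Y a" if "a \<in> Ob A" "s \<in> el S a" for a s
      using lin_closed[OF TF_Hom_lin[OF S X p(1)]] lin_closed[OF TF_Hom_lin[OF S Y q(1)]] that by simp_all
    have "\<pi> a (p a s, q a s) = s" if "a \<in> Ob A" "s \<in> el S a" for a s
      using that surj p q by fastforce
    moreover have "\<pi> a v \<in> el S a" if "a \<in> Ob A" "v \<in> el (prodmod X Y) a" for a v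
      using lin_closed[OF \<pi>] that .
    ultimately have "biproduct TF X Y S i j p q"
      using X Y S p q ij one_closed[of X] one_closed[of Y] pq
      by (simp add: biproduct_def TF_Cmp TF_Idt TF_Zer TF_Plus mor_eq_iff i_def j_def plus)
    then show ?thesis by blast
  qed
qed

lemma additive_TF: "additive_category TF"
  using preadditive_TF zero_object_TF biproduct_TF by (simp add: additive_category_def)

section \<open>Kernels and cokernels in terms of elements\<close>

lemma TF_Cmp_apply: "a \<in> Ob A \<Longrightarrow> x \<in> el X a \<Longrightarrow> Cmp TF X Y Z \<theta> \<eta> a x = \<theta> a (\<eta> a x)"
  by (simp add: TF_Cmp)

lemma TF_Cmp_eq_Zer: "Cmp TF X Y Z \<theta> \<eta> = Zer TF X Z \<longleftrightarrow> (\<forall>a\<in>Ob A. \<forall>x\<in>el X a. \<theta> a (\<eta> a x) = \<one>\<^bsub>fob Z a\<^esub>)"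
  by (simp add: TF_Cmp TF_Zer mor_eq_iff)

text \<open>A map whose values lie in the image of \<open>k\<close> lifts elementwise; uniqueness of
  preimages makes the lift linear and unique.\<close>

lemma is_kernelI:
  assumes K: "K \<in> Ob TF" and X: "X \<in> Ob TF" and Y: "Y \<in> Ob TF"
    and f: "f \<in> Hom TF X Y" and k: "k \<in> Hom TF K X"
    and inj: "\<And>a. a \<in> Ob A \<Longrightarrow> inj_on (k a) (el K a)"
    and im: "\<And>a. a \<in> Ob A \<Longrightarrow> k a ` el K a = {x \<in> el X a. f a x = \<one>\<^bsub>fob Y a\<^esub>}"
  shows "is_kernel TF X Y f K k"
  unfolding is_kernel_def
proof (intro conjI ballI impI)
  show "Cmp TF K X Y f k = Zer TF K Y"
    using im by (auto simp: TF_Cmp_eq_Zer)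
  fix V g assume V: "V \<in> Ob TF" and g: "g \<in> Hom TF V X" and "Cmp TF V X Y f g = Zer TF V Y"
  note klin = TF_Hom_lin[OF K X k] and glin = TF_Hom_lin[OF V X g]
  define h where "h a v = inv_into (el K a) (k a) (g a v)" for a v
  have *: "g a v \<in> k a ` el K a" if "a \<in> Ob A" "v \<in> el V a" for a v
    using im that \<open>Cmp TF V X Y f g = Zer TF V Y\<close> lin_closed[OF glin] by (auto simp: TF_Cmp_eq_Zer)
  then have h: "h a v \<in> el K a" "k a (h a v) = g a v" if "a \<in> Ob A" "v \<in> el V a" for a v
    using that by (simp_all add: h_def inv_into_into f_inv_into_f)
  have uniq: "h a v = x" if "a \<in> Ob A" "v \<in> el V a" "x \<in> el K a" "k a x = g a v" for a v x
    using that h[of a v] inj[of a] by (metis inj_onD)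
  have "alin V K h"
    by (rule alinI) (use V K in \<open>auto simp: h mult_closed act_closed lin_mult[OF klin] lin_mult[OF glin]
      lin_act[OF klin] lin_act[OF glin] intro!: uniq\<close>)
  then have hK: "mor V h \<in> Hom TF V K" by (rule mor_in[OF V K])
  moreover have "Cmp TF V K X k (mor V h) = g"
    unfolding TF_Cmp eq_mor_iff[OF V X g] by (simp add: h)
  moreover have "h' = mor V h" if "h' \<in> Hom TF V K" "Cmp TF V K X k h' = g" for h'
  proof -
    have "mor V h = h'"
      unfolding eq_mor_iff[OF V K that(1)]
      using that lin_closed[OF TF_Hom_lin[OF V K that(1)]]
      by (auto intro!: uniq simp: TF_Cmp)
    then show ?thesis by simp
  qed
  ultimately show "\<exists>!h. h \<in> Hom TF V K \<and> Cmp TF V K X k h = g" by blast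
qed (use assms in auto)

text \<open>The universal property is tested on two submodules, which are objects because
  torsion-freeness passes to submodules: the kernel of \<open>k\<close> for injectivity, and the
  kernel of \<open>f\<close> for the image.\<close>

lemma is_kernelD:
  assumes ker: "is_kernel TF X Y f K k" and a: "a \<in> Ob A"
  shows "inj_on (k a) (el K a)" and "k a ` el K a = {x \<in> el X a. f a x = \<one>\<^bsub>fob Y a\<^esub>}"
proof -
  have K: "K \<in> Ob TF" and X: "X \<in> Ob TF" and Y: "Y \<in> Ob TF"
    and f: "f \<in> Hom TF X Y" and k: "k \<in> Hom TF K X" and fk: "Cmp TF K X Y f k = Zer TF K Y"
    and up: "\<And>V g. V \<in> Ob TF \<Longrightarrow> g \<in> Hom TF V X \<Longrightarrow> Cmp TF V X Y f g = Zer TF V Y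
      \<Longrightarrow> \<exists>!h. h \<in> Hom TF V K \<and> Cmp TF V K X k h = g"
    using ker by (auto simp: is_kernel_def)
  note klin = TF_Hom_lin[OF K X k] and flin = TF_Hom_lin[OF X Y f]
  show "inj_on (k a) (el K a)"
  proof (rule lin_inj_onI[OF _ _ klin a])
    fix x assume x: "x \<in> el K a" "k a x = \<one>\<^bsub>fob X a\<^esub>"
    define U where "U = (\<lambda>a. {x \<in> el K a. k a x = \<one>\<^bsub>fob X a\<^esub>})"
    have U: "asub K U" unfolding U_def by (rule asub_kernel[OF _ _ klin]) (use K X in auto)
    let ?V = "submod K U"
    have V: "?V \<in> Ob TF" by (rule submod_in_TF[OF K U])
    have z: "mor ?V (\<lambda>a x. \<one>\<^bsub>fob K a\<^esub>) \<in> Hom TF ?V K"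
      using K V by (simp add: mor_in alin_one)
    have kz: "Cmp TF ?V K X k (incl K U) = Cmp TF ?V K X k (mor ?V (\<lambda>a x. \<one>\<^bsub>fob K a\<^esub>))"
      unfolding TF_Cmp mor_eq_iff using K X by (simp add: lin_one[OF _ _ klin]) (simp add: U_def)
    have "\<exists>!h. h \<in> Hom TF ?V K \<and> Cmp TF ?V K X k h = Cmp TF ?V K X k (incl K U)"
    proof (rule up[OF V])
      show "Cmp TF ?V K X k (incl K U) \<in> Hom TF ?V X"
        by (rule TF_Cmp_in[OF V K X incl_in[OF K U] k])
      show "Cmp TF ?V X Y f (Cmp TF ?V K X k (incl K U)) = Zer TF ?V Y"
        using fk U unfolding TF_Cmp_eq_Zer by (auto simp: TF_Cmp asubD(1))
    qed
    \<comment> \<open>Inclusion and zero agree after composition with \<open>k\<close>, so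
      uniqueness of factorisations makes them equal and the kernel of \<open>k\<close>
      trivial.\<close>
    then have "incl K U = mor ?V (\<lambda>a x. \<one>\<^bsub>fob K a\<^esub>)"
      using kz z incl_in[OF K U] by metis
    then have "incl K U a x = \<one>\<^bsub>fob K a\<^esub>"
      using a x by (simp add: U_def)
    then show "x = \<one>\<^bsub>fob K a\<^esub>" using a x by (simp add: U_def)
  qed (use K X in auto)
  show "k a ` el K a = {x \<in> el X a. f a x = \<one>\<^bsub>fob Y a\<^esub>}"
  proof
    show "k a ` el K a \<subseteq> {x \<in> el X a. f a x = \<one>\<^bsub>fob Y a\<^esub>}"
      using fk a by (auto simp: TF_Cmp_eq_Zer lin_closed[OF klin])
    define U where "U = (\<lambda>a. {x \<in> el X a. f a x = \<one>\<^bsub>fob Y a\<^esub>})"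
    have U: "asub X U" unfolding U_def by (rule asub_kernel[OF _ _ flin]) (use Y X in auto)
    let ?V = "submod X U"
    have V: "?V \<in> Ob TF" by (rule submod_in_TF[OF X U])
    have "Cmp TF ?V X Y f (incl X U) = Zer TF ?V Y"
      by (simp add: TF_Cmp_eq_Zer) (simp add: U_def)
    \<comment> \<open>The inclusion of the kernel of \<open>f\<close> factors through
      \<open>k\<close>, so each of its elements is a value of \<open>k\<close>.\<close>
    then obtain h where h: "h \<in> Hom TF ?V K" "Cmp TF ?V K X k h = incl X U"
      using up[OF V incl_in[OF X U]] by blast
    show "{x \<in> el X a. f a x = \<one>\<^bsub>fob Y a\<^esub>} \<subseteq> k a ` el K a"
    proof
      fix x assume "x \<in> {x \<in> el X a. f a x = \<one>\<^bsub>fob Y a\<^esub>}"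
      then have x: "x \<in> U a" by (simp add: U_def)
      have "k a (h a x) = x"
        using fun_cong[OF fun_cong[OF h(2)], of a x] a x by (simp add: TF_Cmp)
      moreover have "h a x \<in> el K a"
        using lin_closed[OF TF_Hom_lin[OF V K h(1)] a] x by simp
      ultimately show "x \<in> k a ` el K a" by force
    qed
  qed
qed

text \<open>The kernel of \<open>c\<close> is in general larger than the image of \<open>f\<close>.
  The hypothesis on it is therefore phrased through test maps: what \<open>c\<close> kills must be
  killed by each \<open>g\<close> that kills the image of \<open>f\<close>.\<close>

lemma is_cokernelI:
  assumes X: "X \<in> Ob TF" and Y: "Y \<in> Ob TF" and Q: "Q \<in> Ob TF"
    and f: "f \<in> Hom TF X Y" and c: "c \<in> Hom TF Y Q"
    and surj: "\<And>a. a \<in> Ob A \<Longrightarrow> c a ` el Y a = el Q a"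
    and cf: "\<And>a x. a \<in> Ob A \<Longrightarrow> x \<in> el X a \<Longrightarrow> c a (f a x) = \<one>\<^bsub>fob Q a\<^esub>"
    and ker: "\<And>a y V g. a \<in> Ob A \<Longrightarrow> y \<in> el Y a \<Longrightarrow> c a y = \<one>\<^bsub>fob Q a\<^esub> \<Longrightarrow> V \<in> Ob TF \<Longrightarrow> g \<in> Hom TF Y V
      \<Longrightarrow> (\<And>b x. b \<in> Ob A \<Longrightarrow> x \<in> el X b \<Longrightarrow> g b (f b x) = \<one>\<^bsub>fob V b\<^esub>) \<Longrightarrow> g a y = \<one>\<^bsub>fob V a\<^esub>"
  shows "is_cokernel TF X Y f Q c"
  unfolding is_cokernel_def
proof (intro conjI ballI impI)
  show "Cmp TF X Y Q c f = Zer TF X Q" using cf by (simp add: TF_Cmp_eq_Zer)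
  fix V g assume V: "V \<in> Ob TF" and g: "g \<in> Hom TF Y V" and gf: "Cmp TF X Y V g f = Zer TF X V"
  obtain h where h: "h \<in> Hom TF Q V" "\<And>a y. a \<in> Ob A \<Longrightarrow> y \<in> el Y a \<Longrightarrow> h a (c a y) = g a y"
    by (rule factor_through_quotient[OF TF_amod[OF Y] Q TF_Hom_lin[OF Y Q c] surj[symmetric] V TF_Hom_lin[OF Y V g]])
      (use ker[OF _ _ _ V g] gf in \<open>auto simp: TF_Cmp_eq_Zer\<close>)
  moreover have "Cmp TF Y Q V h c = g"
    unfolding TF_Cmp eq_mor_iff[OF Y V g] by (simp add: h)
  moreover have "h' = h" if "h' \<in> Hom TF Q V" "Cmp TF Y Q V h' c = g" for h'
  proof (rule TF_Hom_ext[OF Q V V that(1) h(1)])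
    fix a q assume a: "a \<in> Ob A" and "q \<in> el Q a"
    then obtain y where "y \<in> el Y a" "q = c a y" using surj by auto
    then show "h' a q = h a q"
      using a h(2) that(2) by (auto simp: TF_Cmp)
  qed
  ultimately show "\<exists>!h. h \<in> Hom TF Q V \<and> Cmp TF Y Q V h c = g" by blast
qed (use assms in auto)

text \<open>The image of \<open>c\<close> is a submodule of \<open>Q\<close>, hence an object, and
  \<open>c\<close> corestricts to it. Factoring this corestriction through \<open>c\<close> gives an
  endomorphism of \<open>Q\<close> with values in the image that agrees with the identity after
  \<open>c\<close>; by uniqueness it is the identity, so the image is everything.\<close>

lemma is_cokernelD:
  assumes coker: "is_cokernel TF X Y f Q c" and a: "a \<in> Ob A"
  shows "c a ` el Y a = el Q a"
proof -
  have X: "X \<in> Ob TF" and Y: "Y \<in> Ob TF" and Q: "Q \<in> Ob TF"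
    and f: "f \<in> Hom TF X Y" and c: "c \<in> Hom TF Y Q" and cf: "Cmp TF X Y Q c f = Zer TF X Q"
    and up: "\<And>V g. V \<in> Ob TF \<Longrightarrow> g \<in> Hom TF Y V \<Longrightarrow> Cmp TF X Y V g f = Zer TF X V
      \<Longrightarrow> \<exists>!h. h \<in> Hom TF Q V \<and> Cmp TF Y Q V h c = g"
    using coker by (auto simp: is_cokernel_def)
  note clin = TF_Hom_lin[OF Y Q c]
  define U where "U = (\<lambda>a. c a ` el Y a)"
  have U: "asub Q U" unfolding U_def by (rule asub_image[OF _ _ clin]) (use Y Q in auto)
  have I: "submod Q U \<in> Ob TF" by (rule submod_in_TF[OF Q U])
  have c': "c \<in> Hom TF Y (submod Q U)" by (rule corestrict_in[OF Q U Y c]) (simp add: U_def)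
  have "Cmp TF X Y (submod Q U) c f = Zer TF X (submod Q U)"
    using cf by (simp add: TF_Cmp_eq_Zer)
  then obtain h where h: "h \<in> Hom TF Q (submod Q U)" "Cmp TF Y Q (submod Q U) h c = c"
    using up[OF I c'] by blast
  have hU: "h a q \<in> U a" if "a \<in> Ob A" "q \<in> el Q a" for a q
    using lin_closed[OF TF_Hom_lin[OF Q I h(1)] that] by simp
  have id: "mor Q (\<lambda>a x. x) \<in> Hom TF Q Q" using Q by (simp add: mor_in alin_id)
  have ih: "mor Q h \<in> Hom TF Q Q"
    using lin_compose[OF TF_Hom_lin[OF Q I h(1)] alin_submod[OF U]] Q by (simp add: mor_in)
  have "Cmp TF Y Q Q (mor Q (\<lambda>a x. x)) c = c" "Cmp TF Y Q Q (mor Q h) c = c"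
  proof -
    show "Cmp TF Y Q Q (mor Q (\<lambda>a x. x)) c = c"
      unfolding TF_Cmp eq_mor_iff[OF Y Q c] by (simp add: lin_closed[OF clin])
    show "Cmp TF Y Q Q (mor Q h) c = c"
      unfolding TF_Cmp eq_mor_iff[OF Y Q c]
      using fun_cong[OF fun_cong[OF h(2)]] by (simp add: lin_closed[OF clin] TF_Cmp) (metis mor_apply)
  qed
  then have "mor Q h = mor Q (\<lambda>a x. x)"
    using up[OF Q c cf] id ih by metis
  then have "q \<in> U a" if "q \<in> el Q a" for q
    using hU[OF a that] that a by (simp add: mor_eq_iff)
  then show ?thesis using lin_closed[OF clin a] by (auto simp: U_def)
qed

text \<open>The kernel condition pins down the image of \<open>f\<close>, so conflations are the
  ordinary short exact sequences of modules. The image is then saturated automatically, as the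
  kernel of a map into a torsion-free module.\<close>

lemma conflation_iff:
  assumes X: "X \<in> Ob TF" and Y: "Y \<in> Ob TF" and Z: "Z \<in> Ob TF"
    and f: "f \<in> Hom TF X Y" and g: "g \<in> Hom TF Y Z"
  shows "conflation TF X Y Z f g \<longleftrightarrow> (\<forall>a\<in>Ob A. inj_on (f a) (el X a) \<and> g a ` el Y a = el Z a \<and>
    f a ` el X a = {y \<in> el Y a. g a y = \<one>\<^bsub>fob Z a\<^esub>})" (is "_ \<longleftrightarrow> ?R")
proof
  assume "conflation TF X Y Z f g"
  then have k: "is_kernel TF Y Z g X f" and c: "is_cokernel TF X Y f Z g"
    by (simp_all add: conflation_def)
  show ?R using is_kernelD[OF k] is_cokernelD[OF c] by simp
next
  assume R: ?R
  have "is_kernel TF Y Z g X f" by (rule is_kernelI[OF X Y Z g f]) (use R in auto)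
  moreover have "is_cokernel TF X Y f Z g"
  proof (rule is_cokernelI[OF X Y Z f g])
    fix a y V h assume "a \<in> Ob A" "y \<in> el Y a" "g a y = \<one>\<^bsub>fob Z a\<^esub>"
      and h: "\<And>b x. b \<in> Ob A \<Longrightarrow> x \<in> el X b \<Longrightarrow> h b (f b x) = \<one>\<^bsub>fob V b\<^esub>"
    then have "y \<in> f a ` el X a" using R by auto
    then show "h a y = \<one>\<^bsub>fob V a\<^esub>" using h \<open>a \<in> Ob A\<close> by auto
  qed (use R in blast)+
  ultimately show "conflation TF X Y Z f g" by (simp add: conflation_def)
qed

lemma kernel_TF:
  assumes X: "X \<in> Ob TF" and Y: "Y \<in> Ob TF" and f: "f \<in> Hom TF X Y"
  defines "U \<equiv> \<lambda>a. {x \<in> el X a. f a x = \<one>\<^bsub>fob Y a\<^esub>}"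
  shows "asub X U" "is_kernel TF X Y f (submod X U) (incl X U)"
proof -
  show U: "asub X U"
    unfolding U_def by (rule asub_kernel[OF _ _ TF_Hom_lin[OF X Y f]]) (use X Y in auto)
  show "is_kernel TF X Y f (submod X U) (incl X U)"
    by (rule is_kernelI[OF submod_in_TF[OF X U] X Y f incl_in[OF X U]])
      (auto simp: inj_on_def, simp_all add: U_def)
qed

text \<open>A surjection is the cokernel of the inclusion of its own kernel.\<close>

lemma cokernel_map_iff:
  assumes Y: "Y \<in> Ob TF" and Q: "Q \<in> Ob TF" and c: "c \<in> Hom TF Y Q"
  shows "cokernel_map TF Y Q c \<longleftrightarrow> (\<forall>a\<in>Ob A. c a ` el Y a = el Q a)"
proof
  assume "cokernel_map TF Y Q c"
  then obtain X f where "is_cokernel TF X Y f Q c" by (auto simp: cokernel_map_def)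
  then show "\<forall>a\<in>Ob A. c a ` el Y a = el Q a"
    using is_cokernelD by simp
next
  assume surj: "\<forall>a\<in>Ob A. c a ` el Y a = el Q a"
  define U where "U = (\<lambda>a. {y \<in> el Y a. c a y = \<one>\<^bsub>fob Q a\<^esub>})"
  have U: "asub Y U" unfolding U_def by (rule kernel_TF(1)[OF Y Q c])
  have "is_cokernel TF (submod Y U) Y (incl Y U) Q c"
  proof (rule is_cokernelI[OF submod_in_TF[OF Y U] Y Q incl_in[OF Y U] c])
    fix a y V g assume "a \<in> Ob A" "y \<in> el Y a" "c a y = \<one>\<^bsub>fob Q a\<^esub>"
      and "\<And>b x. b \<in> Ob A \<Longrightarrow> x \<in> el (submod Y U) b \<Longrightarrow> g b (incl Y U b x) = \<one>\<^bsub>fob V b\<^esub>"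
    then show "g a y = \<one>\<^bsub>fob V a\<^esub>" by (force simp: U_def)
  qed (use surj in \<open>auto simp: U_def\<close>)
  then show "cokernel_map TF Y Q c" by (auto simp: cokernel_map_def)
qed

text \<open>The quotient by the image of \<open>f\<close> may have torsion, so the saturated closure
  of the image is divided out instead; by \<open>clos_minimal\<close> no test map can tell the
  difference.\<close>

lemma cokernel_TF:
  assumes X: "X \<in> Ob TF" and Y: "Y \<in> Ob TF" and f: "f \<in> Hom TF X Y"
  shows "\<exists>Q c. is_cokernel TF X Y f Q c"
proof -
  have Y': "amod Y" using Y by simp
  let ?U = "\<lambda>a. f a ` el X a"
  show ?thesis
  proof (rule quotient_object[OF Y' TF_small[OF Y] asub_clos[OF Y', of ?U] saturated_clos])
    fix Q \<pi> assume Q: "Q \<in> Ob TF" and \<pi>: "alin Y Q \<pi>"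
      and surj: "\<And>a. a \<in> Ob A \<Longrightarrow> el Q a = \<pi> a ` el Y a"
      and ker: "\<And>a y. a \<in> Ob A \<Longrightarrow> y \<in> el Y a \<Longrightarrow> \<pi> a y = \<one>\<^bsub>fob Q a\<^esub> \<longleftrightarrow> y \<in> {x. clos Y ?U a x}"
    have "is_cokernel TF X Y f Q (mor Y \<pi>)"
    proof (rule is_cokernelI[OF X Y Q f mor_in[OF Y Q \<pi>]])
      fix a x assume "a \<in> Ob A" "x \<in> el X a"
      then show "mor Y \<pi> a (f a x) = \<one>\<^bsub>fob Q a\<^esub>"
        using lin_closed[OF TF_Hom_lin[OF X Y f]] by (auto simp: ker intro: clos.gen)
    next
      fix a y V g assume *: "a \<in> Ob A" "y \<in> el Y a" "mor Y \<pi> a y = \<one>\<^bsub>fob Q a\<^esub>" and V: "V \<in> Ob TF" "g \<in> Hom TF Y V"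
        and g: "\<And>b x. b \<in> Ob A \<Longrightarrow> x \<in> el X b \<Longrightarrow> g b (f b x) = \<one>\<^bsub>fob V b\<^esub>"
      show "g a y = \<one>\<^bsub>fob V a\<^esub>"
        by (rule clos_minimal[OF _ Y' _ TF_tfree[OF V(1)] TF_Hom_lin[OF Y V], of ?U])
          (use * V g ker in auto)
    qed (use surj in auto)
    then show ?thesis by blast
  qed
qed

text \<open>If \<open>k\<close> is a kernel of \<open>f\<close> and \<open>w x\<close> lies in its
  image, then \<open>w\<close> annihilates \<open>f x\<close> in a torsion-free module, so
  \<open>f x\<close> is zero and \<open>x\<close> lies in the image. Conversely, saturation makes
  the quotient by the image an object, and \<open>k\<close> is the kernel of the projection to
  it.\<close>

lemma kernel_map_iff:
  assumes K: "K \<in> Ob TF" and X: "X \<in> Ob TF" and k: "k \<in> Hom TF K X"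
  shows "kernel_map TF K X k \<longleftrightarrow> (\<forall>a\<in>Ob A. inj_on (k a) (el K a)) \<and> saturated X (\<lambda>a. k a ` el K a)"
proof
  assume "kernel_map TF K X k"
  then obtain Y f where ker: "is_kernel TF X Y f K k" by (auto simp: kernel_map_def)
  then have Y: "Y \<in> Ob TF" and f: "f \<in> Hom TF X Y" by (auto simp: is_kernel_def)
  have "x \<in> k a ` el K a" if w: "(a, b, w) \<in> W" and x: "x \<in> el X a" "fmor X a b w x \<in> k b ` el K b" for a b w x
    using x W_arrow[OF w] tfreeD[OF TF_tfree[OF Y] TF_amod[OF Y] w, of "f a x"]
    by (auto simp: is_kernelD(2)[OF ker] lin_act[OF TF_Hom_lin[OF X Y f]] lin_closed[OF TF_Hom_lin[OF X Y f]])
  then show "(\<forall>a\<in>Ob A. inj_on (k a) (el K a)) \<and> saturated X (\<lambda>a. k a ` el K a)"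
    using is_kernelD(1)[OF ker] unfolding saturated_def by blast
next
  assume R: "(\<forall>a\<in>Ob A. inj_on (k a) (el K a)) \<and> saturated X (\<lambda>a. k a ` el K a)"
  have sub: "asub X (\<lambda>a. k a ` el K a)"
    by (rule asub_image[OF _ _ TF_Hom_lin[OF K X k]]) (use K X in auto)
  show "kernel_map TF K X k"
  proof (rule quotient_object[OF TF_amod[OF X] TF_small[OF X] sub])
    fix Q \<pi> assume Q: "Q \<in> Ob TF" and \<pi>: "alin X Q \<pi>"
      and ker: "\<And>a y. a \<in> Ob A \<Longrightarrow> y \<in> el X a \<Longrightarrow> \<pi> a y = \<one>\<^bsub>fob Q a\<^esub> \<longleftrightarrow> y \<in> k a ` el K a"
    have "is_kernel TF X Q (mor X \<pi>) K k"
      by (rule is_kernelI[OF K X Q mor_in[OF X Q \<pi>] k])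
        (use R ker lin_closed[OF TF_Hom_lin[OF K X k]] in auto)
    then show "kernel_map TF K X k" by (auto simp: kernel_map_def)
  qed (use R in auto)
qed

section \<open>Stability under pullback and pushout\<close>

lemma cokernel_map_pullback:
  assumes pb: "is_pullback TF X Y Z f g P p q" and f: "cokernel_map TF X Z f"
  shows "cokernel_map TF P Y q"
proof -
  have ob: "X \<in> Ob TF" "Y \<in> Ob TF" "Z \<in> Ob TF" "P \<in> Ob TF"
    and mo: "f \<in> Hom TF X Z" "g \<in> Hom TF Y Z" "p \<in> Hom TF P X" "q \<in> Hom TF P Y"
    and up: "\<And>V a b. V \<in> Ob TF \<Longrightarrow> a \<in> Hom TF V X \<Longrightarrow> b \<in> Hom TF V Y \<Longrightarrow> Cmp TF V X Z f a = Cmp TF V Y Z g b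
        \<Longrightarrow> \<exists>h. h \<in> Hom TF V P \<and> Cmp TF V P X p h = a \<and> Cmp TF V P Y q h = b"
    using pb unfolding is_pullback_def by blast+
  note flin = TF_Hom_lin[OF ob(1,3) mo(1)] and glin = TF_Hom_lin[OF ob(2,3) mo(2)]
  have am: "amod X" "amod Y" "amod Z" using ob by auto
  let ?E = "prodmod X Y"
  have E: "amod ?E" "tfree ?E" "\<And>a. a \<in> Ob A \<Longrightarrow> small (el ?E a)"
    using ob by (simp_all add: amod_prodmod tfree_prodmod TF_tfree small_Times TF_small)
  \<comment> \<open>The fibre product of elements, written as the kernel of a difference so that it
    is a submodule at once.\<close>
  define U where "U = (\<lambda>a. {v \<in> el ?E a. f a (fst v) \<otimes>\<^bsub>fob Z a\<^esub> inv\<^bsub>fob Z a\<^esub> g a (snd v) = \<one>\<^bsub>fob Z a\<^esub>})"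
  have U: "asub ?E U"
    unfolding U_def
    by (rule asub_kernel[OF E(1) am(3)])
      (rule alin_mult[OF am(3) lin_compose[OF alin_fst flin] alin_inv[OF am(3) lin_compose[OF alin_snd glin]]])
  have U_iff: "v \<in> U a \<longleftrightarrow> v \<in> el ?E a \<and> f a (fst v) = g a (snd v)" if "a \<in> Ob A" for a v
    using that am by (auto simp: U_def div_eq_one_iff amod_group lin_closed[OF flin] lin_closed[OF glin])
  show ?thesis
  proof (rule realise_object[OF amod_submod[OF E(1) U] tfree_submod[OF U E(2)]])
    show "small (el (submod ?E U) a)" if "a \<in> Ob A" for a
      using E(3)[OF that] asubD(1)[OF U that] by (auto intro: small_subset)
    fix V \<pi> assume V: "V \<in> Ob TF" and \<pi>: "alin (submod ?E U) V \<pi>"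
      and surj: "\<And>a. a \<in> Ob A \<Longrightarrow> el V a = \<pi> a ` el (submod ?E U) a"
      and inj: "\<And>a v. a \<in> Ob A \<Longrightarrow> v \<in> el (submod ?E U) a \<Longrightarrow> \<pi> a v = \<one>\<^bsub>fob V a\<^esub> \<longleftrightarrow> v = \<one>\<^bsub>fob (submod ?E U) a\<^esub>"
    obtain p0 where p0: "p0 \<in> Hom TF V X" "\<And>a v. a \<in> Ob A \<Longrightarrow> v \<in> el (submod ?E U) a \<Longrightarrow> p0 a (\<pi> a v) = fst v"
      by (rule factor_through_quotient[OF amod_submod[OF E(1) U] V \<pi> surj ob(1) lin_compose[OF alin_submod[OF U] alin_fst]])
        (use inj in auto)
    obtain q0 where q0: "q0 \<in> Hom TF V Y" "\<And>a v. a \<in> Ob A \<Longrightarrow> v \<in> el (submod ?E U) a \<Longrightarrow> q0 a (\<pi> a v) = snd v"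
      by (rule factor_through_quotient[OF amod_submod[OF E(1) U] V \<pi> surj ob(2) lin_compose[OF alin_submod[OF U] alin_snd]])
        (use inj in auto)
    have "Cmp TF V X Z f p0 = Cmp TF V Y Z g q0"
      unfolding TF_Cmp mor_eq_iff by (auto simp: surj p0 q0 U_iff)
    \<comment> \<open>A map from the concrete fibre product to \<open>P\<close> suffices: its
      composite with \<open>q\<close> is the second projection, which is onto because
      \<open>f\<close> is, and so \<open>q\<close> is onto.\<close>
    then obtain h where h: "h \<in> Hom TF V P" "Cmp TF V P Y q h = q0"
      using up[OF V p0(1) q0(1)] by blast
    have "y \<in> q a ` el P a" if a: "a \<in> Ob A" and y: "y \<in> el Y a" for a y
    proof -
      have "g a y \<in> f a ` el X a"
        using f a y lin_closed[OF glin] cokernel_map_iff[OF ob(1,3) mo(1)] by auto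
      then obtain x where "(x, y) \<in> U a" using U_iff a y by auto
      then have "\<pi> a (x, y) \<in> el V a" "q0 a (\<pi> a (x, y)) = y" using surj q0 a by auto
      then have "q a (h a (\<pi> a (x, y))) = y" "h a (\<pi> a (x, y)) \<in> el P a"
        using h(2) a lin_closed[OF TF_Hom_lin[OF V ob(4) h(1)]] by (auto simp: TF_Cmp)
      then show ?thesis by force
    qed
    then show ?thesis
      unfolding cokernel_map_iff[OF ob(4,2) mo(4)]
      using lin_closed[OF TF_Hom_lin[OF ob(4,2) mo(4)]] by blast
  qed
qed

text \<open>The concrete pushout is the product modulo all \<open>(f z, - g z)\<close>, and this
  submodule is already saturated. The abstract pushout \<open>P\<close> maps to it by
  \<open>h\<close>, and a map \<open>k\<close> back with \<open>k h\<close> the identity shows that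
  \<open>h\<close> loses nothing and that each element of \<open>P\<close> has the form
  \<open>p x + q y\<close>. The claims on \<open>q\<close> are then read off in the
  quotient.\<close>

lemma kernel_map_pushout:
  assumes po: "is_pushout TF X Y Z f g P p q" and f: "kernel_map TF Z X f"
  shows "kernel_map TF Y P q"
proof -
  have ob: "X \<in> Ob TF" "Y \<in> Ob TF" "Z \<in> Ob TF" "P \<in> Ob TF"
    and mo: "f \<in> Hom TF Z X" "g \<in> Hom TF Z Y" "p \<in> Hom TF X P" "q \<in> Hom TF Y P"
    and pfqg: "Cmp TF Z X P p f = Cmp TF Z Y P q g"
    and up: "\<And>V a b. V \<in> Ob TF \<Longrightarrow> a \<in> Hom TF X V \<Longrightarrow> b \<in> Hom TF Y V \<Longrightarrow> Cmp TF Z X V a f = Cmp TF Z Y V b g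
        \<Longrightarrow> \<exists>!h. h \<in> Hom TF P V \<and> Cmp TF X P V h p = a \<and> Cmp TF Y P V h q = b"
    using po unfolding is_pushout_def by blast+
  note flin = TF_Hom_lin[OF ob(3,1) mo(1)] and glin = TF_Hom_lin[OF ob(3,2) mo(2)]
    and plin = TF_Hom_lin[OF ob(1,4) mo(3)] and qlin = TF_Hom_lin[OF ob(2,4) mo(4)]
  have am: "amod X" "amod Y" "amod Z" "amod P" using ob by auto
  have f_inj: "inj_on (f a) (el Z a)" if "a \<in> Ob A" for a
    using f kernel_map_iff[OF ob(3,1) mo(1)] that by auto
  have f_sat: "saturated X (\<lambda>a. f a ` el Z a)"
    using f kernel_map_iff[OF ob(3,1) mo(1)] by auto
  let ?E = "prodmod X Y"
  have E: "amod ?E" "tfree ?E" "\<And>a. a \<in> Ob A \<Longrightarrow> small (el ?E a)"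
    using ob by (simp_all add: amod_prodmod tfree_prodmod TF_tfree small_Times TF_small)
  define N where "N = (\<lambda>a. (\<lambda>z. (f a z, inv\<^bsub>fob Y a\<^esub> g a z)) ` el Z a)"
  have N: "asub ?E N"
    unfolding N_def by (rule asub_image[OF am(3) E(1) alin_pair[OF flin alin_inv[OF am(2) glin]]])
  have sat: "saturated ?E N"
    unfolding saturated_def
  proof (intro ballI, clarify)
    fix a b w x y assume w: "(a, b, w) \<in> W" and xy: "(x, y) \<in> el ?E a" "fmor ?E a b w (x, y) \<in> N b"
    note ab = W_arrow[OF w]
    obtain z where z: "z \<in> el Z b" "fmor X a b w x = f b z" "fmor Y a b w y = inv\<^bsub>fob Y b\<^esub> g b z"
      using xy(2) by (auto simp: N_def)
    \<comment> \<open>Saturation of the image of \<open>f\<close> divides the first coordinate by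
      \<open>w\<close>; injectivity of \<open>f\<close> identifies \<open>z\<close> with
      \<open>w z'\<close>, and torsion-freeness of \<open>Y\<close> cancels \<open>w\<close> in the
      second coordinate.\<close>
    then have "x \<in> f a ` el Z a" using f_sat w xy(1) by (auto simp: saturated_def)
    then obtain z' where z': "z' \<in> el Z a" "x = f a z'" by auto
    then have "f b (fmor Z a b w z') = f b z" using z(2) ab by (simp add: lin_act[OF flin])
    then have "fmor Z a b w z' = z" using f_inj[of b] ab z z' act_closed[OF am(3)] by (auto dest: inj_onD)
    then have "fmor Y a b w y = fmor Y a b w (inv\<^bsub>fob Y a\<^esub> g a z')"
      using z(3) z'(1) ab by (simp add: act_inv[OF am(2)] lin_closed[OF glin] lin_act[OF glin, symmetric])
    moreover have "inj_on (fmor Y a b w) (el Y a)"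
      using TF_tfree[OF ob(2)] w by (auto simp: tfree_def)
    ultimately have "y = inv\<^bsub>fob Y a\<^esub> g a z'"
      using xy(1) z'(1) ab by (auto simp: inv_closed[OF am(2)] lin_closed[OF glin] dest!: inj_onD)
    then show "(x, y) \<in> N a" using z' by (auto simp: N_def)
  qed
  show ?thesis
  proof (rule quotient_object[OF E(1,3) N sat])
    fix Q \<pi> assume Q: "Q \<in> Ob TF" and \<pi>: "alin ?E Q \<pi>"
      and surj: "\<And>a. a \<in> Ob A \<Longrightarrow> el Q a = \<pi> a ` el ?E a"
      and ker: "\<And>a v. a \<in> Ob A \<Longrightarrow> v \<in> el ?E a \<Longrightarrow> \<pi> a v = \<one>\<^bsub>fob Q a\<^esub> \<longleftrightarrow> v \<in> N a"
    define p0 where "p0 = mor X (\<lambda>a x. \<pi> a (x, \<one>\<^bsub>fob Y a\<^esub>))"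
    define q0 where "q0 = mor Y (\<lambda>a y. \<pi> a (\<one>\<^bsub>fob X a\<^esub>, y))"
    have p0: "p0 \<in> Hom TF X Q" and q0: "q0 \<in> Hom TF Y Q"
      unfolding p0_def q0_def using ob am Q
      by (auto intro!: mor_in lin_compose[OF _ \<pi>] alin_pair alin_id alin_one)
    have inv_eq: "x \<otimes>\<^bsub>fob P a\<^esub> inv\<^bsub>fob P a\<^esub> x = \<one>\<^bsub>fob P a\<^esub>" if "a \<in> Ob A" "x \<in> el P a" for a x
      using that am(4) by (simp add: div_eq_one_iff amod_group)
    have \<pi>_split: "\<pi> a (x, y) = \<pi> a (x, \<one>\<^bsub>fob Y a\<^esub>) \<otimes>\<^bsub>fob Q a\<^esub> \<pi> a (\<one>\<^bsub>fob X a\<^esub>, y)"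
      if "a \<in> Ob A" "x \<in> el X a" "y \<in> el Y a" for a x y
    proof -
      interpret G: comm_group "fob X a" by (rule amod_group[OF am(1) that(1)])
      interpret H: comm_group "fob Y a" by (rule amod_group[OF am(2) that(1)])
      show ?thesis using that by (simp flip: lin_mult[OF \<pi>])
    qed
    have \<pi>_eq: "\<pi> a (x, y) = \<pi> a (x', y') \<longleftrightarrow> (\<exists>z\<in>el Z a. x = x' \<otimes>\<^bsub>fob X a\<^esub> f a z \<and> y = y' \<otimes>\<^bsub>fob Y a\<^esub> inv\<^bsub>fob Y a\<^esub> g a z)"
      if a: "a \<in> Ob A" and "x \<in> el X a" "y \<in> el Y a" "x' \<in> el X a" "y' \<in> el Y a" for a x y x' y'
    proof -
      interpret G: comm_group "fob X a" by (rule amod_group[OF am(1) a])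
      interpret H: comm_group "fob Y a" by (rule amod_group[OF am(2) a])
      have "\<pi> a (x, y) = \<pi> a (x', y') \<longleftrightarrow> \<pi> a ((x, y) \<otimes>\<^bsub>fob ?E a\<^esub> inv\<^bsub>fob ?E a\<^esub> (x', y')) = \<one>\<^bsub>fob Q a\<^esub>"
        using that Q E(1) lin_closed[OF \<pi> a, of "(x, y)"] lin_closed[OF \<pi> a, of "(x', y')"] inv_closed[OF E(1) a, of "(x', y')"]
          lin_mult[OF \<pi> a, of "(x, y)" "inv\<^bsub>fob ?E a\<^esub> (x', y')"] lin_inv[OF E(1) TF_amod[OF Q] \<pi> a, of "(x', y')"]
        by (simp add: div_eq_one_iff amod_group del: prodmod_simps(2))
      also have "\<dots> \<longleftrightarrow> (x \<otimes>\<^bsub>fob X a\<^esub> inv\<^bsub>fob X a\<^esub> x', y \<otimes>\<^bsub>fob Y a\<^esub> inv\<^bsub>fob Y a\<^esub> y') \<in> N a"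
        using that by (simp add: ker[OF a] inv_prodmod[OF am(1,2) a])
      also have "\<dots> \<longleftrightarrow> (\<exists>z\<in>el Z a. x = x' \<otimes>\<^bsub>fob X a\<^esub> f a z \<and> y = y' \<otimes>\<^bsub>fob Y a\<^esub> inv\<^bsub>fob Y a\<^esub> g a z)"
        using that lin_closed[OF flin a] lin_closed[OF glin a]
        by (auto simp: N_def image_iff G.inv_solve_right' H.inv_solve_right' G.m_comm H.m_comm)
      finally show ?thesis .
    qed
    have "Cmp TF Z X Q p0 f = Cmp TF Z Y Q q0 g"
      unfolding TF_Cmp mor_eq_iff
    proof (intro ballI)
      fix a z assume a: "a \<in> Ob A" and z: "z \<in> el Z a"
      interpret G: comm_group "fob X a" by (rule amod_group[OF am(1) a])
      interpret H: comm_group "fob Y a" by (rule amod_group[OF am(2) a])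
      show "p0 a (f a z) = q0 a (g a z)"
        using a z lin_closed[OF flin a z] lin_closed[OF glin a z]
        by (auto simp: p0_def q0_def \<pi>_eq intro!: bexI[of _ z])
    qed
    then obtain h where h: "h \<in> Hom TF P Q" "Cmp TF X P Q h p = p0" "Cmp TF Y P Q h q = q0"
      using up[OF Q p0 q0] by blast
    note hlin = TF_Hom_lin[OF ob(4) Q h(1)]
    have hp: "h a (p a x) = \<pi> a (x, \<one>\<^bsub>fob Y a\<^esub>)" if "a \<in> Ob A" "x \<in> el X a" for a x
      using fun_cong[OF fun_cong[OF h(2)], of a x] that by (simp add: TF_Cmp p0_def)
    have hq: "h a (q a y) = \<pi> a (\<one>\<^bsub>fob X a\<^esub>, y)" if "a \<in> Ob A" "y \<in> el Y a" for a y
      using fun_cong[OF fun_cong[OF h(3)], of a y] that by (simp add: TF_Cmp q0_def)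
    have pf: "p a (f a z) = q a (g a z)" if "a \<in> Ob A" "z \<in> el Z a" for a z
      using fun_cong[OF fun_cong[OF pfqg], of a z] that by (simp add: TF_Cmp)
    have \<psi>: "alin ?E P (\<lambda>a v. p a (fst v) \<otimes>\<^bsub>fob P a\<^esub> q a (snd v))"
      by (rule alin_mult[OF am(4) lin_compose[OF alin_fst plin] lin_compose[OF alin_snd qlin]])
    obtain k where k: "k \<in> Hom TF Q P"
      "\<And>a v. a \<in> Ob A \<Longrightarrow> v \<in> el ?E a \<Longrightarrow> k a (\<pi> a v) = p a (fst v) \<otimes>\<^bsub>fob P a\<^esub> q a (snd v)"
    proof (rule factor_through_quotient[OF E(1) Q \<pi> surj ob(4) \<psi>])
      fix a v assume a: "a \<in> Ob A" and "v \<in> el ?E a" "\<pi> a v = \<one>\<^bsub>fob Q a\<^esub>"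
      then obtain z where "z \<in> el Z a" "v = (f a z, inv\<^bsub>fob Y a\<^esub> g a z)" by (auto simp: ker N_def)
      then show "p a (fst v) \<otimes>\<^bsub>fob P a\<^esub> q a (snd v) = \<one>\<^bsub>fob P a\<^esub>"
        using a by (simp add: pf lin_inv[OF am(2,4) qlin] lin_closed[OF glin] lin_closed[OF qlin] inv_eq)
    qed blast+
    \<comment> \<open>Both endomorphisms of \<open>P\<close> restrict to \<open>p\<close> and
      \<open>q\<close>, so the uniqueness part of the pushout property identifies them.\<close>
    have "Cmp TF P Q P k h = mor P (\<lambda>a u. u)"
    proof -
      have *: "mor P (\<lambda>a u. u) \<in> Hom TF P P" "Cmp TF P Q P k h \<in> Hom TF P P"
        using ob by (simp_all add: mor_in alin_id TF_Cmp_in[OF ob(4) Q ob(4) h(1) k(1)])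
      have "Cmp TF X P P (mor P (\<lambda>a u. u)) p = p" "Cmp TF Y P P (mor P (\<lambda>a u. u)) q = q"
        unfolding TF_Cmp eq_mor_iff[OF ob(1,4) mo(3)] eq_mor_iff[OF ob(2,4) mo(4)]
        by (simp_all add: lin_closed[OF plin] lin_closed[OF qlin])
      moreover have "Cmp TF X P P (Cmp TF P Q P k h) p = p" "Cmp TF Y P P (Cmp TF P Q P k h) q = q"
        unfolding TF_Cmp eq_mor_iff[OF ob(1,4) mo(3)] eq_mor_iff[OF ob(2,4) mo(4)]
        using am by (simp_all add: lin_closed[OF plin] lin_closed[OF qlin] hp hq k(2) one_closed
          lin_one[OF _ _ plin] lin_one[OF _ _ qlin] comm_groupE(5)[OF amod_group]
          monoid.r_one[OF comm_monoid.axioms(1)[OF comm_group.axioms(1)[OF amod_group]]])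
      ultimately show ?thesis
        using up[OF ob(4) mo(3,4) pfqg] * by blast
    qed
    then have kh: "k a (h a u) = u" if "a \<in> Ob A" "u \<in> el P a" for a u
      using that by (simp add: TF_Cmp mor_eq_iff)
    have split: "\<exists>x\<in>el X a. \<exists>y\<in>el Y a. u = p a x \<otimes>\<^bsub>fob P a\<^esub> q a y" if "a \<in> Ob A" "u \<in> el P a" for a u
    proof -
      have "h a u \<in> \<pi> a ` el ?E a" using lin_closed[OF hlin that] surj that by simp
      then obtain x y where "h a u = \<pi> a (x, y)" "x \<in> el X a" "y \<in> el Y a" by auto
      then show ?thesis using kh[OF that] k(2)[of a "(x, y)"] that by auto
    qed
    show "kernel_map TF Y P q"
      unfolding kernel_map_iff[OF ob(2,4) mo(4)]
    proof (intro conjI ballI)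
      fix a assume a: "a \<in> Ob A"
      interpret G: comm_group "fob X a" by (rule amod_group[OF am(1) a])
      show "inj_on (q a) (el Y a)"
      proof (rule lin_inj_onI[OF am(2,4) qlin a])
        fix y assume y: "y \<in> el Y a" "q a y = \<one>\<^bsub>fob P a\<^esub>"
        have "\<pi> a (\<one>\<^bsub>fob X a\<^esub>, y) = \<one>\<^bsub>fob Q a\<^esub>"
          using hq[OF a y(1)] y(2) lin_one[OF am(4) TF_amod[OF Q] hlin a] by simp
        \<comment> \<open>The first coordinate makes \<open>f z\<close> zero, hence \<open>z\<close>
          by injectivity, and then the second coordinate vanishes.\<close>
        then obtain z where z: "z \<in> el Z a" "\<one>\<^bsub>fob X a\<^esub> = f a z" "y = inv\<^bsub>fob Y a\<^esub> g a z"
          using ker[OF a] y(1) by (auto simp: N_def)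
        then have "z = \<one>\<^bsub>fob Z a\<^esub>"
          using f_inj[OF a] lin_one[OF am(3,1) flin a] one_closed[OF am(3) a] by (metis inj_onD)
        then show "y = \<one>\<^bsub>fob Y a\<^esub>"
          using z(3) lin_one[OF am(3,2) glin a] inv_one_eq[OF amod_group[OF am(2) a]] by simp
      qed
    next
      show "saturated P (\<lambda>a. q a ` el Y a)"
        unfolding saturated_def
      proof (intro ballI, clarify)
        fix a b w u y' assume w: "(a, b, w) \<in> W" and u: "u \<in> el P a" and y': "y' \<in> el Y b" "fmor P a b w u = q b y'"
        note ab = W_arrow[OF w, THEN conjunct1] W_arrow[OF w, THEN conjunct2, THEN conjunct1] W_arrow[OF w, THEN conjunct2, THEN conjunct2]
        interpret G: comm_group "fob X b" by (rule amod_group[OF am(1) ab(2)])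
        obtain x y where xy: "x \<in> el X a" "y \<in> el Y a" "u = p a x \<otimes>\<^bsub>fob P a\<^esub> q a y"
          using split[OF ab(1) u] by blast
        have "fmor P a b w u = p b (fmor X a b w x) \<otimes>\<^bsub>fob P b\<^esub> q b (fmor Y a b w y)"
          using ab xy by (simp add: act_mult[OF am(4)] lin_closed[OF plin] lin_closed[OF qlin] lin_act[OF plin] lin_act[OF qlin])
        then have "h b (fmor P a b w u) = \<pi> b (fmor X a b w x, fmor Y a b w y)"
          using ab xy \<pi>_split[of b "fmor X a b w x" "fmor Y a b w y"]
          by (simp add: lin_mult[OF hlin] hp hq act_closed[OF am(1)] act_closed[OF am(2)] lin_closed[OF plin] lin_closed[OF qlin])
        \<comment> \<open>Comparing first coordinates puts \<open>w x\<close> into the image of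
          \<open>f\<close>. Saturation puts \<open>x\<close> there as well, so \<open>p x\<close>
          can be rewritten as a value of \<open>q\<close>.\<close>
        then have "\<pi> b (fmor X a b w x, fmor Y a b w y) = \<pi> b (\<one>\<^bsub>fob X b\<^esub>, y')"
          using y' hq ab by simp
        then obtain z where z: "z \<in> el Z b" "fmor X a b w x = f b z"
          using ab xy y' lin_closed[OF flin]
          by (auto simp: \<pi>_eq act_closed[OF am(1)] act_closed[OF am(2)])
        then have "x \<in> f a ` el Z a" using f_sat w xy(1) by (auto simp: saturated_def)
        then obtain z' where z': "z' \<in> el Z a" "x = f a z'" by auto
        then have "u = q a (g a z' \<otimes>\<^bsub>fob Y a\<^esub> y)"
          using xy ab by (simp add: pf lin_mult[OF qlin] lin_closed[OF glin])
        then show "u \<in> q a ` el Y a"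
          using z' xy ab by (auto simp: mult_closed[OF am(2)] lin_closed[OF glin])
      qed
    qed
  qed
qed

lemma quasi_abelian_TF: "quasi_abelian TF"
  unfolding quasi_abelian_def
proof (intro conjI ballI allI impI)
  fix X Y f assume "X \<in> Ob TF" "Y \<in> Ob TF" "f \<in> Hom TF X Y"
  then show "\<exists>K k. is_kernel TF X Y f K k" "\<exists>Q c. is_cokernel TF X Y f Q c"
    using kernel_TF(2) cokernel_TF by blast+
qed (use additive_TF cokernel_map_pullback kernel_map_pushout in blast)+

end

section \<open>Filtered direct limits\<close>

locale filtered_diagram = torsionfree_modules r A W
  for r :: "'u rel" and A :: "('o, 'm, 'z) precat_scheme" and W +
  fixes J :: "('u, 'u) cat" and D
  assumes diagram: "small_filtered_diagram r J TF D"
begin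

lemma category_J: "category J" and small_J: "small (Ob J)" and J_nonempty: "Ob J \<noteq> {}"
  and functor_D: "is_functor J TF D"
  using diagram by (auto simp: small_filtered_diagram_def small_category_def filtered_category_def)

lemma J_bound:
  assumes "i \<in> Ob J" "j \<in> Ob J"
  shows "\<exists>k\<in>Ob J. \<exists>u\<in>Hom J i k. \<exists>v\<in>Hom J j k. True"
proof -
  have "\<exists>k\<in>Ob J. Hom J i k \<noteq> {} \<and> Hom J j k \<noteq> {}"
    using diagram assms by (simp add: small_filtered_diagram_def filtered_category_def)
  then show ?thesis by (simp add: ex_in_conv[symmetric])
qed

lemma J_equalise: "i \<in> Ob J \<Longrightarrow> j \<in> Ob J \<Longrightarrow> u \<in> Hom J i j \<Longrightarrow> v \<in> Hom J i j
    \<Longrightarrow> \<exists>k\<in>Ob J. \<exists>w\<in>Hom J j k. Cmp J i j k w u = Cmp J i j k w v"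
  using diagram by (simp add: small_filtered_diagram_def filtered_category_def)

lemmas J_Cmp = category.Cmp_in[OF category_J] and J_Idt = category.Idt_in[OF category_J]

lemma D_ob [simp]: "i \<in> Ob J \<Longrightarrow> fob D i \<in> Ob TF"
  using functor_D by (simp add: is_functor_def)

lemma D_mor: "i \<in> Ob J \<Longrightarrow> j \<in> Ob J \<Longrightarrow> u \<in> Hom J i j \<Longrightarrow> fmor D i j u \<in> Hom TF (fob D i) (fob D j)"
  using functor_D by (simp add: is_functor_def)

lemma D_lin: "i \<in> Ob J \<Longrightarrow> j \<in> Ob J \<Longrightarrow> u \<in> Hom J i j \<Longrightarrow> alin (fob D i) (fob D j) (fmor D i j u)"
  by (rule TF_Hom_lin[OF _ _ D_mor]) auto

lemma D_closed: "i \<in> Ob J \<Longrightarrow> j \<in> Ob J \<Longrightarrow> u \<in> Hom J i j \<Longrightarrow> a \<in> Ob A \<Longrightarrow> x \<in> el (fob D i) a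
    \<Longrightarrow> fmor D i j u a x \<in> el (fob D j) a"
  by (rule lin_closed[OF D_lin])

lemma D_Idt: "i \<in> Ob J \<Longrightarrow> a \<in> Ob A \<Longrightarrow> x \<in> el (fob D i) a \<Longrightarrow> fmor D i i (Idt J i) a x = x"
  using functor_D by (simp add: is_functor_def TF_Idt)

lemma D_Cmp: "i \<in> Ob J \<Longrightarrow> j \<in> Ob J \<Longrightarrow> k \<in> Ob J \<Longrightarrow> u \<in> Hom J i j \<Longrightarrow> v \<in> Hom J j k \<Longrightarrow> a \<in> Ob A
    \<Longrightarrow> x \<in> el (fob D i) a \<Longrightarrow> fmor D i k (Cmp J i j k v u) a x = fmor D j k v a (fmor D i j u a x)"
  using functor_D by (simp add: is_functor_def TF_Cmp)

text \<open>A common bound of \<open>k\<close> and \<open>k'\<close> turns the two arrows into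
  parallel ones; equalising these closes the square.\<close>

lemma J_merge:
  assumes "i \<in> Ob J" "k \<in> Ob J" "k' \<in> Ob J" "u \<in> Hom J i k" "u' \<in> Hom J i k'"
  obtains l w w' where "l \<in> Ob J" "w \<in> Hom J k l" "w' \<in> Hom J k' l" "Cmp J i k l w u = Cmp J i k' l w' u'"
proof -
  obtain m s t where m: "m \<in> Ob J" "s \<in> Hom J k m" "t \<in> Hom J k' m"
    using J_bound[OF assms(2,3)] by blast
  obtain l e where l: "l \<in> Ob J" "e \<in> Hom J m l"
    "Cmp J i m l e (Cmp J i k m s u) = Cmp J i m l e (Cmp J i k' m t u')"
    using J_equalise[of i m "Cmp J i k m s u" "Cmp J i k' m t u'"] J_Cmp assms m by metis
  show ?thesis
    by (rule that[of l "Cmp J k m l e s" "Cmp J k' m l e t"])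
      (use assms m l in \<open>auto simp: J_Cmp category.Cmp_assoc[OF category_J, symmetric]\<close>)
qed

text \<open>A filtered direct limit described on elements: the stages cover \<open>L\<close>, and
  what vanishes in \<open>L\<close> vanishes at a later stage. Stating the second clause for zero
  suffices, because differences reduce equality of elements to it.\<close>

definition elcolim where
  "elcolim L \<iota> \<longleftrightarrow> is_cocone J TF D L \<iota> \<and>
     (\<forall>a\<in>Ob A. \<forall>y\<in>el L a. \<exists>i\<in>Ob J. \<exists>x\<in>el (fob D i) a. y = \<iota> i a x) \<and>
     (\<forall>a\<in>Ob A. \<forall>i\<in>Ob J. \<forall>x\<in>el (fob D i) a. \<iota> i a x = \<one>\<^bsub>fob L a\<^esub>
        \<longrightarrow> (\<exists>j\<in>Ob J. \<exists>u\<in>Hom J i j. fmor D i j u a x = \<one>\<^bsub>fob (fob D j) a\<^esub>))"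

lemma coconeD:
  assumes "is_cocone J TF D L \<iota>"
  shows "L \<in> Ob TF" "i \<in> Ob J \<Longrightarrow> \<iota> i \<in> Hom TF (fob D i) L" "i \<in> Ob J \<Longrightarrow> alin (fob D i) L (\<iota> i)"
    "i \<in> Ob J \<Longrightarrow> j \<in> Ob J \<Longrightarrow> u \<in> Hom J i j \<Longrightarrow> a \<in> Ob A \<Longrightarrow> x \<in> el (fob D i) a
      \<Longrightarrow> \<iota> j a (fmor D i j u a x) = \<iota> i a x"
proof -
  show L: "L \<in> Ob TF" using assms by (simp add: is_cocone_def)
  show \<iota>: "\<iota> i \<in> Hom TF (fob D i) L" if "i \<in> Ob J"
    using assms that by (simp add: is_cocone_def)
  show "alin (fob D i) L (\<iota> i)" if "i \<in> Ob J"
    using TF_Hom_lin[OF D_ob L \<iota>] that by blast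
  assume "i \<in> Ob J" "j \<in> Ob J" "u \<in> Hom J i j" "a \<in> Ob A" "x \<in> el (fob D i) a"
  moreover from this have "Cmp TF (fob D i) (fob D j) L (\<iota> j) (fmor D i j u) = \<iota> i"
    using assms by (simp add: is_cocone_def)
  ultimately show "\<iota> j a (fmor D i j u a x) = \<iota> i a x"
    by (metis TF_Cmp_apply)
qed

lemma coconeI:
  assumes L: "L \<in> Ob TF" and \<iota>: "\<And>i. i \<in> Ob J \<Longrightarrow> alin (fob D i) L (\<iota> i)"
    and "\<And>i j u a x. i \<in> Ob J \<Longrightarrow> j \<in> Ob J \<Longrightarrow> u \<in> Hom J i j \<Longrightarrow> a \<in> Ob A \<Longrightarrow> x \<in> el (fob D i) a
      \<Longrightarrow> \<iota> j a (fmor D i j u a x) = \<iota> i a x"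
  shows "is_cocone J TF D L (\<lambda>i. mor (fob D i) (\<iota> i))"
  using assms by (simp add: is_cocone_def mor_in TF_Cmp mor_eq_iff D_closed)

lemma elcolim_eq:
  assumes L: "elcolim L \<iota>" and a: "a \<in> Ob A" and i: "i \<in> Ob J" "x \<in> el (fob D i) a" "x' \<in> el (fob D i) a"
    and eq: "\<iota> i a x = \<iota> i a x'"
  obtains j u where "j \<in> Ob J" "u \<in> Hom J i j" "fmor D i j u a x = fmor D i j u a x'"
proof -
  have co: "is_cocone J TF D L \<iota>" using L by (simp add: elcolim_def)
  note lin = coconeD(3)[OF co i(1)]
  let ?z = "x \<otimes>\<^bsub>fob (fob D i) a\<^esub> inv\<^bsub>fob (fob D i) a\<^esub> x'"
  have am: "amod L" "amod (fob D i)" using coconeD(1)[OF co] i by auto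
  have "?z \<in> el (fob D i) a" using am a i by (simp add: mult_closed inv_closed)
  moreover have "\<iota> i a ?z = \<one>\<^bsub>fob L a\<^esub>"
    using am a i eq by (simp add: lin_mult[OF lin] lin_inv[OF _ _ lin] inv_closed lin_closed[OF lin] div_eq_one_iff amod_group)
  ultimately obtain j u where j: "j \<in> Ob J" "u \<in> Hom J i j" "fmor D i j u a ?z = \<one>\<^bsub>fob (fob D j) a\<^esub>"
    using L a i(1) unfolding elcolim_def by blast
  note ulin = D_lin[OF i(1) j(1,2)]
  have "fmor D i j u a x = fmor D i j u a x'"
    using j am a i by (simp add: lin_mult[OF ulin] lin_inv[OF _ _ ulin] inv_closed lin_closed[OF ulin] div_eq_one_iff amod_group)
  then show ?thesis using that j by blast
qed

lemma elcolim_common: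
  assumes L: "elcolim L \<iota>" and y: "a \<in> Ob A" "y \<in> el L a" and y': "b \<in> Ob A" "y' \<in> el L b"
  obtains k x x' where "k \<in> Ob J" "x \<in> el (fob D k) a" "x' \<in> el (fob D k) b" "y = \<iota> k a x" "y' = \<iota> k b x'"
proof -
  have co: "is_cocone J TF D L \<iota>" using L by (simp add: elcolim_def)
  obtain i x where i: "i \<in> Ob J" "x \<in> el (fob D i) a" "y = \<iota> i a x"
    using L y unfolding elcolim_def by blast
  obtain j x' where j: "j \<in> Ob J" "x' \<in> el (fob D j) b" "y' = \<iota> j b x'"
    using L y' unfolding elcolim_def by blast
  obtain k u v where k: "k \<in> Ob J" "u \<in> Hom J i k" "v \<in> Hom J j k"
    using J_bound[OF i(1) j(1)] by blast
  show ?thesis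
    by (rule that[of k "fmor D i k u a x" "fmor D j k v b x'"])
      (use i j k y y' in \<open>simp_all add: D_closed coconeD(4)[OF co]\<close>)
qed

text \<open>Well-definedness of the map that a cocone induces on \<open>L\<close>: with both
  representatives moved to one stage, equality in \<open>L\<close> becomes equality at a later
  stage, which every cocone respects.\<close>

lemma elcolim_compare:
  assumes L: "elcolim L \<iota>" and X: "is_cocone J TF D X \<kappa>" and a: "a \<in> Ob A"
    and i: "i \<in> Ob J" "x \<in> el (fob D i) a" and j: "j \<in> Ob J" "x' \<in> el (fob D j) a"
    and eq: "\<iota> i a x = \<iota> j a x'"
  shows "\<kappa> i a x = \<kappa> j a x'"
proof -
  have co: "is_cocone J TF D L \<iota>" using L by (simp add: elcolim_def)
  obtain k u v where k: "k \<in> Ob J" "u \<in> Hom J i k" "v \<in> Hom J j k"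
    using J_bound[OF i(1) j(1)] by blast
  have "\<iota> k a (fmor D i k u a x) = \<iota> k a (fmor D j k v a x')"
    using i j k a eq by (simp add: coconeD(4)[OF co])
  then obtain l w where l: "l \<in> Ob J" "w \<in> Hom J k l"
    "fmor D k l w a (fmor D i k u a x) = fmor D k l w a (fmor D j k v a x')"
    using elcolim_eq[OF L a k(1) D_closed[OF i(1) k(1,2) a i(2)] D_closed[OF j(1) k(1,3) a j(2)]] by metis
  then have "\<kappa> k a (fmor D i k u a x) = \<kappa> k a (fmor D j k v a x')"
    using k a i j by (metis coconeD(4)[OF X] D_closed)
  then show ?thesis using i j k a by (simp add: coconeD(4)[OF X])
qed

lemma elcolim_is_colimit:
  assumes L: "elcolim L \<iota>"
  shows "is_colimit J TF D L \<iota>"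
  unfolding is_colimit_def
proof (intro conjI allI impI)
  show co: "is_cocone J TF D L \<iota>" using L by (simp add: elcolim_def)
  fix X \<kappa> assume X: "is_cocone J TF D X \<kappa>"
  have am: "L \<in> Ob TF" "X \<in> Ob TF" using coconeD(1) co X by auto
  \<comment> \<open>Some representative is chosen; by \<open>elcolim_compare\<close> the value does
    not depend on it.\<close>
  define h where "h a y = (SOME z. \<exists>i x. i \<in> Ob J \<and> x \<in> el (fob D i) a \<and> y = \<iota> i a x \<and> z = \<kappa> i a x)" for a y
  have h: "h a (\<iota> i a x) = \<kappa> i a x" if "a \<in> Ob A" "i \<in> Ob J" "x \<in> el (fob D i) a" for a i x
    unfolding h_def
  proof (rule some_equality)
    show "\<exists>i' x'. i' \<in> Ob J \<and> x' \<in> el (fob D i') a \<and> \<iota> i a x = \<iota> i' a x' \<and> \<kappa> i a x = \<kappa> i' a x'"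
      using that by blast
    fix z assume "\<exists>i' x'. i' \<in> Ob J \<and> x' \<in> el (fob D i') a \<and> \<iota> i a x = \<iota> i' a x' \<and> z = \<kappa> i' a x'"
    then obtain i' x' where *: "i' \<in> Ob J" "x' \<in> el (fob D i') a" "\<iota> i a x = \<iota> i' a x'" and z: "z = \<kappa> i' a x'"
      by blast
    show "z = \<kappa> i a x" using elcolim_compare[OF L X that *] z by simp
  qed
  have "alin L X h"
  proof (rule alinI)
    fix a y assume a: "a \<in> Ob A" and y: "y \<in> el L a"
    { obtain k x where k: "k \<in> Ob J" "x \<in> el (fob D k) a" "y = \<iota> k a x"
        using elcolim_common[OF L a y a y] by metis
      then show "h a y \<in> el X a"
        using a by (simp add: h lin_closed[OF coconeD(3)[OF X]])
      fix b f assume "b \<in> Ob A" "f \<in> Hom A a b"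
      then show "h b (fmor L a b f y) = fmor X a b f (h a y)"
        using a k by (simp add: h lin_act[OF coconeD(3)[OF co], symmetric] act_closed lin_act[OF coconeD(3)[OF X]]) }
    fix y' assume "y' \<in> el L a"
    then obtain k x x' where "k \<in> Ob J" "x \<in> el (fob D k) a" "x' \<in> el (fob D k) a" "y = \<iota> k a x" "y' = \<iota> k a x'"
      using elcolim_common[OF L a y a] by metis
    then show "h a (y \<otimes>\<^bsub>fob L a\<^esub> y') = h a y \<otimes>\<^bsub>fob X a\<^esub> h a y'"
      using a by (simp add: h lin_mult[OF coconeD(3)[OF co], symmetric] mult_closed lin_mult[OF coconeD(3)[OF X]])
  qed
  then have "mor L h \<in> Hom TF L X" using am by (simp add: mor_in)
  moreover have "\<forall>i\<in>Ob J. Cmp TF (fob D i) L X (mor L h) (\<iota> i) = \<kappa> i"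
    unfolding TF_Cmp
    using am by (simp add: eq_mor_iff[OF D_ob am(2) coconeD(2)[OF X]] h lin_closed[OF coconeD(3)[OF co]])
  moreover have "h' = mor L h" if h': "h' \<in> Hom TF L X" "\<forall>i\<in>Ob J. Cmp TF (fob D i) L X h' (\<iota> i) = \<kappa> i" for h'
  proof (rule TF_Hom_ext[OF am(1,2,2) h'(1) \<open>mor L h \<in> _\<close>])
    fix a y assume a: "a \<in> Ob A" and y: "y \<in> el L a"
    then obtain k x where k: "k \<in> Ob J" "x \<in> el (fob D k) a" "y = \<iota> k a x"
      using elcolim_common[OF L a y a y] by metis
    then have "h' a y = \<kappa> k a x" using a h'(2) by (metis TF_Cmp_apply)
    then show "h' a y = mor L h a y" using a y k by (simp add: h)
  qed
  ultimately show "\<exists>!h. h \<in> Hom TF L X \<and> (\<forall>i\<in>Ob J. Cmp TF (fob D i) L X h (\<iota> i) = \<kappa> i)" by blast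
qed

text \<open>The usual limit of sets, pairs being identified when they agree at some later stage.
  Filteredness makes this transitive and represents finitely many elements at one stage, where the
  operations are performed. Codes in \<open>'u\<close> stand for the classes; they exist because
  \<open>Ob J\<close> and the carriers are small.\<close>

lemma elcolim_exists: "\<exists>L \<iota>. elcolim L \<iota>"
proof -
  have am [simp]: "amod (fob D i)" if "i \<in> Ob J" for i using that by simp
  define E where "E a = (SIGMA i:Ob J. el (fob D i) a)" for a
  define R where "R a = {((i, x), (j, y)) | i x j y. (i, x) \<in> E a \<and> (j, y) \<in> E a \<and>
    (\<exists>k\<in>Ob J. \<exists>u\<in>Hom J i k. \<exists>v\<in>Hom J j k. fmor D i k u a x = fmor D j k v a y)}" for a
  have R_iff: "((i, x), (j, y)) \<in> R a \<longleftrightarrow> (i, x) \<in> E a \<and> (j, y) \<in> E a \<and>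
    (\<exists>k\<in>Ob J. \<exists>u\<in>Hom J i k. \<exists>v\<in>Hom J j k. fmor D i k u a x = fmor D j k v a y)" for a i x j y
    by (auto simp: R_def)
  have E_iff: "(i, x) \<in> E a \<longleftrightarrow> i \<in> Ob J \<and> x \<in> el (fob D i) a" for a i x by (simp add: E_def)
  have "\<exists>e :: 'u \<times> 'u \<Rightarrow> 'u. \<forall>p\<in>E a. \<forall>q\<in>E a. e p = e q \<longleftrightarrow> (p, q) \<in> R a" if a: "a \<in> Ob A" for a
  proof (rule small_class_map)
    show "small (E a)"
      unfolding E_def by (rule small_Sigma[OF small_J]) (simp add: a TF_small)
    show "equiv (E a) (R a)"
    proof (rule equivI)
      show "R a \<subseteq> E a \<times> E a" by (auto simp: R_def)
      show "refl_on (E a) (R a)"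
        using J_Idt by (auto simp: refl_on_def R_iff E_iff, blast)
      show "sym (R a)"
        by (rule symI) (auto simp: R_def; metis)
      show "trans (R a)"
      proof (rule transI, clarify)
        fix i x j y l z assume xy: "((i, x), (j, y)) \<in> R a" and yz: "((j, y), (l, z)) \<in> R a"
        then have el: "i \<in> Ob J" "j \<in> Ob J" "l \<in> Ob J" "x \<in> el (fob D i) a" "y \<in> el (fob D j) a" "z \<in> el (fob D l) a"
          by (auto simp: R_iff E_iff)
        obtain k u v where k: "k \<in> Ob J" "u \<in> Hom J i k" "v \<in> Hom J j k" "fmor D i k u a x = fmor D j k v a y"
          using xy by (auto simp: R_iff)
        obtain k' u' v' where k': "k' \<in> Ob J" "u' \<in> Hom J j k'" "v' \<in> Hom J l k'" "fmor D j k' u' a y = fmor D l k' v' a z"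
          using yz by (auto simp: R_iff)
        \<comment> \<open>The two stages at which \<open>y\<close> is compared are joined in such a
          way that the two images of \<open>y\<close> coincide.\<close>
        obtain m w w' where m: "m \<in> Ob J" "w \<in> Hom J k m" "w' \<in> Hom J k' m" "Cmp J j k m w v = Cmp J j k' m w' u'"
          using J_merge[OF el(2) k(1) k'(1) k(3) k'(2)] .
        have "fmor D i m (Cmp J i k m w u) a x = fmor D l m (Cmp J l k' m w' v') a z"
          using k k' m el a by (metis D_Cmp)
        then show "((i, x), (l, z)) \<in> R a"
          using el m k k' J_Cmp[of i k m u w] J_Cmp[of l k' m v' w'] by (auto simp: R_iff E_iff)
      qed
    qed
  qed
  then obtain e :: "'o \<Rightarrow> 'u \<times> 'u \<Rightarrow> 'u" where
    e: "\<And>a p q. a \<in> Ob A \<Longrightarrow> p \<in> E a \<Longrightarrow> q \<in> E a \<Longrightarrow> e a p = e a q \<longleftrightarrow> (p, q) \<in> R a"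
    by metis
  \<comment> \<open>The stage \<open>i0\<close> anchors the unit; by \<open>L_one\<close> the unit
    of any other stage has the same class.\<close>
  obtain i0 where i0: "i0 \<in> Ob J" using J_nonempty by blast
  define L :: "('o, 'm, 'u monoid, 'u \<Rightarrow> 'u) func" where
    "L = \<lparr>fob = (\<lambda>a. \<lparr>carrier = e a ` E a,
        mult = (\<lambda>p q. SOME z. \<exists>i x y. (i, x) \<in> E a \<and> (i, y) \<in> E a \<and> p = e a (i, x) \<and> q = e a (i, y)
          \<and> z = e a (i, x \<otimes>\<^bsub>fob (fob D i) a\<^esub> y)),
        one = e a (i0, \<one>\<^bsub>fob (fob D i0) a\<^esub>)\<rparr>),
      fmor = (\<lambda>a b f. \<lambda>p\<in>e a ` E a. SOME z. \<exists>i x. (i, x) \<in> E a \<and> p = e a (i, x) \<and> z = e b (i, fmor (fob D i) a b f x))\<rparr>"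
  have L_el: "el L a = e a ` E a" for a by (simp add: L_def)
  have step: "e a (j, fmor D i j u a x) = e a (i, x)"
    if "a \<in> Ob A" "i \<in> Ob J" "j \<in> Ob J" "u \<in> Hom J i j" "x \<in> el (fob D i) a" for a i j u x
  proof -
    have "fmor D j j (Idt J j) a (fmor D i j u a x) = fmor D i j u a x"
      using that by (simp add: D_Idt D_closed)
    then have "\<exists>k\<in>Ob J. \<exists>v\<in>Hom J j k. \<exists>u'\<in>Hom J i k. fmor D j k v a (fmor D i j u a x) = fmor D i k u' a x"
      using that J_Idt by blast
    then have "((j, fmor D i j u a x), (i, x)) \<in> R a"
      using that by (simp add: R_iff E_iff D_closed)
    then show ?thesis using that by (simp add: e E_iff D_closed)
  qed
  have eqD: "\<exists>k\<in>Ob J. \<exists>u\<in>Hom J i k. \<exists>v\<in>Hom J j k. fmor D i k u a x = fmor D j k v a y"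
    if "a \<in> Ob A" "i \<in> Ob J" "j \<in> Ob J" "x \<in> el (fob D i) a" "y \<in> el (fob D j) a" "e a (i, x) = e a (j, y)" for a i j x y
    using that by (simp add: e E_iff R_iff)
  have eqI: "e a (i, x) = e a (j, y)"
    if "a \<in> Ob A" "i \<in> Ob J" "j \<in> Ob J" "x \<in> el (fob D i) a" "y \<in> el (fob D j) a"
      "k \<in> Ob J" "u \<in> Hom J i k" "v \<in> Hom J j k" "fmor D i k u a x = fmor D j k v a y" for a i j x y k u v
    using that by (metis step)
  have L_mult: "e a (i, x) \<otimes>\<^bsub>fob L a\<^esub> e a (i, y) = e a (i, x \<otimes>\<^bsub>fob (fob D i) a\<^esub> y)"
    if a: "a \<in> Ob A" and i: "i \<in> Ob J" "x \<in> el (fob D i) a" "y \<in> el (fob D i) a" for a i x y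
  proof -
    have *: "e a (j, x' \<otimes>\<^bsub>fob (fob D j) a\<^esub> y') = e a (i, x \<otimes>\<^bsub>fob (fob D i) a\<^esub> y)"
      if j: "j \<in> Ob J" "x' \<in> el (fob D j) a" "y' \<in> el (fob D j) a" and
        eqx: "e a (i, x) = e a (j, x')" and eqy: "e a (i, y) = e a (j, y')" for j x' y'
    proof -
      obtain k u v where k: "k \<in> Ob J" "u \<in> Hom J i k" "v \<in> Hom J j k" "fmor D i k u a x = fmor D j k v a x'"
        using eqD[OF a i(1) j(1) i(2) j(2) eqx] by blast
      obtain k' u' v' where k': "k' \<in> Ob J" "u' \<in> Hom J i k'" "v' \<in> Hom J j k'" "fmor D i k' u' a y = fmor D j k' v' a y'"
        using eqD[OF a i(1) j(1) i(3) j(3) eqy] by blast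
      obtain l w w' where l: "l \<in> Ob J" "w \<in> Hom J k l" "w' \<in> Hom J k' l" "Cmp J i k l w u = Cmp J i k' l w' u'"
        using J_merge[OF i(1) k(1) k'(1) k(2) k'(2)] .
      have in1: "Cmp J j k l w v \<in> Hom J j l" "Cmp J j k' l w' v' \<in> Hom J j l" "Cmp J i k l w u \<in> Hom J i l"
        using i j k k' l by (simp_all add: J_Cmp)
      \<comment> \<open>The equalities for \<open>x\<close> and for \<open>y\<close> hold along
        different arrows. \<open>J_merge\<close> has unified the arrows out of \<open>i\<close>;
        this equalisation unifies those out of \<open>j\<close>, so that one arrow on each side
        serves both factors.\<close>
      obtain m d where m: "m \<in> Ob J" "d \<in> Hom J l m" "Cmp J j l m d (Cmp J j k l w v) = Cmp J j l m d (Cmp J j k' l w' v')"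
        using J_equalise[OF j(1) l(1) in1(1,2)] by blast
      define s t where "s = Cmp J i l m d (Cmp J i k l w u)" and "t = Cmp J j l m d (Cmp J j k l w v)"
      have st: "s \<in> Hom J i m" "t \<in> Hom J j m"
        using i j l m in1 by (simp_all add: s_def t_def J_Cmp)
      have "fmor D i m s a x = fmor D j m t a x'"
        unfolding s_def t_def using a i j k l(1-3) m(1,2) in1 by (simp add: D_Cmp D_closed)
      moreover have "fmor D i m s a y = fmor D j m t a y'"
        unfolding s_def t_def l(4) m(3) using a i j k' l(1-3) m(1,2) in1 by (simp add: D_Cmp D_closed J_Cmp)
      ultimately have eq: "fmor D i m s a (x \<otimes>\<^bsub>fob (fob D i) a\<^esub> y) = fmor D j m t a (x' \<otimes>\<^bsub>fob (fob D j) a\<^esub> y')"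
        using a i j m st by (simp add: lin_mult[OF D_lin])
      show ?thesis
        by (rule eqI[OF a i(1) j(1) _ _ m(1) st eq, symmetric]) (use a i j in \<open>simp_all add: mult_closed\<close>)
    qed
    have "(SOME z. \<exists>j x' y'. (j, x') \<in> E a \<and> (j, y') \<in> E a \<and> e a (i, x) = e a (j, x') \<and> e a (i, y) = e a (j, y')
          \<and> z = e a (j, x' \<otimes>\<^bsub>fob (fob D j) a\<^esub> y')) = e a (i, x \<otimes>\<^bsub>fob (fob D i) a\<^esub> y)" (is "(SOME z. ?P z) = ?z")
    proof (rule some_equality)
      show "?P ?z" using i E_iff by blast
      fix z assume "?P z"
      then obtain j x' y' where "(j, x') \<in> E a" "(j, y') \<in> E a" "e a (i, x) = e a (j, x')" "e a (i, y) = e a (j, y')"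
        and z: "z = e a (j, x' \<otimes>\<^bsub>fob (fob D j) a\<^esub> y')" by blast
      then show "z = ?z" using *[of j x' y'] by (simp add: E_iff)
    qed
    then show ?thesis by (simp add: L_def)
  qed
  have L_act: "fmor L a b f (e a (i, x)) = e b (i, fmor (fob D i) a b f x)"
    if a: "a \<in> Ob A" and b: "b \<in> Ob A" "f \<in> Hom A a b" and i: "i \<in> Ob J" "x \<in> el (fob D i) a" for a b f i x
  proof -
    have *: "e b (j, fmor (fob D j) a b f x') = e b (i, fmor (fob D i) a b f x)"
      if j: "j \<in> Ob J" "x' \<in> el (fob D j) a" and eqx: "e a (i, x) = e a (j, x')" for j x'
    proof -
      obtain k u v where k: "k \<in> Ob J" "u \<in> Hom J i k" "v \<in> Hom J j k" "fmor D i k u a x = fmor D j k v a x'"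
        using eqD[OF a i(1) j(1) i(2) j(2) eqx] by blast
      then have eq: "fmor D i k u b (fmor (fob D i) a b f x) = fmor D j k v b (fmor (fob D j) a b f x')"
        using a b i j by (simp add: lin_act[OF D_lin])
      show ?thesis
        by (rule eqI[OF b(1) i(1) j(1) _ _ k(1-3) eq, symmetric]) (use a b i j in \<open>simp_all add: act_closed\<close>)
    qed
    have "(SOME z. \<exists>j x'. (j, x') \<in> E a \<and> e a (i, x) = e a (j, x') \<and> z = e b (j, fmor (fob D j) a b f x'))
        = e b (i, fmor (fob D i) a b f x)" (is "(SOME z. ?P z) = ?z")
    proof (rule some_equality)
      show "?P ?z" using i E_iff by blast
      fix z assume "?P z"
      then obtain j x' where "(j, x') \<in> E a" "e a (i, x) = e a (j, x')" and z: "z = e b (j, fmor (fob D j) a b f x')"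
        by blast
      then show "z = ?z" using *[of j x'] by (simp add: E_iff)
    qed
    moreover have "(i, x) \<in> E a" using i by (simp add: E_iff)
    ultimately show ?thesis by (simp add: L_def)
  qed
  have L_one: "e a (i, \<one>\<^bsub>fob (fob D i) a\<^esub>) = \<one>\<^bsub>fob L a\<^esub>" if a: "a \<in> Ob A" and i: "i \<in> Ob J" for a i
  proof -
    obtain k u v where k: "k \<in> Ob J" "u \<in> Hom J i k" "v \<in> Hom J i0 k"
      using J_bound[OF i i0] by blast
    have "fmor D i k u a \<one>\<^bsub>fob (fob D i) a\<^esub> = fmor D i0 k v a \<one>\<^bsub>fob (fob D i0) a\<^esub>"
      using a i i0 k by (simp add: lin_one[OF _ _ D_lin])
    then show ?thesis
      using eqI[OF a i i0 _ _ k] a i i0 by (simp add: one_closed L_def)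
  qed
  have rep: "\<exists>i x. i \<in> Ob J \<and> x \<in> el (fob D i) a \<and> p = e a (i, x)" if "p \<in> el L a" for a p
    using that by (auto simp: L_el E_iff, blast)
  have rep_in: "e a (i, x) \<in> el L a" if "i \<in> Ob J" "x \<in> el (fob D i) a" for a i x
    using that by (auto simp: L_el E_iff)
  have rep2: "\<exists>i x y. i \<in> Ob J \<and> x \<in> el (fob D i) a \<and> y \<in> el (fob D i) a \<and> p = e a (i, x) \<and> q = e a (i, y)"
    if a: "a \<in> Ob A" and p: "p \<in> el L a" and q: "q \<in> el L a" for a p q
  proof -
    obtain i x where i: "i \<in> Ob J" "x \<in> el (fob D i) a" "p = e a (i, x)" using rep[OF p] by blast
    obtain j y where j: "j \<in> Ob J" "y \<in> el (fob D j) a" "q = e a (j, y)" using rep[OF q] by blast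
    obtain k u v where k: "k \<in> Ob J" "u \<in> Hom J i k" "v \<in> Hom J j k"
      using J_bound[OF i(1) j(1)] by blast
    show ?thesis
      using a i j k by (intro exI[of _ k] exI[of _ "fmor D i k u a x"] exI[of _ "fmor D j k v a y"])
        (simp add: D_closed step)
  qed
  have rep3: "\<exists>i x y z. i \<in> Ob J \<and> x \<in> el (fob D i) a \<and> y \<in> el (fob D i) a \<and> z \<in> el (fob D i) a
      \<and> p = e a (i, x) \<and> q = e a (i, y) \<and> s = e a (i, z)"
    if a: "a \<in> Ob A" and p: "p \<in> el L a" and q: "q \<in> el L a" and s: "s \<in> el L a" for a p q s
  proof -
    obtain i x y where i: "i \<in> Ob J" "x \<in> el (fob D i) a" "y \<in> el (fob D i) a" "p = e a (i, x)" "q = e a (i, y)"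
      using rep2[OF a p q] by blast
    obtain j z where j: "j \<in> Ob J" "z \<in> el (fob D j) a" "s = e a (j, z)" using rep[OF s] by blast
    obtain k u v where k: "k \<in> Ob J" "u \<in> Hom J i k" "v \<in> Hom J j k"
      using J_bound[OF i(1) j(1)] by blast
    show ?thesis
      using a i j k by (intro exI[of _ k] exI[of _ "fmor D i k u a x"] exI[of _ "fmor D i k u a y"] exI[of _ "fmor D j k v a z"])
        (simp add: D_closed step)
  qed
  have L_group: "comm_group (fob L a)" if a: "a \<in> Ob A" for a
  proof (rule comm_groupI)
    note grp = amod_group[OF am a]
    fix p assume p: "p \<in> el L a"
    obtain i x where i: "i \<in> Ob J" "x \<in> el (fob D i) a" "p = e a (i, x)" using rep[OF p] by blast
    show "\<one>\<^bsub>fob L a\<^esub> \<otimes>\<^bsub>fob L a\<^esub> p = p"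
      using a i by (simp add: L_one[symmetric] L_mult one_closed comm_groupE(5)[OF grp])
    obtain y where "y \<in> el (fob D i) a" "y \<otimes>\<^bsub>fob (fob D i) a\<^esub> x = \<one>\<^bsub>fob (fob D i) a\<^esub>"
      using comm_groupE(6)[OF grp[OF i(1)] i(2)] by blast
    then show "\<exists>q\<in>el L a. q \<otimes>\<^bsub>fob L a\<^esub> p = \<one>\<^bsub>fob L a\<^esub>"
      using a i by (intro bexI[of _ "e a (i, y)"]) (simp_all add: L_mult L_one rep_in)
  next
    note grp = amod_group[OF am a]
    fix p q assume "p \<in> el L a" "q \<in> el L a"
    then obtain i x y where i: "i \<in> Ob J" "x \<in> el (fob D i) a" "y \<in> el (fob D i) a" "p = e a (i, x)" "q = e a (i, y)"
      using rep2[OF a] by blast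
    show "p \<otimes>\<^bsub>fob L a\<^esub> q \<in> el L a" "p \<otimes>\<^bsub>fob L a\<^esub> q = q \<otimes>\<^bsub>fob L a\<^esub> p"
      using a i by (simp_all add: L_mult rep_in mult_closed comm_groupE(4)[OF grp[OF i(1)]])
  next
    note grp = amod_group[OF am a]
    fix p q s assume "p \<in> el L a" "q \<in> el L a" "s \<in> el L a"
    then obtain i x y z where i: "i \<in> Ob J" "x \<in> el (fob D i) a" "y \<in> el (fob D i) a" "z \<in> el (fob D i) a"
      "p = e a (i, x)" "q = e a (i, y)" "s = e a (i, z)"
      using rep3[OF a] by metis
    show "p \<otimes>\<^bsub>fob L a\<^esub> q \<otimes>\<^bsub>fob L a\<^esub> s = p \<otimes>\<^bsub>fob L a\<^esub> (q \<otimes>\<^bsub>fob L a\<^esub> s)"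
      using a i by (simp add: L_mult mult_closed comm_groupE(3)[OF grp])
  next
    show "\<one>\<^bsub>fob L a\<^esub> \<in> el L a"
      using L_one[OF a i0] rep_in[OF i0 one_closed[OF am[OF i0] a]] by simp
  qed
  have "amod L"
  proof (rule amodI[OF L_group])
    fix a b f p q assume *: "a \<in> Ob A" "b \<in> Ob A" "f \<in> Hom A a b" "p \<in> el L a" "q \<in> el L a"
    then obtain i x y where "i \<in> Ob J" "x \<in> el (fob D i) a" "y \<in> el (fob D i) a" "p = e a (i, x)" "q = e a (i, y)"
      using rep2 by metis
    then show "fmor L a b f (p \<otimes>\<^bsub>fob L a\<^esub> q) = fmor L a b f p \<otimes>\<^bsub>fob L b\<^esub> fmor L a b f q"
      using * by (simp add: L_mult L_act mult_closed act_mult act_closed)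
  next
    fix a b f p assume *: "a \<in> Ob A" "b \<in> Ob A" "f \<in> Hom A a b" "p \<in> el L a"
    then obtain i x where i: "i \<in> Ob J" "x \<in> el (fob D i) a" "p = e a (i, x)"
      using rep by metis
    then show "fmor L a b f p \<in> el L b"
      using * by (simp add: L_act rep_in act_closed)
    { fix g assume "g \<in> Hom A a b"
      then show "fmor L a b (Plus A a b f g) p = fmor L a b f p \<otimes>\<^bsub>fob L b\<^esub> fmor L a b g p"
        using * i by (simp add: L_act L_mult Plus_in act_Plus act_closed) }
    { fix c g assume "c \<in> Ob A" "g \<in> Hom A b c"
      then show "fmor L a c (Cmp A a b c g f) p = fmor L b c g (fmor L a b f p)"
        using * i by (simp add: L_act Cmp_in act_Cmp act_closed) }
  next
    fix a p assume *: "a \<in> Ob A" "p \<in> el L a"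
    then obtain i x where i: "i \<in> Ob J" "x \<in> el (fob D i) a" "p = e a (i, x)"
      using rep by metis
    then show "fmor L a a (Idt A a) p = p"
      using * by (simp add: L_act Idt_in act_Idt)
  qed
  have ker: "\<exists>j\<in>Ob J. \<exists>u\<in>Hom J i j. fmor D i j u a x = \<one>\<^bsub>fob (fob D j) a\<^esub>"
    if a: "a \<in> Ob A" and i: "i \<in> Ob J" "x \<in> el (fob D i) a" and eq: "e a (i, x) = \<one>\<^bsub>fob L a\<^esub>" for a i x
  proof -
    obtain k u v where k: "k \<in> Ob J" "u \<in> Hom J i k" "v \<in> Hom J i k" "fmor D i k u a x = fmor D i k v a \<one>\<^bsub>fob (fob D i) a\<^esub>"
      using eqD[OF a i(1) i(1) i(2) one_closed[OF am[OF i(1)] a]] eq L_one[OF a i(1)] by metis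
    then have "fmor D i k u a x = \<one>\<^bsub>fob (fob D k) a\<^esub>"
      using i a by (simp add: lin_one[OF _ _ D_lin])
    then show ?thesis using k by blast
  qed
  have "tfree L"
  proof (rule tfreeI[OF \<open>amod L\<close>])
    fix a b w p assume w: "(a, b, w) \<in> W" and p: "p \<in> el L a" "fmor L a b w p = \<one>\<^bsub>fob L b\<^esub>"
    note ab = W_arrow[OF w, THEN conjunct1] W_arrow[OF w, THEN conjunct2, THEN conjunct1] W_arrow[OF w, THEN conjunct2, THEN conjunct2]
    obtain i x where i: "i \<in> Ob J" "x \<in> el (fob D i) a" "p = e a (i, x)" using rep[OF p(1)] by blast
    \<comment> \<open>\<open>w x\<close> vanishes at a later stage, and torsion-freeness there makes
      \<open>x\<close> vanish at that same stage.\<close>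
    obtain j u where j: "j \<in> Ob J" "u \<in> Hom J i j" "fmor D i j u b (fmor (fob D i) a b w x) = \<one>\<^bsub>fob (fob D j) b\<^esub>"
      using ker[OF ab(2) i(1) act_closed[OF am[OF i(1)] ab i(2)]] p i ab by (auto simp: L_act)
    then have "fmor (fob D j) a b w (fmor D i j u a x) = \<one>\<^bsub>fob (fob D j) b\<^esub>"
      using i ab by (simp add: lin_act[OF D_lin])
    then have "fmor D i j u a x = \<one>\<^bsub>fob (fob D j) a\<^esub>"
      using tfreeD[OF TF_tfree[OF D_ob[OF j(1)]] am[OF j(1)] w D_closed[OF i(1) j(1,2) ab(1) i(2)]] by blast
    then show "p = \<one>\<^bsub>fob L a\<^esub>"
      using step[OF ab(1) i(1) j(1,2) i(2)] L_one[OF ab(1) j(1)] i(3) by simp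
  qed
  moreover have "small (el L a)" if "a \<in> Ob A" for a
    unfolding L_el E_def by (intro small_image small_Sigma small_J) (simp add: that TF_small)
  moreover have "fmor L a b f \<in> extensional (el L a)" for a b f
    by (simp add: L_def)
  ultimately have L: "L \<in> Ob TF" using \<open>amod L\<close> by (simp add: TF_Ob)
  define \<iota> where "\<iota> = (\<lambda>i. mor (fob D i) (\<lambda>a x. e a (i, x)))"
  have "is_cocone J TF D L \<iota>"
    unfolding \<iota>_def by (rule coconeI[OF L alinI]) (simp_all add: rep_in L_mult L_act step)
  then have "elcolim L \<iota>"
    unfolding elcolim_def using rep ker by (fastforce simp: \<iota>_def)
  then show ?thesis by blast
qed

text \<open>A colimit known only by its universal property is compared with the constructed one.
  Uniqueness makes the composite from \<open>L\<close> to \<open>K\<close> and back the identity,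
  and this carries covering and vanishing over from \<open>K\<close> to \<open>L\<close>.\<close>

lemma is_colimit_iff: "is_colimit J TF D L \<iota> \<longleftrightarrow> elcolim L \<iota>"
proof
  assume L: "is_colimit J TF D L \<iota>"
  then have co: "is_cocone J TF D L \<iota>" by (simp add: is_colimit_def)
  note Lo = coconeD(1)[OF co]
  obtain K \<kappa> where K: "elcolim K \<kappa>" using elcolim_exists by blast
  then have coK: "is_cocone J TF D K \<kappa>" by (simp add: elcolim_def)
  note Ko = coconeD(1)[OF coK]
  obtain h where h: "h \<in> Hom TF L K" "\<forall>i\<in>Ob J. Cmp TF (fob D i) L K h (\<iota> i) = \<kappa> i"
    using L coK unfolding is_colimit_def by blast
  obtain k where k: "k \<in> Hom TF K L" "\<forall>i\<in>Ob J. Cmp TF (fob D i) K L k (\<kappa> i) = \<iota> i"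
    using elcolim_is_colimit[OF K] co unfolding is_colimit_def by blast
  have h_app: "h a (\<iota> i a x) = \<kappa> i a x" if "i \<in> Ob J" "a \<in> Ob A" "x \<in> el (fob D i) a" for i a x
    using h(2) that by (metis TF_Cmp_apply)
  have k_app: "k a (\<kappa> i a x) = \<iota> i a x" if "i \<in> Ob J" "a \<in> Ob A" "x \<in> el (fob D i) a" for i a x
    using k(2) that by (metis TF_Cmp_apply)
  have \<iota>_in: "\<iota> i a x \<in> el L a" if "i \<in> Ob J" "a \<in> Ob A" "x \<in> el (fob D i) a" for i a x
    using lin_closed[OF coconeD(3)[OF co]] that by blast
  have "Cmp TF L K L k h = mor L (\<lambda>a x. x)"
  proof -
    have *: "\<exists>!g. g \<in> Hom TF L L \<and> (\<forall>i\<in>Ob J. Cmp TF (fob D i) L L g (\<iota> i) = \<iota> i)"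
      using L co unfolding is_colimit_def by blast
    have "mor L (\<lambda>a x. x) \<in> Hom TF L L" "Cmp TF L K L k h \<in> Hom TF L L"
      using Lo by (simp_all add: mor_in alin_id TF_Cmp_in[OF Lo Ko Lo h(1) k(1)])
    moreover have "Cmp TF (fob D i) L L (mor L (\<lambda>a x. x)) (\<iota> i) = \<iota> i" "Cmp TF (fob D i) L L (Cmp TF L K L k h) (\<iota> i) = \<iota> i"
      if i: "i \<in> Ob J" for i
      unfolding TF_Cmp eq_mor_iff[OF D_ob[OF i] Lo coconeD(2)[OF co i]]
      by (simp_all add: \<iota>_in i h_app k_app)
    ultimately show ?thesis using * by blast
  qed
  then have kh: "k a (h a y) = y" if "a \<in> Ob A" "y \<in> el L a" for a y
    using that by (simp add: TF_Cmp mor_eq_iff)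
  show "elcolim L \<iota>"
    unfolding elcolim_def
  proof (intro conjI ballI impI co)
    fix a y assume a: "a \<in> Ob A" and y: "y \<in> el L a"
    have "h a y \<in> el K a" using lin_closed[OF TF_Hom_lin[OF Lo Ko h(1)] a y] .
    then obtain i x where "i \<in> Ob J" "x \<in> el (fob D i) a" "h a y = \<kappa> i a x"
      using K a unfolding elcolim_def by blast
    then show "\<exists>i\<in>Ob J. \<exists>x\<in>el (fob D i) a. y = \<iota> i a x"
      using kh[OF a y] k_app a by metis
  next
    fix a i x assume *: "a \<in> Ob A" "i \<in> Ob J" "x \<in> el (fob D i) a" "\<iota> i a x = \<one>\<^bsub>fob L a\<^esub>"
    then have "\<kappa> i a x = \<one>\<^bsub>fob K a\<^esub>"
      using h_app[of i a x] lin_one[OF _ _ TF_Hom_lin[OF Lo Ko h(1)], of a] Lo Ko by simp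
    then show "\<exists>j\<in>Ob J. \<exists>u\<in>Hom J i j. fmor D i j u a x = \<one>\<^bsub>fob (fob D j) a\<^esub>"
      using K * unfolding elcolim_def by blast
  qed
qed (rule elcolim_is_colimit)

end

section \<open>Existence and exactness of filtered direct limits\<close>

context torsionfree_modules
begin

lemma filtered_diagramI: "small_filtered_diagram r J TF D \<Longrightarrow> filtered_diagram r A W J D"
  by unfold_locales

lemma has_filtered_colimits_TF: "has_filtered_colimits r TF"
  unfolding has_filtered_colimits_def
proof (intro allI impI)
  fix J :: "('u, 'u) cat" and D assume "small_filtered_diagram r J TF D"
  then interpret filtered_diagram r A W J D by (rule filtered_diagramI)
  show "\<exists>L \<iota>. is_colimit J TF D L \<iota>"
    using elcolim_exists is_colimit_iff by blast
qed

text \<open>\<open>conflation_iff\<close> and \<open>is_colimit_iff\<close> turn everything into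
  statements on elements, settled by chases: represent an element at a stage, move along the diagram
  until its image vanishes, and use exactness there.\<close>

lemma exact_filtered_colimits_TF: "exact_filtered_colimits r TF"
  unfolding exact_filtered_colimits_def
proof (intro allI impI, elim conjE)
  fix J :: "('u, 'u) cat" and D D' D'' \<phi> \<psi> L L' L'' \<iota> \<iota>' \<iota>'' f g
  assume diag: "small_filtered_diagram r J TF D" "small_filtered_diagram r J TF D'" "small_filtered_diagram r J TF D''"
    and nat: "\<phi> \<in> nat_trans J TF D D'" "\<psi> \<in> nat_trans J TF D' D''"
    and confl: "\<forall>i\<in>Ob J. conflation TF (fob D i) (fob D' i) (fob D'' i) (\<phi> i) (\<psi> i)"
    and colim: "is_colimit J TF D L \<iota>" "is_colimit J TF D' L' \<iota>'" "is_colimit J TF D'' L'' \<iota>''"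
    and f: "f \<in> Hom TF L L'" and g: "g \<in> Hom TF L' L''"
    and f\<iota>: "\<forall>i\<in>Ob J. Cmp TF (fob D i) L L' f (\<iota> i) = Cmp TF (fob D i) (fob D' i) L' (\<iota>' i) (\<phi> i)"
    and g\<iota>: "\<forall>i\<in>Ob J. Cmp TF (fob D' i) L' L'' g (\<iota>' i) = Cmp TF (fob D' i) (fob D'' i) L'' (\<iota>'' i) (\<psi> i)"
  interpret D: filtered_diagram r A W J D by (rule filtered_diagramI[OF diag(1)])
  interpret D': filtered_diagram r A W J D' by (rule filtered_diagramI[OF diag(2)])
  interpret D'': filtered_diagram r A W J D'' by (rule filtered_diagramI[OF diag(3)])
  have L: "D.elcolim L \<iota>" and L': "D'.elcolim L' \<iota>'" and L'': "D''.elcolim L'' \<iota>''"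
    using colim D.is_colimit_iff D'.is_colimit_iff D''.is_colimit_iff by auto
  have co: "is_cocone J TF D L \<iota>" and co': "is_cocone J TF D' L' \<iota>'" and co'': "is_cocone J TF D'' L'' \<iota>''"
    using colim by (simp_all add: is_colimit_def)
  have ob: "L \<in> Ob TF" "L' \<in> Ob TF" "L'' \<in> Ob TF"
    using D.coconeD(1)[OF co] D'.coconeD(1)[OF co'] D''.coconeD(1)[OF co''] by auto
  note flin = TF_Hom_lin[OF ob(1,2) f] and glin = TF_Hom_lin[OF ob(2,3) g]
  have \<phi>: "\<phi> i \<in> Hom TF (fob D i) (fob D' i)" and \<psi>: "\<psi> i \<in> Hom TF (fob D' i) (fob D'' i)" if "i \<in> Ob J" for i
    using nat that by (auto simp: nat_trans_def)
  note \<phi>lin = TF_Hom_lin[OF D.D_ob D'.D_ob \<phi>] and \<psi>lin = TF_Hom_lin[OF D'.D_ob D''.D_ob \<psi>]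
  have \<phi>nat: "\<phi> j a (fmor D i j u a x) = fmor D' i j u a (\<phi> i a x)"
    if "i \<in> Ob J" "j \<in> Ob J" "u \<in> Hom J i j" "a \<in> Ob A" "x \<in> el (fob D i) a" for i j u a x
  proof -
    have "Cmp TF (fob D i) (fob D j) (fob D' j) (\<phi> j) (fmor D i j u) = Cmp TF (fob D i) (fob D' i) (fob D' j) (fmor D' i j u) (\<phi> i)"
      using nat that unfolding nat_trans_def by blast
    then show ?thesis using that by (simp add: TF_Cmp mor_eq_iff)
  qed
  have \<psi>nat: "\<psi> j a (fmor D' i j u a x) = fmor D'' i j u a (\<psi> i a x)"
    if "i \<in> Ob J" "j \<in> Ob J" "u \<in> Hom J i j" "a \<in> Ob A" "x \<in> el (fob D' i) a" for i j u a x
  proof -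
    have "Cmp TF (fob D' i) (fob D' j) (fob D'' j) (\<psi> j) (fmor D' i j u) = Cmp TF (fob D' i) (fob D'' i) (fob D'' j) (fmor D'' i j u) (\<psi> i)"
      using nat that unfolding nat_trans_def by blast
    then show ?thesis using that by (simp add: TF_Cmp mor_eq_iff)
  qed
  have ex: "inj_on (\<phi> i a) (el (fob D i) a)" "\<psi> i a ` el (fob D' i) a = el (fob D'' i) a"
    "\<phi> i a ` el (fob D i) a = {y \<in> el (fob D' i) a. \<psi> i a y = \<one>\<^bsub>fob (fob D'' i) a\<^esub>}" if "i \<in> Ob J" "a \<in> Ob A" for i a
    using confl that conflation_iff[OF D.D_ob D'.D_ob D''.D_ob \<phi> \<psi>] by blast+
  have fapp: "f a (\<iota> i a x) = \<iota>' i a (\<phi> i a x)" if "i \<in> Ob J" "a \<in> Ob A" "x \<in> el (fob D i) a" for i a x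
    using f\<iota> that by (simp add: TF_Cmp mor_eq_iff)
  have gapp: "g a (\<iota>' i a x) = \<iota>'' i a (\<psi> i a x)" if "i \<in> Ob J" "a \<in> Ob A" "x \<in> el (fob D' i) a" for i a x
    using g\<iota> that by (simp add: TF_Cmp mor_eq_iff)
  show "conflation TF L L' L'' f g"
    unfolding conflation_iff[OF ob f g]
  proof (intro ballI conjI)
    fix a assume a: "a \<in> Ob A"
    show "inj_on (f a) (el L a)"
    proof (rule lin_inj_onI[OF _ _ flin a])
      fix y assume y: "y \<in> el L a" "f a y = \<one>\<^bsub>fob L' a\<^esub>"
      obtain i x where i: "i \<in> Ob J" "x \<in> el (fob D i) a" "y = \<iota> i a x"
        using L a y(1) unfolding D.elcolim_def by blast
      have "\<iota>' i a (\<phi> i a x) = \<one>\<^bsub>fob L' a\<^esub>" using y(2) i a by (simp add: fapp)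
      then obtain j u where j: "j \<in> Ob J" "u \<in> Hom J i j" "fmor D' i j u a (\<phi> i a x) = \<one>\<^bsub>fob (fob D' j) a\<^esub>"
        using L' a i lin_closed[OF \<phi>lin[OF i(1) i(1) i(1)] a i(2)] unfolding D'.elcolim_def by blast
      then have "\<phi> j a (fmor D i j u a x) = \<phi> j a \<one>\<^bsub>fob (fob D j) a\<^esub>"
        using i a by (simp add: \<phi>nat lin_one[OF _ _ \<phi>lin])
      then have "fmor D i j u a x = \<one>\<^bsub>fob (fob D j) a\<^esub>"
        using ex(1)[OF j(1) a] i a j by (auto simp: D.D_closed one_closed dest!: inj_onD)
      then show "y = \<one>\<^bsub>fob L a\<^esub>"
        using D.coconeD(4)[OF co i(1) j(1,2) a i(2)] i(3) lin_one[OF _ _ D.coconeD(3)[OF co j(1)] a] j ob by simp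
    qed (use ob in auto)
    show "g a ` el L' a = el L'' a"
    proof
      show "g a ` el L' a \<subseteq> el L'' a" using lin_closed[OF glin a] by blast
      show "el L'' a \<subseteq> g a ` el L' a"
      proof
        fix y assume "y \<in> el L'' a"
        then obtain i x where i: "i \<in> Ob J" "x \<in> el (fob D'' i) a" "y = \<iota>'' i a x"
          using L'' a unfolding D''.elcolim_def by blast
        then obtain z where z: "z \<in> el (fob D' i) a" "x = \<psi> i a z" using ex(2)[OF i(1) a] by blast
        then have "y = g a (\<iota>' i a z)" using i a by (simp add: gapp)
        then show "y \<in> g a ` el L' a" using lin_closed[OF D'.coconeD(3)[OF co' i(1)] a z(1)] by blast
      qed
    qed
    show "f a ` el L a = {y \<in> el L' a. g a y = \<one>\<^bsub>fob L'' a\<^esub>}"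
    proof
      show "f a ` el L a \<subseteq> {y \<in> el L' a. g a y = \<one>\<^bsub>fob L'' a\<^esub>}"
      proof clarify
        fix y assume y: "y \<in> el L a"
        then obtain i x where i: "i \<in> Ob J" "x \<in> el (fob D i) a" "y = \<iota> i a x"
          using L a unfolding D.elcolim_def by blast
        have "\<phi> i a x \<in> el (fob D' i) a" "\<psi> i a (\<phi> i a x) = \<one>\<^bsub>fob (fob D'' i) a\<^esub>"
          using ex(3)[OF i(1) a] i(2) by blast+
        then have "g a (f a y) = \<one>\<^bsub>fob L'' a\<^esub>"
          using i a ob by (simp add: fapp gapp lin_one[OF _ _ D''.coconeD(3)[OF co'']])
        then show "f a y \<in> el L' a \<and> g a (f a y) = \<one>\<^bsub>fob L'' a\<^esub>"
          using lin_closed[OF flin a y] by blast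
      qed
      show "{y \<in> el L' a. g a y = \<one>\<^bsub>fob L'' a\<^esub>} \<subseteq> f a ` el L a"
      proof clarify
        fix y assume y: "y \<in> el L' a" "g a y = \<one>\<^bsub>fob L'' a\<^esub>"
        obtain i x where i: "i \<in> Ob J" "x \<in> el (fob D' i) a" "y = \<iota>' i a x"
          using L' a y(1) unfolding D'.elcolim_def by blast
        have "\<iota>'' i a (\<psi> i a x) = \<one>\<^bsub>fob L'' a\<^esub>" using y(2) i a by (simp add: gapp)
        then obtain j u where j: "j \<in> Ob J" "u \<in> Hom J i j" "fmor D'' i j u a (\<psi> i a x) = \<one>\<^bsub>fob (fob D'' j) a\<^esub>"
          using L'' a i lin_closed[OF \<psi>lin[OF i(1) i(1) i(1)] a i(2)] unfolding D''.elcolim_def by blast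
        \<comment> \<open>At stage \<open>j\<close> the image under \<open>\<psi> j\<close> is zero,
          so exactness at that stage supplies a preimage under \<open>\<phi> j\<close>.\<close>
        then have "fmor D' i j u a x \<in> \<phi> j a ` el (fob D j) a"
          using i a by (simp add: ex(3) D'.D_closed \<psi>nat)
        then obtain z where z: "z \<in> el (fob D j) a" "fmor D' i j u a x = \<phi> j a z" by blast
        then have "y = f a (\<iota> j a z)"
          using D'.coconeD(4)[OF co' i(1) j(1,2) a i(2)] i(3) j a by (simp add: fapp)
        then show "y \<in> f a ` el L a" using lin_closed[OF D.coconeD(3)[OF co j(1)] a z(1)] by blast
      qed
    qed
  qed
qed

section \<open>Finitely presented modules\<close>

text \<open>Surjectivity of the canonical map says that maps into the limit factor through a stage.
  For injectivity, two factorisations that agree at a later stage are each one step away from a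
  common map, hence lie in one class.\<close>

lemma finitely_presentableI:
  assumes X: "X \<in> Ob TF"
    and surj: "\<And>(J :: ('u, 'u) cat) D L \<iota> g. small_filtered_diagram r J TF D \<Longrightarrow> is_colimit J TF D L \<iota> \<Longrightarrow>
      g \<in> Hom TF X L \<Longrightarrow> \<exists>i\<in>Ob J. \<exists>f\<in>Hom TF X (fob D i). Cmp TF X (fob D i) L (\<iota> i) f = g"
    and inj: "\<And>(J :: ('u, 'u) cat) D L \<iota> i j f g. small_filtered_diagram r J TF D \<Longrightarrow> is_colimit J TF D L \<iota> \<Longrightarrow>
      i \<in> Ob J \<Longrightarrow> j \<in> Ob J \<Longrightarrow> f \<in> Hom TF X (fob D i) \<Longrightarrow> g \<in> Hom TF X (fob D j) \<Longrightarrow>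
      Cmp TF X (fob D i) L (\<iota> i) f = Cmp TF X (fob D j) L (\<iota> j) g \<Longrightarrow>
      \<exists>k\<in>Ob J. \<exists>u\<in>Hom J i k. \<exists>v\<in>Hom J j k.
        Cmp TF X (fob D i) (fob D k) (fmor D i k u) f = Cmp TF X (fob D j) (fob D k) (fmor D j k v) g"
  shows "finitely_presentable r TF X"
  unfolding finitely_presentable_def
proof (intro conjI X allI impI, elim conjE)
  fix J :: "('u, 'u) cat" and D L \<iota>
  assume diag: "small_filtered_diagram r J TF D" and colim: "is_colimit J TF D L \<iota>"
  interpret filtered_diagram r A W J D by (rule filtered_diagramI[OF diag])
  have co: "is_cocone J TF D L \<iota>" using colim by (simp add: is_colimit_def)
  let ?S = "\<lambda>i. Hom TF X (fob D i)"
  let ?T = "\<lambda>i j u f. Cmp TF X (fob D i) (fob D j) (fmor D i j u) f"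
  define val where "val = (\<lambda>(i, f). Cmp TF X (fob D i) L (\<iota> i) f)"
  define s where "s = colim_step J ?S ?T"
  define E where "E = (SIGMA i:Ob J. ?S i)"
  \<comment> \<open>One step does not change the composite with \<iota>, so the composite is
    constant on classes and \<open>the_elem\<close> is applied to a singleton.\<close>
  have step: "p \<in> E \<and> q \<in> E \<and> val p = val q" if pq: "(p, q) \<in> s" for p q
  proof -
    obtain i f j u where *: "p = (i, f)" "q = (j, ?T i j u f)" "i \<in> Ob J" "j \<in> Ob J" "u \<in> Hom J i j" "f \<in> ?S i"
      using pq unfolding s_def colim_step_def by blast
    have "?T i j u f \<in> ?S j"
      using * X by (intro TF_Cmp_in D_mor) auto
    moreover have "Cmp TF X (fob D j) L (\<iota> j) (?T i j u f) = Cmp TF X (fob D i) L (\<iota> i) f"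
      unfolding TF_Cmp mor_eq_iff using * X by (simp add: coconeD(4)[OF co] lin_closed[OF TF_Hom_lin[OF X D_ob]])
    ultimately show ?thesis using * by (auto simp: E_def val_def)
  qed
  have rel: "q \<in> E \<and> val q = val p" if "(p, q) \<in> (s \<union> s\<inverse>)\<^sup>*" "p \<in> E" for p q
    using that(1) by (induction rule: rtrancl_induct) (use that(2) step in auto)
  have sym: "(q, p) \<in> (s \<union> s\<inverse>)\<^sup>*" if "(p, q) \<in> (s \<union> s\<inverse>)\<^sup>*" for p q
    using that sym_rtrancl[of "s \<union> s\<inverse>"] sym_Un_converse[of s] by (meson symD)
  have val: "the_elem (val ` ((s \<union> s\<inverse>)\<^sup>* `` {p})) = val p" if "p \<in> E" for p
  proof -
    have "val ` ((s \<union> s\<inverse>)\<^sup>* `` {p}) \<subseteq> {val p}"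
    proof (rule image_subsetI)
      fix q assume "q \<in> (s \<union> s\<inverse>)\<^sup>* `` {p}"
      then show "val q \<in> {val p}" using rel[OF _ that, of q] by simp
    qed
    moreover have "p \<in> (s \<union> s\<inverse>)\<^sup>* `` {p}" by simp
    ultimately have "val ` ((s \<union> s\<inverse>)\<^sup>* `` {p}) = {val p}" by blast
    then show ?thesis by simp
  qed
  have in_s: "((i, f), (k, ?T i k u f)) \<in> s" if "i \<in> Ob J" "k \<in> Ob J" "u \<in> Hom J i k" "f \<in> ?S i" for i k u f
    using that unfolding s_def colim_step_def by blast
  show "bij_betw (\<lambda>K. the_elem ((\<lambda>(i, f). Cmp TF X (fob D i) L (\<iota> i) f) ` K)) (set_colim J ?S ?T) (Hom TF X L)"
    unfolding val_def[symmetric]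
  proof (rule bij_betwI')
    fix K K' assume "K \<in> set_colim J ?S ?T" "K' \<in> set_colim J ?S ?T"
    then obtain p q where p: "p \<in> E" "K = (s \<union> s\<inverse>)\<^sup>* `` {p}" and q: "q \<in> E" "K' = (s \<union> s\<inverse>)\<^sup>* `` {q}"
      by (auto simp: set_colim_def quotient_def s_def E_def)
    have "K = K'" if eq: "val p = val q"
    proof -
      obtain i f j g where pq: "p = (i, f)" "q = (j, g)" "i \<in> Ob J" "j \<in> Ob J" "f \<in> ?S i" "g \<in> ?S j"
        using p(1) q(1) by (auto simp: E_def)
      obtain k u v where k: "k \<in> Ob J" "u \<in> Hom J i k" "v \<in> Hom J j k" "?T i k u f = ?T j k v g"
        using inj[OF diag colim pq(3-6)] eq pq(1,2) by (auto simp: val_def)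
      have "(p, (k, ?T i k u f)) \<in> s" "(q, (k, ?T i k u f)) \<in> s"
        using in_s[OF pq(3) k(1,2) pq(5)] in_s[OF pq(4) k(1,3) pq(6)] pq(1,2) k(4) by simp_all
      then have *: "(p, q) \<in> (s \<union> s\<inverse>)\<^sup>*"
        by (meson UnI1 UnI2 converseI r_into_rtrancl rtrancl_trans)
      then show ?thesis
        unfolding p(2) q(2) using sym[OF *] by (blast intro: rtrancl_trans)
    qed
    then show "(the_elem (val ` K) = the_elem (val ` K')) = (K = K')"
      using val[OF p(1)] val[OF q(1)] p(2) q(2) by metis
  next
    fix K assume "K \<in> set_colim J ?S ?T"
    then obtain p where p: "p \<in> E" "K = (s \<union> s\<inverse>)\<^sup>* `` {p}"
      by (auto simp: set_colim_def quotient_def s_def E_def)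
    then show "the_elem (val ` K) \<in> Hom TF X L"
      using val[OF p(1)] X coconeD(1,2)[OF co] by (auto simp: E_def val_def intro!: TF_Cmp_in)
  next
    fix g assume g: "g \<in> Hom TF X L"
    obtain i f where i: "i \<in> Ob J" "f \<in> ?S i" "Cmp TF X (fob D i) L (\<iota> i) f = g"
      using surj[OF diag colim g] by blast
    then have "(i, f) \<in> E" by (simp add: E_def)
    moreover from this have "(s \<union> s\<inverse>)\<^sup>* `` {(i, f)} \<in> set_colim J ?S ?T"
      by (auto simp: set_colim_def quotient_def s_def E_def)
    ultimately show "\<exists>K\<in>set_colim J ?S ?T. g = the_elem (val ` K)"
      using val[of "(i, f)"] i(3) by (intro bexI[of _ "(s \<union> s\<inverse>)\<^sup>* `` {(i, f)}"]) (simp_all add: val_def)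
  qed
qed

section \<open>Finite sums and zero morphisms\<close>

lemma hom_finprod:
  assumes G: "comm_group G" and H: "comm_group H" and h: "h \<in> hom G H" and f: "\<forall>s\<in>S. f s \<in> carrier G"
    and "finite S"
  shows "h (finprod G f S) = finprod H (\<lambda>s. h (f s)) S"
  using assms(5) f
proof (induction S rule: finite_induct)
  case empty
  interpret G: comm_group G by fact
  interpret H: comm_group H by fact
  show ?case using hom_one[OF h] G.is_group H.is_group by simp
next
  case (insert s S)
  interpret G: comm_group G by fact
  interpret H: comm_group H by fact
  have "f \<in> S \<rightarrow> carrier G" "(\<lambda>s. h (f s)) \<in> S \<rightarrow> carrier H" "f s \<in> carrier G" "h (f s) \<in> carrier H"
    using insert.prems hom_in_carrier[OF h] by auto
  then show ?case
    using insert G.finprod_closed[of f S] by (simp add: hom_mult[OF h])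
qed

text \<open>Composition with \<open>g\<close> is additive, so the composite with zero is idempotent
  in its morphism group.\<close>

lemma Cmp_Zer: "a \<in> Ob A \<Longrightarrow> b \<in> Ob A \<Longrightarrow> c \<in> Ob A \<Longrightarrow> g \<in> Hom A b c \<Longrightarrow> Cmp A a b c g (Zer A a b) = Zer A a c"
  using Cmp_Plus_right[of a b c "Zer A a b" "Zer A a b" g]
  by (intro idem_one[OF Hom_group[of a c], unfolded hom_group_def, simplified])
    (simp_all add: Zer_in Cmp_in Plus_Zer_left)

lemma Plus_Zer_right: "a \<in> Ob A \<Longrightarrow> b \<in> Ob A \<Longrightarrow> f \<in> Hom A a b \<Longrightarrow> Plus A a b f (Zer A a b) = f"
  using comm_groupE(4)[OF Hom_group[of a b]] Plus_Zer_left[of a b f] Zer_in[of a b]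
  by (simp add: hom_group_def)

end

text \<open>
  Formal linear combinations of generators \<open>s \<in> X\<close> of sort \<open>\<sigma> s\<close>.  \<open>freemod\<close> allows infinite
  combinations; \<open>freesub S\<close> consists of those supported in \<open>S\<close>, so that \<open>freesub S\<close> is
  contained in \<open>freesub S'\<close> for \<open>S \<subseteq> S'\<close>.
\<close>

locale generators = torsionfree_modules r A W
  for r :: "'u rel" and A :: "('o, 'm, 'z) precat_scheme" and W +
  fixes X :: "'s set" and \<sigma> :: "'s \<Rightarrow> 'o"
  assumes sort: "s \<in> X \<Longrightarrow> \<sigma> s \<in> Ob A"
begin

section \<open>Free modules and evaluation\<close>

definition freemod :: "('o, 'm, ('s \<Rightarrow> 'm) monoid, ('s \<Rightarrow> 'm) \<Rightarrow> ('s \<Rightarrow> 'm)) func" where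
  "freemod = \<lparr>fob = (\<lambda>b. \<lparr>carrier = (\<Pi>\<^sub>E s\<in>X. Hom A (\<sigma> s) b),
      mult = (\<lambda>p q. \<lambda>s\<in>X. Plus A (\<sigma> s) b (p s) (q s)), one = (\<lambda>s\<in>X. Zer A (\<sigma> s) b)\<rparr>),
    fmor = (\<lambda>b c f p. \<lambda>s\<in>X. Cmp A (\<sigma> s) b c f (p s))\<rparr>"

definition supp :: "'s set \<Rightarrow> 'o \<Rightarrow> ('s \<Rightarrow> 'm) set" where
  "supp S b = {p \<in> (\<Pi>\<^sub>E s\<in>X. Hom A (\<sigma> s) b). \<forall>s\<in>X - S. p s = Zer A (\<sigma> s) b}"

abbreviation freesub :: "'s set \<Rightarrow> ('o, 'm, ('s \<Rightarrow> 'm) monoid, ('s \<Rightarrow> 'm) \<Rightarrow> ('s \<Rightarrow> 'm)) func" where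
  "freesub S \<equiv> submod freemod (supp S)"

text \<open>The basis element of the generator \<open>s\<close>, that is, the universal element of
  the representable functor on its sort.\<close>

definition delta :: "'s \<Rightarrow> 's \<Rightarrow> 'm" where
  "delta s = (\<lambda>t\<in>X. if t = s then Idt A (\<sigma> s) else Zer A (\<sigma> t) (\<sigma> s))"

text \<open>The combination of the elements \<open>y s\<close> with coefficients \<open>p s\<close>,
  hence the linear map sending each basis element with \<open>s\<close> in \<open>S\<close> to
  \<open>y s\<close>. The sum runs over an explicit finite \<open>S\<close>, since a member of
  \<open>freemod\<close> may have infinitely many nonzero coefficients.\<close>

definition ev :: "('o, 'm, 'x monoid, 'x \<Rightarrow> 'x) func \<Rightarrow> ('s \<Rightarrow> 'x) \<Rightarrow> 's set \<Rightarrow> 'o \<Rightarrow> ('s \<Rightarrow> 'm) \<Rightarrow> 'x" where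
  "ev Y y S b p = finprod (fob Y b) (\<lambda>s. fmor Y (\<sigma> s) b (p s) (y s)) S"

lemma freemod_simps:
  "el freemod b = (\<Pi>\<^sub>E s\<in>X. Hom A (\<sigma> s) b)"
  "p \<otimes>\<^bsub>fob freemod b\<^esub> q = (\<lambda>s\<in>X. Plus A (\<sigma> s) b (p s) (q s))"
  "\<one>\<^bsub>fob freemod b\<^esub> = (\<lambda>s\<in>X. Zer A (\<sigma> s) b)"
  "fmor freemod b c f p = (\<lambda>s\<in>X. Cmp A (\<sigma> s) b c f (p s))"
  by (simp_all add: freemod_def)

lemma restrict_ext: "p \<in> Pi\<^sub>E X B \<Longrightarrow> (\<And>s. s \<in> X \<Longrightarrow> f s = p s) \<Longrightarrow> (\<lambda>s\<in>X. f s) = p"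
  by (auto simp: PiE_def extensional_def restrict_def fun_eq_iff)

lemma restrict_eqI: "(\<And>s. s \<in> Y \<Longrightarrow> f s = g s) \<Longrightarrow> (\<lambda>s\<in>Y. f s) = (\<lambda>s\<in>Y. g s)"
  by (auto simp: restrict_def fun_eq_iff)

lemma coeff_in: "p \<in> (\<Pi>\<^sub>E s\<in>X. Hom A (\<sigma> s) b) \<Longrightarrow> s \<in> X \<Longrightarrow> p s \<in> Hom A (\<sigma> s) b"
  by auto

lemma amod_freemod: "amod freemod"
proof (rule amodI)
  fix b assume b: "b \<in> Ob A"
  have grp: "comm_group (hom_group A (\<sigma> s) b)" if "s \<in> X" for s
    using Hom_group[OF sort[OF that] b] .
  note G = comm_groupE[OF grp, unfolded hom_group_def, simplified]
  show "comm_group (fob freemod b)"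
  proof (rule comm_groupI_inv[where i = "\<lambda>p. \<lambda>s\<in>X. inv\<^bsub>hom_group A (\<sigma> s) b\<^esub> (p s)"])
    fix p assume p: "p \<in> el freemod b"
    then have ps: "p s \<in> carrier (hom_group A (\<sigma> s) b)" if "s \<in> X" for s
      using that by (auto simp: freemod_simps hom_group_def)
    have 1: "inv\<^bsub>hom_group A (\<sigma> s) b\<^esub> p s \<in> carrier (hom_group A (\<sigma> s) b)" if "s \<in> X" for s
      using group.inv_closed[OF comm_group.axioms(2)[OF grp[OF that]] ps[OF that]] .
    have 2: "inv\<^bsub>hom_group A (\<sigma> s) b\<^esub> p s \<otimes>\<^bsub>hom_group A (\<sigma> s) b\<^esub> p s = \<one>\<^bsub>hom_group A (\<sigma> s) b\<^esub>" if "s \<in> X" for s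
      using group.l_inv[OF comm_group.axioms(2)[OF grp[OF that]] ps[OF that]] .
    show "(\<lambda>s\<in>X. inv\<^bsub>hom_group A (\<sigma> s) b\<^esub> p s) \<in> el freemod b"
      using 1 by (auto simp: freemod_simps hom_group_def)
    show "(\<lambda>s\<in>X. inv\<^bsub>hom_group A (\<sigma> s) b\<^esub> p s) \<otimes>\<^bsub>fob freemod b\<^esub> p = \<one>\<^bsub>fob freemod b\<^esub>"
      using 2 by (auto simp: freemod_simps hom_group_def intro!: restrict_eqI)
    show "\<one>\<^bsub>fob freemod b\<^esub> \<otimes>\<^bsub>fob freemod b\<^esub> p = p"
      using p by (auto simp: freemod_simps Plus_Zer_left sort b coeff_in intro!: restrict_ext)
  next
    fix p q assume pq: "p \<in> el freemod b" "q \<in> el freemod b"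
    show "p \<otimes>\<^bsub>fob freemod b\<^esub> q \<in> el freemod b"
      using pq by (auto simp: freemod_simps coeff_in intro!: Plus_in sort b)
    show "p \<otimes>\<^bsub>fob freemod b\<^esub> q = q \<otimes>\<^bsub>fob freemod b\<^esub> p"
      using pq by (auto simp: freemod_simps coeff_in intro!: restrict_eqI G(4))
  next
    fix p q t assume "p \<in> el freemod b" "q \<in> el freemod b" "t \<in> el freemod b"
    then show "p \<otimes>\<^bsub>fob freemod b\<^esub> q \<otimes>\<^bsub>fob freemod b\<^esub> t = p \<otimes>\<^bsub>fob freemod b\<^esub> (q \<otimes>\<^bsub>fob freemod b\<^esub> t)"
      by (auto simp: freemod_simps coeff_in intro!: restrict_eqI G(3))
  next
    show "\<one>\<^bsub>fob freemod b\<^esub> \<in> el freemod b"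
      by (auto simp: freemod_simps intro!: Zer_in sort b)
  qed
next
  fix a p assume "a \<in> Ob A" "p \<in> el freemod a"
  then show "fmor freemod a a (Idt A a) p = p"
    by (auto simp: freemod_simps coeff_in sort Cmp_Idt_left intro!: restrict_ext)
qed (auto simp: freemod_simps coeff_in sort Cmp_in Plus_in Cmp_Plus_left Cmp_Plus_right Cmp_assoc intro!: restrict_eqI)

lemma supp_subset: "supp S b \<subseteq> el freemod b"
  by (auto simp: supp_def freemod_simps)

lemma supp_mono: "S \<subseteq> S' \<Longrightarrow> supp S b \<subseteq> supp S' b"
  by (auto simp: supp_def)

lemma asub_supp: "asub freemod (supp S)"
proof (rule asubI[OF amod_freemod])
  fix a p assume a: "a \<in> Ob A" and p: "p \<in> supp S a"
  have q: "inv\<^bsub>fob freemod a\<^esub> p \<in> el freemod a"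
    using p supp_subset by (intro inv_closed[OF amod_freemod a]) blast
  have "inv\<^bsub>fob freemod a\<^esub> p \<otimes>\<^bsub>fob freemod a\<^esub> p = \<one>\<^bsub>fob freemod a\<^esub>"
    using p supp_subset by (intro group.l_inv comm_group.axioms(2) amod_group[OF amod_freemod a]) blast
  \<comment> \<open>At a coordinate outside \<open>S\<close> this equation says that the coefficient
    of the inverse plus zero is zero.\<close>
  then have eq: "(\<lambda>s\<in>X. Plus A (\<sigma> s) a ((inv\<^bsub>fob freemod a\<^esub> p) s) (p s)) = (\<lambda>s\<in>X. Zer A (\<sigma> s) a)"
    by (simp only: freemod_simps)
  have "Plus A (\<sigma> s) a ((inv\<^bsub>fob freemod a\<^esub> p) s) (p s) = Zer A (\<sigma> s) a" if "s \<in> X" for s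
    using fun_cong[OF eq, of s] that by simp
  then have "(inv\<^bsub>fob freemod a\<^esub> p) s = Zer A (\<sigma> s) a" if "s \<in> X - S" for s
    using that p q Plus_Zer_right[of "\<sigma> s" a "(inv\<^bsub>fob freemod a\<^esub> p) s"] a
    by (force simp: supp_def freemod_simps sort)
  then show "inv\<^bsub>fob freemod a\<^esub> p \<in> supp S a" using q by (auto simp: supp_def freemod_simps)
next
  fix a p q assume "a \<in> Ob A" "p \<in> supp S a" "q \<in> supp S a"
  then show "p \<otimes>\<^bsub>fob freemod a\<^esub> q \<in> supp S a"
    by (auto simp: supp_def freemod_simps sort Zer_in Plus_Zer_left coeff_in intro!: Plus_in)
next
  fix a b f p assume "a \<in> Ob A" "b \<in> Ob A" "f \<in> Hom A a b" "p \<in> supp S a"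
  then show "fmor freemod a b f p \<in> supp S b"
    by (auto simp: supp_def freemod_simps sort Cmp_Zer coeff_in intro!: Cmp_in)
next
  fix a assume "a \<in> Ob A"
  then show "\<one>\<^bsub>fob freemod a\<^esub> \<in> supp S a"
    by (auto simp: supp_def freemod_simps sort intro!: Zer_in)
qed (use supp_subset in blast)

lemma amod_freesub: "amod (freesub S)"
  by (rule amod_submod[OF amod_freemod asub_supp])

lemma delta_in: "s \<in> X \<Longrightarrow> s \<in> S \<Longrightarrow> delta s \<in> supp S (\<sigma> s)"
  by (auto simp: supp_def delta_def sort Idt_in Zer_in)

text \<open>Coefficients outside \<open>S\<close> are zero, so an element is determined by finitely
  many morphisms.\<close>

lemma small_supp:
  assumes "finite S" "S \<subseteq> X" "b \<in> Ob A"
  shows "small (supp S b)"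
proof (rule small_inj_on)
  show "inj_on (\<lambda>p. restrict p S) (supp S b)"
  proof (rule inj_onI)
    fix p q assume p: "p \<in> supp S b" and q: "q \<in> supp S b" and eq: "restrict p S = restrict q S"
    show "p = q"
    proof (rule PiE_ext)
      show "p \<in> (\<Pi>\<^sub>E s\<in>X. Hom A (\<sigma> s) b)" "q \<in> (\<Pi>\<^sub>E s\<in>X. Hom A (\<sigma> s) b)"
        using p q by (simp_all add: supp_def)
      fix s assume "s \<in> X"
      then show "p s = q s"
        using p q fun_cong[OF eq, of s] by (cases "s \<in> S") (auto simp: supp_def)
    qed
  qed
  show "(\<lambda>p. restrict p S) ` supp S b \<subseteq> (\<Pi>\<^sub>E s\<in>S. Hom A (\<sigma> s) b)"
    using assms(2) by (auto simp: supp_def)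
  show "small (\<Pi>\<^sub>E s\<in>S. Hom A (\<sigma> s) b)"
    using assms by (intro small_PiE small_Hom sort) auto
qed

lemma ev_term_closed:
  assumes "amod Y" "S \<subseteq> X" "\<forall>s\<in>S. y s \<in> el Y (\<sigma> s)" "b \<in> Ob A" "p \<in> el freemod b" "s \<in> S"
  shows "fmor Y (\<sigma> s) b (p s) (y s) \<in> el Y b"
  using assms by (intro act_closed) (auto simp: sort freemod_simps)

lemma alin_ev:
  assumes Y: "amod Y" and S: "S \<subseteq> X" "finite S" and y: "\<forall>s\<in>S. y s \<in> el Y (\<sigma> s)"
  shows "alin freemod Y (ev Y y S)"
proof (rule alinI)
  note cl = ev_term_closed[OF Y S(1) y]
  have ps: "p s \<in> Hom A (\<sigma> s) b" if "p \<in> el freemod b" "s \<in> S" for p s b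
    using that S by (auto simp: freemod_simps)
  have \<sigma>: "\<sigma> s \<in> Ob A" if "s \<in> S" for s using that S sort by auto
  { fix b p assume b: "b \<in> Ob A" and p: "p \<in> el freemod b"
    interpret G: comm_group "fob Y b" by (rule amod_group[OF Y b])
    show "ev Y y S b p \<in> el Y b"
      unfolding ev_def by (rule G.finprod_closed) (use cl b p in auto)
    fix q assume q: "q \<in> el freemod b"
    have "ev Y y S b (p \<otimes>\<^bsub>fob freemod b\<^esub> q)
        = finprod (fob Y b) (\<lambda>s. fmor Y (\<sigma> s) b (p s) (y s) \<otimes>\<^bsub>fob Y b\<^esub> fmor Y (\<sigma> s) b (q s) (y s)) S"
      unfolding ev_def
      by (rule G.finprod_cong')
        (use S b p q ps y \<sigma> cl in \<open>auto simp: freemod_simps act_Plus[OF Y] subset_iff\<close>)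
    also have "\<dots> = ev Y y S b p \<otimes>\<^bsub>fob Y b\<^esub> ev Y y S b q"
      unfolding ev_def by (rule G.finprod_multf) (use cl b p q in auto)
    finally show "ev Y y S b (p \<otimes>\<^bsub>fob freemod b\<^esub> q) = ev Y y S b p \<otimes>\<^bsub>fob Y b\<^esub> ev Y y S b q" . }
  fix b c f p assume *: "b \<in> Ob A" "c \<in> Ob A" "f \<in> Hom A b c" "p \<in> el freemod b"
  interpret H: comm_group "fob Y c" by (rule amod_group[OF Y *(2)])
  have "fmor Y b c f (ev Y y S b p) = finprod (fob Y c) (\<lambda>s. fmor Y b c f (fmor Y (\<sigma> s) b (p s) (y s))) S"
    unfolding ev_def
    by (rule hom_finprod[OF amod_group[OF Y *(1)] amod_group[OF Y *(2)] amod_hom[OF Y *(1-3)] _ S(2)]) (use cl * in blast)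
  also have "\<dots> = ev Y y S c (fmor freemod b c f p)"
    unfolding ev_def
    by (rule H.finprod_cong') (use S * ps y \<sigma> cl in \<open>auto simp: freemod_simps act_Cmp[OF Y] subset_iff intro!: act_closed[OF Y] Cmp_in\<close>)
  finally show "ev Y y S c (fmor freemod b c f p) = fmor Y b c f (ev Y y S b p)" by simp
qed

lemma alin_ev_freesub:
  assumes "amod Y" "S \<subseteq> X" "finite S" "\<forall>s\<in>S. y s \<in> el Y (\<sigma> s)"
  shows "alin (freesub S) Y (ev Y y S)"
  using lin_compose[OF alin_submod[OF asub_supp] alin_ev[OF assms]] .

lemma ev_delta:
  assumes Y: "amod Y" and S: "S \<subseteq> X" "finite S" and y: "\<forall>s\<in>S. y s \<in> el Y (\<sigma> s)" and s: "s \<in> S"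
  shows "ev Y y S (\<sigma> s) (delta s) = y s"
proof -
  have \<sigma>: "\<sigma> t \<in> Ob A" if "t \<in> S" for t using that S sort by auto
  interpret G: comm_group "fob Y (\<sigma> s)" by (rule amod_group[OF Y \<sigma>[OF s]])
  have "ev Y y S (\<sigma> s) (delta s) = finprod (fob Y (\<sigma> s)) (\<lambda>t. if s = t then y s else \<one>\<^bsub>fob Y (\<sigma> s)\<^esub>) S"
    unfolding ev_def
    by (rule G.finprod_cong') (use S y s \<sigma> in \<open>auto simp: delta_def act_Idt[OF Y] act_Zer[OF Y] subset_iff\<close>)
  also have "\<dots> = y s"
    using G.finprod_singleton[OF s S(2), of "\<lambda>_. y s"] y s by simp
  finally show ?thesis .
qed

text \<open>The added generators have zero coefficients, and zero acts as zero. A relation can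
  therefore be read inside any larger finite set of generators.\<close>

lemma ev_mono:
  assumes Y: "amod Y" and S: "S \<subseteq> S'" "S' \<subseteq> X" "finite S'" and y: "\<forall>s\<in>S'. y s \<in> el Y (\<sigma> s)"
    and b: "b \<in> Ob A" and p: "p \<in> supp S b"
  shows "ev Y y S' b p = ev Y y S b p"
proof -
  interpret G: comm_group "fob Y b" by (rule amod_group[OF Y b])
  have \<sigma>: "\<sigma> t \<in> Ob A" if "t \<in> S'" for t using that S sort by auto
  have "fmor Y (\<sigma> s) b (p s) (y s) \<in> el Y b" if "s \<in> S'" for s
    using ev_term_closed[OF Y S(2) y b _ that] supp_subset p by blast
  moreover have "fmor Y (\<sigma> s) b (p s) (y s) = \<one>\<^bsub>fob Y b\<^esub>" if "s \<in> S' - S" for s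
  proof -
    have "p s = Zer A (\<sigma> s) b" using that S p by (auto simp: supp_def)
    then show ?thesis using act_Zer[OF Y \<sigma> b, of s "y s"] y that by auto
  qed
  ultimately show ?thesis
    unfolding ev_def using S by (intro G.finprod_mono_neutral_cong_left[symmetric]) auto
qed

lemma lin_ev:
  assumes Y: "amod Y" and Z: "amod Z" and \<eta>: "alin Y Z \<eta>" and S: "S \<subseteq> X" "finite S"
    and y: "\<forall>s\<in>S. y s \<in> el Y (\<sigma> s)" and b: "b \<in> Ob A" and p: "p \<in> el freemod b"
  shows "\<eta> b (ev Y y S b p) = ev Z (\<lambda>s. \<eta> (\<sigma> s) (y s)) S b p"
proof -
  interpret H: comm_group "fob Z b" by (rule amod_group[OF Z b])
  note cl = ev_term_closed[OF Y S(1) y b p]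
  have ps: "p s \<in> Hom A (\<sigma> s) b" if "s \<in> S" for s
    using that S p by (auto simp: freemod_simps)
  have \<sigma>: "\<sigma> t \<in> Ob A" if "t \<in> S" for t using that S sort by auto
  have "\<eta> b (ev Y y S b p) = finprod (fob Z b) (\<lambda>s. \<eta> b (fmor Y (\<sigma> s) b (p s) (y s))) S"
    unfolding ev_def
    by (rule hom_finprod[OF amod_group[OF Y b] amod_group[OF Z b] _ _ S(2)])
      (use \<eta> b cl in \<open>auto simp: alin_def\<close>)
  also have "\<dots> = ev Z (\<lambda>s. \<eta> (\<sigma> s) (y s)) S b p"
    unfolding ev_def
    by (rule H.finprod_cong') (use S y \<sigma> ps b in \<open>auto simp: lin_act[OF \<eta>] intro!: act_closed[OF Z] lin_closed[OF \<eta>]\<close>)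
  finally show ?thesis .
qed

text \<open>Uniqueness in the universal property of free modules, by induction on a finite set
  \<open>U\<close> containing the support: an element is a multiple of one basis element plus an
  element supported on the rest.\<close>

lemma free_determined:
  assumes Y: "amod Y" and S: "S \<subseteq> X" "finite S" and \<eta>: "alin (freesub S) Y \<eta>"
    and b: "b \<in> Ob A" and p: "p \<in> supp S b"
  shows "\<eta> b p = ev Y (\<lambda>s. \<eta> (\<sigma> s) (delta s)) S b p"
proof -
  have delta: "delta s \<in> supp S (\<sigma> s)" if "s \<in> S" for s using that S delta_in by auto
  have \<eta>delta: "\<forall>s\<in>S. \<eta> (\<sigma> s) (delta s) \<in> el Y (\<sigma> s)"
    using lin_closed[OF \<eta>] delta S sort by auto
  interpret G: comm_group "fob Y b" by (rule amod_group[OF Y b])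
  have "\<eta> b p = ev Y (\<lambda>s. \<eta> (\<sigma> s) (delta s)) U b p" if "finite U" "U \<subseteq> S" "p \<in> supp U b" for U p
    using that
  proof (induction U arbitrary: p rule: finite_induct)
    case empty
    then have "p = \<one>\<^bsub>fob freemod b\<^esub>"
      by (auto simp: supp_def freemod_simps intro!: restrict_ext[symmetric])
    then show ?case
      using lin_one[OF amod_freesub Y \<eta> b] by (simp add: ev_def)
  next
    case (insert s U)
    have s: "s \<in> S" "s \<in> X" "\<sigma> s \<in> Ob A" using insert S sort by auto
    \<comment> \<open>\<open>p\<close> with its coefficient at \<open>s\<close> erased, so that the
      induction hypothesis for \<open>U\<close> applies to it.\<close>
    define q where "q = (\<lambda>t\<in>X. if t = s then Zer A (\<sigma> s) b else p t)"
    have p: "p \<in> el freemod b" using insert.prems(2) supp_subset by blast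
    have q: "q \<in> supp U b"
      using insert.prems s b p by (auto simp: supp_def q_def freemod_simps Zer_in coeff_in)
    have ps: "p s \<in> Hom A (\<sigma> s) b" using p s by (auto simp: freemod_simps)
    have pS: "p \<in> supp S b" and qS: "q \<in> supp S b"
      using insert.prems q supp_mono[of "insert s U" S] supp_mono[of U S] by auto
    have p_eq: "fmor freemod (\<sigma> s) b (p s) (delta s) \<otimes>\<^bsub>fob freemod b\<^esub> q = p"
      using p s b ps unfolding freemod_simps
      by (intro restrict_ext)
        (auto simp: delta_def q_def sort Cmp_Idt_right Plus_Zer_right Plus_Zer_left Cmp_Zer coeff_in)
    have act: "fmor freemod (\<sigma> s) b (p s) (delta s) \<in> supp S b"
      by (rule asubD(5)[OF asub_supp s(3) b ps delta[OF s(1)]])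
    have "\<eta> b p = \<eta> b (fmor freemod (\<sigma> s) b (p s) (delta s)) \<otimes>\<^bsub>fob Y b\<^esub> \<eta> b q"
      using lin_mult[OF \<eta> b, of "fmor freemod (\<sigma> s) b (p s) (delta s)" q] act qS p_eq by simp
    also have "\<eta> b (fmor freemod (\<sigma> s) b (p s) (delta s)) = fmor Y (\<sigma> s) b (p s) (\<eta> (\<sigma> s) (delta s))"
      using lin_act[OF \<eta> s(3) b ps, of "delta s"] delta[OF s(1)] by simp
    also have "\<eta> b q = ev Y (\<lambda>s. \<eta> (\<sigma> s) (delta s)) U b q"
      using insert q by auto
    also have "\<dots> = ev Y (\<lambda>s. \<eta> (\<sigma> s) (delta s)) U b p"
      unfolding ev_def
    proof (rule G.finprod_cong')
      fix t assume t: "t \<in> U"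
      then show "fmor Y (\<sigma> t) b (q t) (\<eta> (\<sigma> t) (delta t)) = fmor Y (\<sigma> t) b (p t) (\<eta> (\<sigma> t) (delta t))"
        using insert S by (auto simp: q_def)
    qed (use ev_term_closed[OF Y S(1) \<eta>delta b p] insert in auto)
    also have "fmor Y (\<sigma> s) b (p s) (\<eta> (\<sigma> s) (delta s)) \<otimes>\<^bsub>fob Y b\<^esub> \<dots>
        = ev Y (\<lambda>s. \<eta> (\<sigma> s) (delta s)) (insert s U) b p"
      unfolding ev_def
      by (rule G.finprod_insert[symmetric])
        (use ev_term_closed[OF Y S(1) \<eta>delta b p] insert s in auto)
    finally show ?case .
  qed
  then show ?thesis using S(2) p by blast
qed

text \<open>Generators \<open>S\<close> and relations \<open>T\<close> within the torsion-free
  modules, so the relations are closed up under division by \<open>W\<close> too. It is a predicate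
  on \<open>Q\<close> and \<pi> because a presented object is determined only up to
  isomorphism.\<close>

definition presents where
  "presents S T Q \<pi> \<longleftrightarrow> Q \<in> Ob TF \<and> alin (freesub S) Q \<pi> \<and> (\<forall>b\<in>Ob A. el Q b = \<pi> b ` supp S b) \<and>
     (\<forall>b\<in>Ob A. \<forall>p\<in>supp S b. \<pi> b p = \<one>\<^bsub>fob Q b\<^esub> \<longleftrightarrow> clos (freesub S) (\<lambda>b. {p. (b, p) \<in> T}) b p)"

lemma presents_exists:
  assumes "finite S" "S \<subseteq> X"
  shows "\<exists>Q \<pi>. presents S T Q \<pi>"
proof (rule quotient_object[OF amod_freesub _ asub_clos[OF amod_freesub, of S "\<lambda>b. {p. (b, p) \<in> T}"] saturated_clos])
  show "small (el (freesub S) b)" if "b \<in> Ob A" for b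
    using small_supp[OF assms that] by simp
  fix Q \<pi> assume "Q \<in> Ob TF" "alin (freesub S) Q \<pi>"
    and "\<And>b. b \<in> Ob A \<Longrightarrow> el Q b = \<pi> b ` el (freesub S) b"
    and "\<And>b p. b \<in> Ob A \<Longrightarrow> p \<in> el (freesub S) b \<Longrightarrow> \<pi> b p = \<one>\<^bsub>fob Q b\<^esub>
      \<longleftrightarrow> p \<in> {p. clos (freesub S) (\<lambda>b. {p. (b, p) \<in> T}) b p}"
  then have "presents S T Q \<pi>" by (simp add: presents_def)
  then show ?thesis by blast
qed

text \<open>Checking the relations in \<open>T\<close> is enough: the target is torsion-free, so
  their saturated closure is killed as well.\<close>

lemma presents_factor:
  assumes Q: "presents S T Q \<pi>" and Y: "Y \<in> Ob TF" and \<psi>: "alin (freesub S) Y \<psi>"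
    and T: "\<And>b p. (b, p) \<in> T \<Longrightarrow> b \<in> Ob A \<Longrightarrow> p \<in> supp S b \<Longrightarrow> \<psi> b p = \<one>\<^bsub>fob Y b\<^esub>"
  obtains h where "h \<in> Hom TF Q Y" "\<And>b p. b \<in> Ob A \<Longrightarrow> p \<in> supp S b \<Longrightarrow> h b (\<pi> b p) = \<psi> b p"
proof (rule factor_through_quotient[OF amod_freesub _ _ _ Y \<psi>])
  fix b p assume "b \<in> Ob A" "p \<in> el (freesub S) b" "\<pi> b p = \<one>\<^bsub>fob Q b\<^esub>"
  then have "clos (freesub S) (\<lambda>b. {p. (b, p) \<in> T}) b p" using Q by (simp add: presents_def)
  then show "\<psi> b p = \<one>\<^bsub>fob Y b\<^esub>"
    by (rule clos_minimal[OF _ amod_freesub TF_amod[OF Y] TF_tfree[OF Y] \<psi>]) (use T in auto)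
qed (use Q that in \<open>auto simp: presents_def\<close>)

text \<open>Every element of \<open>Q\<close> is a combination of the images of the basis
  elements.\<close>

lemma presents_ext:
  assumes Q: "presents S T Q \<pi>" and S: "finite S" "S \<subseteq> X" and Y: "Y \<in> Ob TF"
    and g: "g \<in> Hom TF Q Y" "g' \<in> Hom TF Q Y"
    and eq: "\<And>s. s \<in> S \<Longrightarrow> g (\<sigma> s) (\<pi> (\<sigma> s) (delta s)) = g' (\<sigma> s) (\<pi> (\<sigma> s) (delta s))"
  shows "g = g'"
proof -
  have Q': "Q \<in> Ob TF" and \<pi>: "alin (freesub S) Q \<pi>" and surj: "\<And>b. b \<in> Ob A \<Longrightarrow> el Q b = \<pi> b ` supp S b"
    using Q by (auto simp: presents_def)
  note lin = lin_compose[OF \<pi> TF_Hom_lin[OF Q' Y]]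
  show ?thesis
  proof (rule TF_Hom_ext[OF Q' Y Y g])
    fix b x assume b: "b \<in> Ob A" and "x \<in> el Q b"
    then obtain p where p: "p \<in> supp S b" "x = \<pi> b p" using surj by auto
    interpret G: comm_group "fob Y b" by (rule amod_group[OF TF_amod[OF Y] b])
    have \<delta>: "\<forall>s\<in>S. g' (\<sigma> s) (\<pi> (\<sigma> s) (delta s)) \<in> el Y (\<sigma> s)"
      using lin_closed[OF lin[OF g(2)]] S sort delta_in by auto
    have "ev Y (\<lambda>s. g (\<sigma> s) (\<pi> (\<sigma> s) (delta s))) S b p = ev Y (\<lambda>s. g' (\<sigma> s) (\<pi> (\<sigma> s) (delta s))) S b p"
      unfolding ev_def
      by (rule G.finprod_cong')
        (use ev_term_closed[OF TF_amod[OF Y] S(2) \<delta> b subsetD[OF supp_subset p(1)]] in \<open>auto simp: eq\<close>)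
    then show "g b x = g' b x"
      unfolding p(2)
      using free_determined[OF TF_amod[OF Y] S(2,1) lin[OF g(1)] b p(1)]
        free_determined[OF TF_amod[OF Y] S(2,1) lin[OF g(2)] b p(1)] by simp
  qed
qed

end

section \<open>Lifting finitely many elements and relations to a stage\<close>

context filtered_diagram
begin

text \<open>Each new element and the lifts already chosen are moved to a common later stage.\<close>

lemma elcolim_lift_finite:
  assumes L: "elcolim L \<iota>" and "finite S" and "\<And>s. s \<in> S \<Longrightarrow> \<sigma> s \<in> Ob A \<and> z s \<in> el L (\<sigma> s)"
  shows "\<exists>k\<in>Ob J. \<exists>y. \<forall>s\<in>S. y s \<in> el (fob D k) (\<sigma> s) \<and> \<iota> k (\<sigma> s) (y s) = z s"
  using assms(2,3)
proof (induction S rule: finite_induct)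
  case empty
  then show ?case using J_nonempty by auto
next
  case (insert s S)
  have co: "is_cocone J TF D L \<iota>" using L by (simp add: elcolim_def)
  obtain k y where k: "k \<in> Ob J" "\<And>s. s \<in> S \<Longrightarrow> y s \<in> el (fob D k) (\<sigma> s) \<and> \<iota> k (\<sigma> s) (y s) = z s"
    using insert by auto
  obtain i x where i: "i \<in> Ob J" "x \<in> el (fob D i) (\<sigma> s)" "z s = \<iota> i (\<sigma> s) x"
    using L insert.prems[of s] unfolding elcolim_def by blast
  obtain l u v where l: "l \<in> Ob J" "u \<in> Hom J k l" "v \<in> Hom J i l" using J_bound[OF k(1) i(1)] by blast
  define y' where "y' t = (if t = s then fmor D i l v (\<sigma> s) x else fmor D k l u (\<sigma> t) (y t))" for t
  have "\<forall>t\<in>insert s S. y' t \<in> el (fob D l) (\<sigma> t) \<and> \<iota> l (\<sigma> t) (y' t) = z t"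
    using insert.prems insert.hyps k i l by (auto simp: y'_def D_closed coconeD(4)[OF co])
  then show ?case using l(1) by blast
qed

text \<open>Transition maps preserve units, so what has vanished stays so while a later stage kills
  the next element.\<close>

lemma elcolim_kill_finite:
  assumes L: "elcolim L \<iota>" and "finite T" and k: "k \<in> Ob J"
    and "\<And>t. t \<in> T \<Longrightarrow> b t \<in> Ob A \<and> x t \<in> el (fob D k) (b t) \<and> \<iota> k (b t) (x t) = \<one>\<^bsub>fob L (b t)\<^esub>"
  shows "\<exists>l\<in>Ob J. \<exists>u\<in>Hom J k l. \<forall>t\<in>T. fmor D k l u (b t) (x t) = \<one>\<^bsub>fob (fob D l) (b t)\<^esub>"
  using assms(2,4)
proof (induction T rule: finite_induct)
  case empty
  then show ?case using J_Idt[OF k] k by auto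
next
  case (insert t T)
  have co: "is_cocone J TF D L \<iota>" using L by (simp add: elcolim_def)
  obtain l u where l: "l \<in> Ob J" "u \<in> Hom J k l" "\<And>t. t \<in> T \<Longrightarrow> fmor D k l u (b t) (x t) = \<one>\<^bsub>fob (fob D l) (b t)\<^esub>"
    using insert by auto
  have t: "b t \<in> Ob A" "x t \<in> el (fob D k) (b t)" "\<iota> k (b t) (x t) = \<one>\<^bsub>fob L (b t)\<^esub>"
    using insert.prems[of t] by auto
  have "\<iota> l (b t) (fmor D k l u (b t) (x t)) = \<one>\<^bsub>fob L (b t)\<^esub>"
    using t l k by (simp add: coconeD(4)[OF co])
  then obtain m v where m: "m \<in> Ob J" "v \<in> Hom J l m"
    "fmor D l m v (b t) (fmor D k l u (b t) (x t)) = \<one>\<^bsub>fob (fob D m) (b t)\<^esub>"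
    using L t(1) l(1) D_closed[OF k l(1,2) t(1,2)] unfolding elcolim_def by blast
  have "fmor D k m (Cmp J k l m v u) (b t') (x t') = \<one>\<^bsub>fob (fob D m) (b t')\<^esub>" if "t' \<in> insert t T" for t'
    using that insert.prems[OF that] k l m by (auto simp: D_Cmp lin_one[OF _ _ D_lin])
  then show ?case using m(1) J_Cmp[OF k l(1) m(1) l(2) m(2)] by blast
qed

end

section \<open>Finite presentations give finitely presentable objects\<close>

context generators
begin

text \<open>The images of the generators lift to a stage \<open>k\<close>; the finitely many
  relations, true in the limit, hold at a later stage \<open>l\<close>, which is torsion-free, so
  the map descends to \<open>Q\<close>. As for agreement, two maps are compared on finitely many
  generators, and the differences vanish at a later stage.\<close>

lemma presents_finitely_presentable:
  assumes Q: "presents S T Q \<pi>" and S: "finite S" "S \<subseteq> X" and T: "finite T" "T \<subseteq> (SIGMA b:Ob A. supp S b)"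
  shows "finitely_presentable r TF Q"
proof -
  have Q': "Q \<in> Ob TF" and \<pi>: "alin (freesub S) Q \<pi>"
    and ker: "\<And>b p. b \<in> Ob A \<Longrightarrow> p \<in> supp S b \<Longrightarrow> \<pi> b p = \<one>\<^bsub>fob Q b\<^esub> \<longleftrightarrow> clos (freesub S) (\<lambda>b. {p. (b, p) \<in> T}) b p"
    using Q by (auto simp: presents_def)
  have \<sigma>: "\<sigma> s \<in> Ob A" if "s \<in> S" for s using that S sort by auto
  define e where "e s = \<pi> (\<sigma> s) (delta s)" for s
  have e: "e s \<in> el Q (\<sigma> s)" if "s \<in> S" for s
    using lin_closed[OF \<pi>, of "\<sigma> s" "delta s"] that \<sigma> S delta_in unfolding e_def by auto
  have Tin: "b \<in> Ob A \<and> p \<in> supp S b \<and> p \<in> el freemod b" if "(b, p) \<in> T" for b p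
    using that T(2) supp_subset by blast
  have T_kill: "\<pi> b p = \<one>\<^bsub>fob Q b\<^esub>" if "(b, p) \<in> T" for b p
    using Tin[OF that] that by (simp add: ker clos.gen)
  show ?thesis
  proof (rule finitely_presentableI[OF Q'])
    fix J :: "('u, 'u) cat" and D L \<iota> g
    assume diag: "small_filtered_diagram r J TF D" and colim: "is_colimit J TF D L \<iota>" and g: "g \<in> Hom TF Q L"
    interpret filtered_diagram r A W J D by (rule filtered_diagramI[OF diag])
    have L: "elcolim L \<iota>" using colim is_colimit_iff by simp
    have co: "is_cocone J TF D L \<iota>" using colim by (simp add: is_colimit_def)
    note Lo = coconeD(1)[OF co]
    note glin = TF_Hom_lin[OF Q' Lo g]
    have ge: "\<forall>s\<in>S. g (\<sigma> s) (e s) \<in> el L (\<sigma> s)" using lin_closed[OF glin] \<sigma> e by blast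
    obtain k y where k: "k \<in> Ob J" and y: "\<And>s. s \<in> S \<Longrightarrow> y s \<in> el (fob D k) (\<sigma> s) \<and> \<iota> k (\<sigma> s) (y s) = g (\<sigma> s) (e s)"
      using elcolim_lift_finite[OF L S(1), of \<sigma> "\<lambda>s. g (\<sigma> s) (e s)"] \<sigma> ge by blast
    have yB: "\<forall>s\<in>S. y s \<in> el (fob D k) (\<sigma> s)" using y by blast
    have "\<exists>l\<in>Ob J. \<exists>u\<in>Hom J k l. \<forall>t\<in>T. fmor D k l u (fst t) (ev (fob D k) y S (fst t) (snd t)) = \<one>\<^bsub>fob (fob D l) (fst t)\<^esub>"
    proof (rule elcolim_kill_finite[OF L T(1) k])
      fix t assume "t \<in> T"
      moreover obtain b p where t: "t = (b, p)" by fastforce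
      ultimately have bp: "(b, p) \<in> T" "b \<in> Ob A" "p \<in> supp S b" "p \<in> el freemod b" using Tin by auto
      interpret G: comm_group "fob L b" by (rule amod_group[OF TF_amod[OF Lo] bp(2)])
      \<comment> \<open>In the limit, a relation evaluated at the lifts becomes \<open>g\<close>
        applied to its class in \<open>Q\<close>, which is zero.\<close>
      have "\<iota> k b (ev (fob D k) y S b p) = ev L (\<lambda>s. \<iota> k (\<sigma> s) (y s)) S b p"
        by (rule lin_ev[OF TF_amod[OF D_ob[OF k]] TF_amod[OF Lo] coconeD(3)[OF co k] S(2,1) yB bp(2,4)])
      also have "\<dots> = ev L (\<lambda>s. g (\<sigma> s) (e s)) S b p"
        unfolding ev_def
        by (rule G.finprod_cong') (use y ev_term_closed[OF TF_amod[OF Lo] S(2) ge bp(2,4)] in auto)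
      also have "\<dots> = g b (\<pi> b p)"
        using free_determined[OF TF_amod[OF Lo] S(2,1) lin_compose[OF \<pi> glin] bp(2,3)] by (simp add: e_def)
      also have "\<dots> = \<one>\<^bsub>fob L b\<^esub>"
        using T_kill[OF bp(1)] lin_one[OF TF_amod[OF Q'] TF_amod[OF Lo] glin bp(2)] by simp
      finally show "fst t \<in> Ob A \<and> ev (fob D k) y S (fst t) (snd t) \<in> el (fob D k) (fst t) \<and>
          \<iota> k (fst t) (ev (fob D k) y S (fst t) (snd t)) = \<one>\<^bsub>fob L (fst t)\<^esub>"
        using t bp lin_closed[OF alin_ev[OF TF_amod[OF D_ob[OF k]] S(2,1) yB]] by simp
    qed
    then obtain l u where l: "l \<in> Ob J" "u \<in> Hom J k l" and
      u: "\<And>b p. (b, p) \<in> T \<Longrightarrow> fmor D k l u b (ev (fob D k) y S b p) = \<one>\<^bsub>fob (fob D l) b\<^esub>" by force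
    define y' where "y' s = fmor D k l u (\<sigma> s) (y s)" for s
    have y': "\<forall>s\<in>S. y' s \<in> el (fob D l) (\<sigma> s)"
      using y \<sigma> k l by (simp add: y'_def D_closed)
    have ev_y': "ev (fob D l) y' S b p = \<one>\<^bsub>fob (fob D l) b\<^esub>" if "(b, p) \<in> T" for b p
      using lin_ev[OF TF_amod[OF D_ob[OF k]] TF_amod[OF D_ob[OF l(1)]] D_lin[OF k l] S(2,1) yB, of b p]
        u[OF that] Tin[OF that] by (simp add: y'_def[abs_def])
    obtain f where f: "f \<in> Hom TF Q (fob D l)" "\<And>b p. b \<in> Ob A \<Longrightarrow> p \<in> supp S b \<Longrightarrow> f b (\<pi> b p) = ev (fob D l) y' S b p"
      by (rule presents_factor[OF Q D_ob[OF l(1)] alin_ev_freesub[OF TF_amod[OF D_ob[OF l(1)]] S(2,1) y']])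
        (use ev_y' in auto)
    have "Cmp TF Q (fob D l) L (\<iota> l) f = g"
    proof (rule presents_ext[OF Q S Lo TF_Cmp_in[OF Q' D_ob[OF l(1)] Lo f(1) coconeD(2)[OF co l(1)]] g])
      fix s assume s: "s \<in> S"
      have "f (\<sigma> s) (e s) = y' s"
        unfolding e_def using f(2)[of "\<sigma> s" "delta s"] ev_delta[OF TF_amod[OF D_ob[OF l(1)]] S(2,1) y' s] s S \<sigma> delta_in
        by auto
      then show "Cmp TF Q (fob D l) L (\<iota> l) f (\<sigma> s) (\<pi> (\<sigma> s) (delta s)) = g (\<sigma> s) (\<pi> (\<sigma> s) (delta s))"
        using s \<sigma> e k l y[OF s] unfolding e_def[symmetric]
        by (simp add: TF_Cmp_apply y'_def coconeD(4)[OF co])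
    qed
    then show "\<exists>i\<in>Ob J. \<exists>f\<in>Hom TF Q (fob D i). Cmp TF Q (fob D i) L (\<iota> i) f = g"
      using l f by blast
  next
    fix J :: "('u, 'u) cat" and D L \<iota> i j f g
    assume diag: "small_filtered_diagram r J TF D" and colim: "is_colimit J TF D L \<iota>"
      and i: "i \<in> Ob J" and j: "j \<in> Ob J" and f: "f \<in> Hom TF Q (fob D i)" and g: "g \<in> Hom TF Q (fob D j)"
      and eq: "Cmp TF Q (fob D i) L (\<iota> i) f = Cmp TF Q (fob D j) L (\<iota> j) g"
    interpret filtered_diagram r A W J D by (rule filtered_diagramI[OF diag])
    have L: "elcolim L \<iota>" using colim is_colimit_iff by simp
    have co: "is_cocone J TF D L \<iota>" using colim by (simp add: is_colimit_def)
    note Lo = coconeD(1)[OF co]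
    note flin = TF_Hom_lin[OF Q' D_ob[OF i] f] and glin = TF_Hom_lin[OF Q' D_ob[OF j] g]
    obtain k u v where k: "k \<in> Ob J" "u \<in> Hom J i k" "v \<in> Hom J j k" using J_bound[OF i j] by blast
    note am = TF_amod[OF D_ob[OF k(1)]]
    define x where "x s = fmor D i k u (\<sigma> s) (f (\<sigma> s) (e s))" for s
    define x' where "x' s = fmor D j k v (\<sigma> s) (g (\<sigma> s) (e s))" for s
    have x: "x s \<in> el (fob D k) (\<sigma> s)" and x': "x' s \<in> el (fob D k) (\<sigma> s)" if "s \<in> S" for s
      using that \<sigma> e i j k by (simp_all add: x_def x'_def D_closed lin_closed[OF flin] lin_closed[OF glin])
    have xx': "\<iota> k (\<sigma> s) (x s) = \<iota> k (\<sigma> s) (x' s)" if "s \<in> S" for s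
    proof -
      have "\<iota> i (\<sigma> s) (f (\<sigma> s) (e s)) = \<iota> j (\<sigma> s) (g (\<sigma> s) (e s))"
        using fun_cong[OF fun_cong[OF eq], of "\<sigma> s" "e s"] that \<sigma> e by (simp add: TF_Cmp_apply)
      then show ?thesis
        using that \<sigma> e i j k by (simp add: x_def x'_def coconeD(4)[OF co] lin_closed[OF flin] lin_closed[OF glin])
    qed
    have "\<exists>l\<in>Ob J. \<exists>w\<in>Hom J k l. \<forall>s\<in>S. fmor D k l w (\<sigma> s) (x s \<otimes>\<^bsub>fob (fob D k) (\<sigma> s)\<^esub> inv\<^bsub>fob (fob D k) (\<sigma> s)\<^esub> x' s)
        = \<one>\<^bsub>fob (fob D l) (\<sigma> s)\<^esub>"
    proof (rule elcolim_kill_finite[OF L S(1) k(1)])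
      fix s assume s: "s \<in> S"
      note lin = coconeD(3)[OF co k(1)]
      show "\<sigma> s \<in> Ob A \<and> x s \<otimes>\<^bsub>fob (fob D k) (\<sigma> s)\<^esub> inv\<^bsub>fob (fob D k) (\<sigma> s)\<^esub> x' s \<in> el (fob D k) (\<sigma> s) \<and>
          \<iota> k (\<sigma> s) (x s \<otimes>\<^bsub>fob (fob D k) (\<sigma> s)\<^esub> inv\<^bsub>fob (fob D k) (\<sigma> s)\<^esub> x' s) = \<one>\<^bsub>fob L (\<sigma> s)\<^esub>"
        using s \<sigma> x x' xx' am Lo by (simp add: mult_closed inv_closed lin_mult[OF lin] lin_inv[OF am TF_amod[OF Lo] lin]
            div_eq_one_iff amod_group lin_closed[OF lin])
    qed
    then obtain l w where l: "l \<in> Ob J" "w \<in> Hom J k l" and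
      w: "\<And>s. s \<in> S \<Longrightarrow> fmor D k l w (\<sigma> s) (x s \<otimes>\<^bsub>fob (fob D k) (\<sigma> s)\<^esub> inv\<^bsub>fob (fob D k) (\<sigma> s)\<^esub> x' s) = \<one>\<^bsub>fob (fob D l) (\<sigma> s)\<^esub>"
      by blast
    have wx: "fmor D k l w (\<sigma> s) (x s) = fmor D k l w (\<sigma> s) (x' s)" if s: "s \<in> S" for s
      using w[OF s] s \<sigma> x x' am l k
      by (simp add: lin_mult[OF D_lin] lin_inv[OF _ _ D_lin] inv_closed lin_closed[OF D_lin] div_eq_one_iff amod_group)
    let ?u = "Cmp J i k l w u" and ?v = "Cmp J j k l w v"
    have uv: "?u \<in> Hom J i l" "?v \<in> Hom J j l" using i j k l by (simp_all add: J_Cmp)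
    have "Cmp TF Q (fob D i) (fob D l) (fmor D i l ?u) f = Cmp TF Q (fob D j) (fob D l) (fmor D j l ?v) g"
    proof (rule presents_ext[OF Q S D_ob[OF l(1)]])
      show "Cmp TF Q (fob D i) (fob D l) (fmor D i l ?u) f \<in> Hom TF Q (fob D l)"
        by (rule TF_Cmp_in[OF Q' D_ob[OF i] D_ob[OF l(1)] f D_mor[OF i l(1) uv(1)]])
      show "Cmp TF Q (fob D j) (fob D l) (fmor D j l ?v) g \<in> Hom TF Q (fob D l)"
        by (rule TF_Cmp_in[OF Q' D_ob[OF j] D_ob[OF l(1)] g D_mor[OF j l(1) uv(2)]])
      fix s assume s: "s \<in> S"
      then show "Cmp TF Q (fob D i) (fob D l) (fmor D i l ?u) f (\<sigma> s) (\<pi> (\<sigma> s) (delta s))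
          = Cmp TF Q (fob D j) (fob D l) (fmor D j l ?v) g (\<sigma> s) (\<pi> (\<sigma> s) (delta s))"
        using wx[OF s] \<sigma> e i j k l unfolding e_def[symmetric]
        by (simp add: TF_Cmp_apply D_Cmp x_def x'_def lin_closed[OF flin] lin_closed[OF glin])
    qed
    then show "\<exists>k\<in>Ob J. \<exists>u\<in>Hom J i k. \<exists>v\<in>Hom J j k.
        Cmp TF Q (fob D i) (fob D k) (fmor D i k u) f = Cmp TF Q (fob D j) (fob D k) (fmor D j k v) g"
      using l uv by blast
  qed
qed

end

section \<open>Every torsion-free module is a filtered direct limit of finitely presented ones\<close>

locale canonical_diagram = torsionfree_modules r A W
  for r :: "'u rel" and A :: "('o, 'm, 'z) precat_scheme" and W +
  fixes M :: "('o, 'm, 'u monoid, 'u \<Rightarrow> 'u) func"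
  assumes M_in: "M \<in> Ob TF"
begin

text \<open>Every element of \<open>M\<close> is a generator of its own sort with itself as value:
  \<open>fst\<close> is the sort and \<open>snd\<close> the assignment for
  \<open>ev\<close>.\<close>

definition elements :: "('o \<times> 'u) set" where
  "elements = (SIGMA a:Ob A. el M a)"

sublocale generators r A W elements fst
  by unfold_locales (auto simp: elements_def)

definition index :: "(('o \<times> 'u) set \<times> ('o \<times> ('o \<times> 'u \<Rightarrow> 'm)) set) set" where
  "index = {(S, T). S \<in> Fpow elements \<and>
     T \<in> Fpow (SIGMA b:Ob A. {p \<in> supp S b. ev M snd S b p = \<one>\<^bsub>fob M b\<^esub>})}"

text \<open>Objects of a diagram must lie in \<open>'u\<close>, whereas the pairs have another type.
  Any injection serves; one exists because there is only a small set of pairs.\<close>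

definition code :: "('o \<times> 'u) set \<times> ('o \<times> ('o \<times> 'u \<Rightarrow> 'm)) set \<Rightarrow> 'u" where
  "code = (SOME e. inj_on e index)"

definition gens :: "'u \<Rightarrow> ('o \<times> 'u) set" where
  "gens i = fst (inv_into index code i)"

definition rels :: "'u \<Rightarrow> ('o \<times> ('o \<times> 'u \<Rightarrow> 'm)) set" where
  "rels i = snd (inv_into index code i)"

text \<open>Inclusion of generators and of relations, as a thin category. All arrows bear the one
  name \<open>undefined\<close>, which is harmless as morphism sets need not be disjoint.\<close>

definition J :: "('u, 'u) cat" where
  "J = \<lparr>Ob = code ` index,
     Hom = (\<lambda>i j. if gens i \<subseteq> gens j \<and> rels i \<subseteq> rels j then {undefined} else {}),
     Idt = (\<lambda>_. undefined), Cmp = (\<lambda>_ _ _ _ _. undefined)\<rparr>"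

definition pres :: "'u \<Rightarrow> ('o, 'm, 'u monoid, 'u \<Rightarrow> 'u) func \<times> ('o \<Rightarrow> ('o \<times> 'u \<Rightarrow> 'm) \<Rightarrow> 'u)" where
  "pres i = (SOME P. presents (gens i) (rels i) (fst P) (snd P))"

abbreviation "Q i \<equiv> fst (pres i)"
abbreviation "\<pi> i \<equiv> snd (pres i)"

definition trans :: "'u \<Rightarrow> 'u \<Rightarrow> 'o \<Rightarrow> 'u \<Rightarrow> 'u" where
  "trans i j = (SOME h. h \<in> Hom TF (Q i) (Q j) \<and> (\<forall>b\<in>Ob A. \<forall>p\<in>supp (gens i) b. h b (\<pi> i b p) = \<pi> j b p))"

definition D :: "('u, 'u, ('o, 'm, 'u monoid, 'u \<Rightarrow> 'u) func, 'o \<Rightarrow> 'u \<Rightarrow> 'u) func" where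
  "D = \<lparr>fob = Q, fmor = (\<lambda>i j u. trans i j)\<rparr>"

definition \<kappa> :: "'u \<Rightarrow> 'o \<Rightarrow> 'u \<Rightarrow> 'u" where
  "\<kappa> i = (SOME h. h \<in> Hom TF (Q i) M \<and> (\<forall>b\<in>Ob A. \<forall>p\<in>supp (gens i) b. h b (\<pi> i b p) = ev M snd (gens i) b p))"

section \<open>The index category and its finite presentations\<close>

lemma M_amod: "amod M"
  using M_in by simp

lemma snd_in: "S \<subseteq> elements \<Longrightarrow> \<forall>s\<in>S. snd s \<in> el M (fst s)"
  by (auto simp: elements_def)

text \<open>A finite set of generators supports only a small set of combinations, and the finite
  subsets of a small set form a small set.\<close>

lemma small_index: "small index"
proof (rule small_subset)
  have X: "small elements"
    unfolding elements_def by (rule small_Sigma[OF small_Ob]) (rule TF_small[OF M_in])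
  have "small (\<Union>S\<in>Fpow elements. supp S b)" if "b \<in> Ob A" for b
    by (rule small_UN[OF small_Fpow[OF X]]) (use that in \<open>auto simp: Fpow_def intro: small_supp\<close>)
  then show "small (Fpow elements \<times> Fpow (SIGMA b:Ob A. \<Union>S\<in>Fpow elements. supp S b))"
    by (intro small_Times small_Fpow X small_Sigma small_Ob)
  show "index \<subseteq> Fpow elements \<times> Fpow (SIGMA b:Ob A. \<Union>S\<in>Fpow elements. supp S b)"
    unfolding index_def Fpow_def by blast
qed

lemma inj_code: "inj_on code index"
proof -
  have "\<exists>e :: _ \<Rightarrow> 'u. inj_on e index" using small_embed[OF small_index] by blast
  then show ?thesis unfolding code_def by (rule someI_ex)
qed

lemma gens_code: "(S, T) \<in> index \<Longrightarrow> gens (code (S, T)) = S"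
  and rels_code: "(S, T) \<in> index \<Longrightarrow> rels (code (S, T)) = T"
  by (simp_all add: gens_def rels_def inj_code)

lemma index_J:
  assumes "i \<in> Ob J"
  shows "(gens i, rels i) \<in> index"
  using assms inv_into_into[of i code index] by (simp add: J_def gens_def rels_def)

lemma code_J: "(S, T) \<in> index \<Longrightarrow> code (S, T) \<in> Ob J"
  by (simp add: J_def)

lemma gens_J: "i \<in> Ob J \<Longrightarrow> finite (gens i)" "i \<in> Ob J \<Longrightarrow> gens i \<subseteq> elements"
  using index_J[of i] by (auto simp: index_def Fpow_def)

lemma rels_J: "i \<in> Ob J \<Longrightarrow> finite (rels i)"
  "i \<in> Ob J \<Longrightarrow> rels i \<subseteq> (SIGMA b:Ob A. {p \<in> supp (gens i) b. ev M snd (gens i) b p = \<one>\<^bsub>fob M b\<^esub>})"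
  using index_J[of i] by (auto simp: index_def Fpow_def)

lemma Hom_J: "u \<in> Hom J i j \<longleftrightarrow> gens i \<subseteq> gens j \<and> rels i \<subseteq> rels j \<and> u = undefined"
  by (auto simp: J_def)

lemma category_J: "category J"
  by (rule category.intro) (auto simp: Hom_J, auto simp: J_def)

text \<open>By \<open>ev_mono\<close>, a relation that holds among the generators \<open>S\<close>
  still holds when read among \<open>S'\<close>. Unions of indices thereby become upper
  bounds.\<close>

lemma index_enlarge:
  assumes "(S, T) \<in> index" "S \<subseteq> S'" "S' \<in> Fpow elements"
  shows "T \<in> Fpow (SIGMA b:Ob A. {p \<in> supp S' b. ev M snd S' b p = \<one>\<^bsub>fob M b\<^esub>})"
proof -
  have "p \<in> supp S' b \<and> ev M snd S' b p = \<one>\<^bsub>fob M b\<^esub>"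
    if "b \<in> Ob A" "p \<in> supp S b" "ev M snd S b p = \<one>\<^bsub>fob M b\<^esub>" for b p
    using that supp_mono[OF assms(2)] ev_mono[OF M_amod assms(2) _ _ snd_in that(1,2)] assms(3)
    by (auto simp: Fpow_def)
  then show ?thesis using assms(1) by (auto simp: index_def Fpow_def)
qed

lemma filtered_J: "filtered_category J"
  unfolding filtered_category_def
proof (intro conjI ballI category_J)
  have "({}, {}) \<in> index" by (simp add: index_def Fpow_def)
  then show "Ob J \<noteq> {}" using code_J by blast
next
  fix i j assume i: "i \<in> Ob J" and j: "j \<in> Ob J"
  have S: "gens i \<union> gens j \<in> Fpow elements" using gens_J i j by (simp add: Fpow_def)
  have "(gens i \<union> gens j, rels i \<union> rels j) \<in> index"
    using index_enlarge[OF index_J[OF i] _ S] index_enlarge[OF index_J[OF j] _ S] S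
    by (simp add: index_def Fpow_def)
  then show "\<exists>k\<in>Ob J. Hom J i k \<noteq> {} \<and> Hom J j k \<noteq> {}"
    by (intro bexI[of _ "code (gens i \<union> gens j, rels i \<union> rels j)"])
      (auto simp: Hom_J gens_code rels_code code_J ex_in_conv[symmetric])
next
  fix i j u v assume "i \<in> Ob J" "j \<in> Ob J" "u \<in> Hom J i j" "v \<in> Hom J i j"
  then show "\<exists>k\<in>Ob J. \<exists>w\<in>Hom J j k. Cmp J i j k w u = Cmp J i j k w v"
    by (intro bexI[of _ j] bexI[of _ undefined]) (auto simp: Hom_J)
qed

lemma small_J: "small_category r J"
  unfolding small_category_def
proof (intro conjI ballI category_J)
  show "small (Ob J)" by (simp add: J_def small_image small_index)
  fix i j show "small (Hom J i j)" by (rule small_finite) (simp add: J_def)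
qed

lemma pres_J:
  assumes "i \<in> Ob J"
  shows "presents (gens i) (rels i) (Q i) (\<pi> i)"
proof -
  have "\<exists>P. presents (gens i) (rels i) (fst P) (snd P)"
    using presents_exists[OF gens_J[OF assms]] by simp
  then show ?thesis unfolding pres_def by (rule someI_ex)
qed

lemma Q_in: "i \<in> Ob J \<Longrightarrow> Q i \<in> Ob TF"
  and \<pi>_lin: "i \<in> Ob J \<Longrightarrow> alin (freesub (gens i)) (Q i) (\<pi> i)"
  and Q_el: "i \<in> Ob J \<Longrightarrow> b \<in> Ob A \<Longrightarrow> el (Q i) b = \<pi> i b ` supp (gens i) b"
  and \<pi>_ker: "i \<in> Ob J \<Longrightarrow> b \<in> Ob A \<Longrightarrow> p \<in> supp (gens i) b
    \<Longrightarrow> \<pi> i b p = \<one>\<^bsub>fob (Q i) b\<^esub> \<longleftrightarrow> clos (freesub (gens i)) (\<lambda>b. {p. (b, p) \<in> rels i}) b p"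
  using pres_J[of i] by (auto simp: presents_def)

text \<open>The free module on \<open>gens i\<close> is contained in the one on
  \<open>gens j\<close>, and \<open>rels i\<close> in \<open>rels j\<close>, so
  \<open>\<pi> j\<close> restricted to the smaller free module kills the relations of
  \<open>i\<close>.\<close>

lemma trans_J:
  assumes i: "i \<in> Ob J" and j: "j \<in> Ob J" and le: "gens i \<subseteq> gens j" "rels i \<subseteq> rels j"
  shows "trans i j \<in> Hom TF (Q i) (Q j)"
    "b \<in> Ob A \<Longrightarrow> p \<in> supp (gens i) b \<Longrightarrow> trans i j b (\<pi> i b p) = \<pi> j b p"
proof -
  have lin: "alin (freesub (gens i)) (Q j) (\<pi> j)"
  proof (rule alinI)
    fix a p q assume "a \<in> Ob A" "p \<in> el (freesub (gens i)) a" "q \<in> el (freesub (gens i)) a"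
    then show "\<pi> j a (p \<otimes>\<^bsub>fob (freesub (gens i)) a\<^esub> q) = \<pi> j a p \<otimes>\<^bsub>fob (Q j) a\<^esub> \<pi> j a q"
      using supp_mono[OF le(1), of a] lin_mult[OF \<pi>_lin[OF j], of a p q] by auto
  next
    fix a p assume "a \<in> Ob A" "p \<in> el (freesub (gens i)) a"
    then show "\<pi> j a p \<in> el (Q j) a"
      using supp_mono[OF le(1), of a] lin_closed[OF \<pi>_lin[OF j], of a p] by auto
  next
    fix a b f p assume "a \<in> Ob A" "b \<in> Ob A" "f \<in> Hom A a b" "p \<in> el (freesub (gens i)) a"
    moreover from this have "p \<in> supp (gens j) a" using supp_mono[OF le(1), of a] by auto
    ultimately show "\<pi> j b (fmor (freesub (gens i)) a b f p) = fmor (Q j) a b f (\<pi> j a p)"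
      using lin_act[OF \<pi>_lin[OF j], of a b f p] by simp
  qed
  obtain h where "h \<in> Hom TF (Q i) (Q j)" "\<And>b p. b \<in> Ob A \<Longrightarrow> p \<in> supp (gens i) b \<Longrightarrow> h b (\<pi> i b p) = \<pi> j b p"
  proof (rule presents_factor[OF pres_J[OF i] Q_in[OF j] lin])
    fix b p assume bp: "(b, p) \<in> rels i" "b \<in> Ob A" "p \<in> supp (gens i) b"
    then have "p \<in> supp (gens j) b" "(b, p) \<in> rels j" using supp_mono[OF le(1)] le(2) by auto
    then show "\<pi> j b p = \<one>\<^bsub>fob (Q j) b\<^esub>"
      using bp by (simp add: \<pi>_ker[OF j] clos.gen)
  qed blast
  then have "\<exists>h. h \<in> Hom TF (Q i) (Q j) \<and> (\<forall>b\<in>Ob A. \<forall>p\<in>supp (gens i) b. h b (\<pi> i b p) = \<pi> j b p)"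
    by blast
  from someI_ex[OF this] show "trans i j \<in> Hom TF (Q i) (Q j)"
    "b \<in> Ob A \<Longrightarrow> p \<in> supp (gens i) b \<Longrightarrow> trans i j b (\<pi> i b p) = \<pi> j b p"
    by (auto simp: trans_def)
qed

text \<open>Evaluation in \<open>M\<close> kills \<open>rels i\<close>, since the relations were
  chosen among those that hold in \<open>M\<close>.\<close>

lemma \<kappa>_J:
  assumes i: "i \<in> Ob J"
  shows "\<kappa> i \<in> Hom TF (Q i) M"
    "b \<in> Ob A \<Longrightarrow> p \<in> supp (gens i) b \<Longrightarrow> \<kappa> i b (\<pi> i b p) = ev M snd (gens i) b p"
proof -
  have lin: "alin (freesub (gens i)) M (ev M snd (gens i))"
    by (rule alin_ev_freesub[OF M_amod gens_J(2,1)[OF i] snd_in[OF gens_J(2)[OF i]]])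
  obtain h where "h \<in> Hom TF (Q i) M"
    "\<And>b p. b \<in> Ob A \<Longrightarrow> p \<in> supp (gens i) b \<Longrightarrow> h b (\<pi> i b p) = ev M snd (gens i) b p"
    by (rule presents_factor[OF pres_J[OF i] M_in lin]) (use rels_J(2)[OF i] in auto)
  then have "\<exists>h. h \<in> Hom TF (Q i) M \<and> (\<forall>b\<in>Ob A. \<forall>p\<in>supp (gens i) b. h b (\<pi> i b p) = ev M snd (gens i) b p)"
    by blast
  from someI_ex[OF this] show "\<kappa> i \<in> Hom TF (Q i) M"
    "b \<in> Ob A \<Longrightarrow> p \<in> supp (gens i) b \<Longrightarrow> \<kappa> i b (\<pi> i b p) = ev M snd (gens i) b p"
    by (auto simp: \<kappa>_def)
qed

section \<open>The canonical diagram and its direct limit\<close>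

lemma functor_D: "is_functor J TF D"
proof
  fix i assume "i \<in> Ob J"
  then show "fob D i \<in> Ob TF" by (simp add: D_def Q_in)
next
  fix i j u assume "i \<in> Ob J" "j \<in> Ob J" "u \<in> Hom J i j"
  then show "fmor D i j u \<in> Hom TF (fob D i) (fob D j)" by (simp add: D_def Hom_J trans_J)
next
  fix i assume i: "i \<in> Ob J"
  have "mor (Q i) (\<lambda>a x. x) = trans i i"
    unfolding eq_mor_iff[OF Q_in[OF i] Q_in[OF i] trans_J(1)[OF i i order.refl order.refl]]
    using i by (auto simp: Q_el trans_J)
  then show "fmor D i i (Idt J i) = Idt TF (fob D i)" by (simp add: D_def TF_Idt)
next
  fix i j k u v assume *: "i \<in> Ob J" "j \<in> Ob J" "k \<in> Ob J" "u \<in> Hom J i j" "v \<in> Hom J j k"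
  then have le: "gens i \<subseteq> gens j" "rels i \<subseteq> rels j" "gens j \<subseteq> gens k" "rels j \<subseteq> rels k"
    "gens i \<subseteq> gens k" "rels i \<subseteq> rels k" by (auto simp: Hom_J)
  have "p \<in> supp (gens j) b" if "p \<in> supp (gens i) b" for p b
    using that supp_mono[OF le(1)] by blast
  then have "mor (Q i) (\<lambda>a x. trans j k a (trans i j a x)) = trans i k"
    unfolding eq_mor_iff[OF Q_in[OF *(1)] Q_in[OF *(3)] trans_J(1)[OF *(1,3) le(5,6)]]
    using * le by (auto simp: Q_el trans_J)
  then show "fmor D i k (Cmp J i j k v u) = Cmp TF (fob D i) (fob D j) (fob D k) (fmor D j k v) (fmor D i j u)"
    by (simp add: D_def TF_Cmp)
qed

lemma diagram_D: "small_filtered_diagram r J TF D"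
  using small_J filtered_J functor_D by (simp add: small_filtered_diagram_def)

sublocale D: filtered_diagram r A W J D
  by (rule filtered_diagramI[OF diagram_D])

lemma cocone_\<kappa>: "is_cocone J TF D M \<kappa>"
  unfolding is_cocone_def
proof (intro conjI ballI M_in)
  fix i assume "i \<in> Ob J"
  then show "\<kappa> i \<in> Hom TF (fob D i) M" by (simp add: D_def \<kappa>_J)
next
  fix i j u assume i: "i \<in> Ob J" and j: "j \<in> Ob J" and "u \<in> Hom J i j"
  then have le: "gens i \<subseteq> gens j" "rels i \<subseteq> rels j" by (simp_all add: Hom_J)
  have "mor (Q i) (\<lambda>a x. \<kappa> j a (trans i j a x)) = \<kappa> i"
    unfolding eq_mor_iff[OF Q_in[OF i] M_in \<kappa>_J(1)[OF i]]
  proof (intro ballI)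
    fix b x assume b: "b \<in> Ob A" and "x \<in> el (Q i) b"
    then obtain p where p: "p \<in> supp (gens i) b" "x = \<pi> i b p" using Q_el[OF i] by auto
    moreover have "p \<in> supp (gens j) b" using p supp_mono[OF le(1)] by blast
    ultimately show "\<kappa> j b (trans i j b x) = \<kappa> i b x"
      using i j le b ev_mono[OF M_amod le(1) gens_J(2,1)[OF j] snd_in[OF gens_J(2)[OF j]] b p(1)]
      by (simp add: trans_J \<kappa>_J)
  qed
  then show "Cmp TF (fob D i) (fob D j) M (\<kappa> j) (fmor D i j u) = \<kappa> i"
    by (simp add: D_def TF_Cmp)
qed

text \<open>An element of \<open>M\<close> comes from the index with that single generator and no
  relations. If a combination \<open>p\<close> at stage \<open>i\<close> evaluates to zero in
  \<open>M\<close>, then \<open>p\<close> is itself an admissible relation, and adding it to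
  \<open>rels i\<close> gives a later stage at which it vanishes.\<close>

lemma colimit_\<kappa>: "is_colimit J TF D M \<kappa>"
  unfolding D.is_colimit_iff D.elcolim_def
proof (intro conjI ballI impI cocone_\<kappa>)
  fix a m assume a: "a \<in> Ob A" and m: "m \<in> el M a"
  define i where "i = code ({(a, m)}, {})"
  have idx: "({(a, m)}, {}) \<in> index"
    using a m by (simp add: index_def Fpow_def elements_def)
  then have i: "i \<in> Ob J" and gi: "gens i = {(a, m)}" by (simp_all add: i_def code_J gens_code)
  have s: "(a, m) \<in> elements" using gens_J(2)[OF i] gi by simp
  have d: "delta (a, m) \<in> supp (gens i) a" using delta_in[OF s, of "gens i"] gi by simp
  have "\<kappa> i a (\<pi> i a (delta (a, m))) = m"
    using \<kappa>_J(2)[OF i a d] ev_delta[OF M_amod gens_J(2,1)[OF i] snd_in[OF gens_J(2)[OF i]], of "(a, m)"] gi by simp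
  moreover have "\<pi> i a (delta (a, m)) \<in> el (fob D i) a" using d i a by (simp add: D_def Q_el)
  ultimately show "\<exists>i\<in>Ob J. \<exists>x\<in>el (fob D i) a. m = \<kappa> i a x" using i by force
next
  fix a i x assume a: "a \<in> Ob A" and i: "i \<in> Ob J" and "x \<in> el (fob D i) a" and eq: "\<kappa> i a x = \<one>\<^bsub>fob M a\<^esub>"
  then obtain p where p: "p \<in> supp (gens i) a" "x = \<pi> i a p" by (auto simp: D_def Q_el)
  define j where "j = code (gens i, insert (a, p) (rels i))"
  have "ev M snd (gens i) a p = \<one>\<^bsub>fob M a\<^esub>" using eq p \<kappa>_J(2)[OF i a] by simp
  then have idx: "(gens i, insert (a, p) (rels i)) \<in> index"
    using index_J[OF i] a p(1) by (auto simp: index_def Fpow_def)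
  have j: "j \<in> Ob J" and gj: "gens j = gens i" and rj: "rels j = insert (a, p) (rels i)"
    using idx by (simp_all add: j_def code_J gens_code rels_code)
  have "\<pi> j a p = \<one>\<^bsub>fob (Q j) a\<^esub>"
    using \<pi>_ker[OF j a, of p] p(1) gj rj a by (auto intro: clos.gen)
  then have "fmor D i j undefined a x = \<one>\<^bsub>fob (fob D j) a\<^esub>"
    using trans_J(2)[OF i j _ _ a p(1)] gj rj p(2) by (auto simp: D_def)
  moreover have "undefined \<in> Hom J i j" using gj rj by (auto simp: Hom_J)
  ultimately show "\<exists>j\<in>Ob J. \<exists>u\<in>Hom J i j. fmor D i j u a x = \<one>\<^bsub>fob (fob D j) a\<^esub>" using j by blast
qed

lemma finitely_presentable_D:
  assumes i: "i \<in> Ob J"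
  shows "finitely_presentable r TF (fob D i)"
  using presents_finitely_presentable[OF pres_J[OF i] gens_J[OF i] rels_J(1)[OF i]] rels_J(2)[OF i]
  by (force simp: D_def)

end

context torsionfree_modules
begin

lemma locally_presentable_TF: "locally_presentable r TF"
  unfolding locally_presentable_def
proof (intro conjI ballI has_filtered_colimits_TF)
  fix M assume "M \<in> Ob TF"
  then interpret canonical_diagram r A W M by unfold_locales
  show "\<exists>(J :: ('u, 'u) cat) D \<iota>. small_filtered_diagram r J TF D \<and>
      (\<forall>i\<in>Ob J. finitely_presentable r TF (fob D i)) \<and> is_colimit J TF D M \<iota>"
    using diagram_D finitely_presentable_D colimit_\<kappa> by blast
qed

theorem grothendieck_TF: "grothendieck_quasi_abelian r TF"
  using quasi_abelian_TF locally_presentable_TF exact_filtered_colimits_TF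
  by (simp add: grothendieck_quasi_abelian_def)

end

section \<open>Filtered rings\<close>

text \<open>The kernel is a subgroup of a small group, hence an object; its inclusion and the zero
  map have equal composites with \<open>f\<close>, so a monomorphism has trivial kernel.\<close>

lemma (in universe) monic_Ab_iff:
  assumes X: "X \<in> Ob (Ab r)" and Y: "Y \<in> Ob (Ab r)" and f: "f \<in> Hom (Ab r) X Y"
  shows "monic (Ab r) X Y f \<longleftrightarrow> inj_on f (carrier X)"
proof
  assume inj: "inj_on f (carrier X)"
  have "g = h" if "g \<in> Hom (Ab r) V X" "h \<in> Hom (Ab r) V X" and eq: "Cmp (Ab r) V X Y f g = Cmp (Ab r) V X Y f h" for V g h
  proof (rule extensionalityI[of _ "carrier V"])
    show "g \<in> extensional (carrier V)" "h \<in> extensional (carrier V)" using that by (simp_all add: Ab_def)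
    fix x assume x: "x \<in> carrier V"
    then have "f (g x) = f (h x)" using fun_cong[OF eq, of x] by (simp add: Ab_def)
    moreover have "g x \<in> carrier X" "h x \<in> carrier X" using that x by (auto simp: Ab_def hom_def)
    ultimately show "g x = h x" using inj by (auto dest: inj_onD)
  qed
  then show "monic (Ab r) X Y f" using assms by (simp add: monic_def)
next
  assume monic: "monic (Ab r) X Y f"
  have X': "comm_group X" "small (carrier X)" and Y': "comm_group Y" and f': "f \<in> hom X Y"
    using X Y f by (auto simp: Ab_def)
  interpret X: comm_group X by fact
  interpret Y: comm_group Y by fact
  interpret f: group_hom X Y f by unfold_locales (rule f')
  define K where "K = X\<lparr>carrier := kernel X Y f\<rparr>"
  have K: "K \<in> Ob (Ab r)"
    using X.subgroup_imp_group[OF f.subgroup_kernel] f.subgroup_kernel small_subset[OF X'(2), of "kernel X Y f"]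
    by (auto simp: Ab_def K_def kernel_def X.m_comm intro!: group.group_comm_groupI)
  define i where "i = (\<lambda>x\<in>carrier K. x)"
  define z where "z = (\<lambda>x\<in>carrier K. \<one>\<^bsub>X\<^esub>)"
  have "i \<in> Hom (Ab r) K X" "z \<in> Hom (Ab r) K X"
    by (auto simp: i_def z_def Ab_def K_def hom_def kernel_def)
  moreover have "Cmp (Ab r) K X Y f i = Cmp (Ab r) K X Y f z"
    by (auto simp: Ab_def i_def z_def K_def kernel_def restrict_def)
  ultimately have "i = z" using monic K unfolding monic_def by blast
  have "x = \<one>\<^bsub>X\<^esub>" if "x \<in> kernel X Y f" for x
    using fun_cong[OF \<open>i = z\<close>, of x] that by (simp add: i_def z_def K_def)
  then have "kernel X Y f = {\<one>\<^bsub>X\<^esub>}" by (auto simp: kernel_def)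
  then show "inj_on f (carrier X)" using f.inj_iff_trivial_ker by simp
qed

text \<open>Monomorphisms of \<open>Ab\<close> are the injective homomorphisms, so both conditions
  cut out the same functors. The result is an equality of records, and the theorem on
  \<open>TF\<close> transfers by rewriting.\<close>

lemma (in torsionfree_modules) full_subcategory_eq_TF:
  assumes "\<And>M. is_additive_functor A (Ab r) M \<Longrightarrow>
    P M \<longleftrightarrow> (\<forall>(a, b, w)\<in>W. monic (Ab r) (fob M a) (fob M b) (fmor M a b w))"
  shows "full_subcategory (additive_functor_category A (Ab r)) P = TF"
proof -
  have "P M \<longleftrightarrow> tfree M" if M: "is_additive_functor A (Ab r) M" for M
  proof -
    interpret is_additive_functor A "Ab r" M by fact
    have "monic (Ab r) (fob M a) (fob M b) (fmor M a b w) \<longleftrightarrow> inj_on (fmor M a b w) (el M a)"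
      if "(a, b, w) \<in> W" for a b w
      using W_arrow[OF that] by (intro monic_Ab_iff fob_in fmor_in) auto
    then show ?thesis unfolding assms[OF M] tfree_def by auto
  qed
  then have "{M. is_additive_functor A (Ab r) M \<and> P M} = {M. is_additive_functor A (Ab r) M \<and> tfree M}"
    by blast
  then show ?thesis
    by (simp add: TF_def full_subcategory_def additive_functor_category_def)
qed

text \<open>Composition and addition are those of a single ring, which supplies all identities; only
  closure has to be assumed. Both categories of a filtered ring are of this kind.\<close>

lemma (in ring) preadditive_of_additive_subgroups:
  assumes sub: "\<And>X Y. X \<in> obs \<Longrightarrow> Y \<in> obs \<Longrightarrow> additive_subgroup (H X Y) R"
    and one: "\<And>X. X \<in> obs \<Longrightarrow> \<one> \<in> H X X"
    and mult: "\<And>X Y Z f g. X \<in> obs \<Longrightarrow> Y \<in> obs \<Longrightarrow> Z \<in> obs \<Longrightarrow> f \<in> H X Y \<Longrightarrow> g \<in> H Y Z \<Longrightarrow> g \<otimes> f \<in> H X Z"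
  shows "preadditive_category \<lparr>Ob = obs, Hom = H, Idt = (\<lambda>_. \<one>), Cmp = (\<lambda>_ _ _ g f. g \<otimes> f),
    Plus = (\<lambda>_ _ f g. f \<oplus> g), Zer = (\<lambda>_ _. \<zero>)\<rparr>"
proof (intro preadditive_category.intro category.intro preadditive_category_axioms.intro, goal_cases)
  \<comment> \<open>Goal 6 asks for the group structure on the morphism set \<open>H X Y\<close>;
    the other goals are closure statements and ring identities.\<close>
  case (6 X Y)
  then interpret H: additive_subgroup "H X Y" R by (simp add: sub)
  show ?case
    unfolding hom_group_def
    by (rule comm_groupI_inv[where i = "\<lambda>x. \<ominus> x"])
      (simp_all add: H.a_closed H.zero_closed H.a_inv_closed H.a_Hcarr a_ac l_neg r_neg)
qed (simp_all add: one mult, simp_all add: additive_subgroup.a_Hcarr[OF sub] m_assoc r_distr l_distr)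

section \<open>The preadditive categories of a filtered ring\<close>

context filtered_ring
begin

lemma filt_hom_subgroup:
  assumes "\<alpha> \<in> carrier \<Gamma>" "\<beta> \<in> carrier \<Gamma>"
  shows "additive_subgroup (filt_hom \<Gamma> leq R F \<alpha> \<beta>) R"
proof -
  have "additive_subgroup {\<zero>\<^bsub>R\<^esub>} R"
    by (intro additive_subgroup.intro R.add.triv_subgroup[simplified])
  then show ?thesis using assms by (simp add: filt_hom_def F_subgroup)
qed

text \<open>Multiplying \<alpha> \<le> \<beta> on the right by the inverse of \<alpha> puts the unit
  of the group below the degree of the morphism set, so \<open>F_one\<close> and
  \<open>F_mono\<close> apply.\<close>

lemma one_filt_hom:
  assumes \<alpha>: "\<alpha> \<in> carrier \<Gamma>" and \<beta>: "\<beta> \<in> carrier \<Gamma>" and le: "leq \<alpha> \<beta>"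
  shows "\<one>\<^bsub>R\<^esub> \<in> filt_hom \<Gamma> leq R F \<alpha> \<beta>"
proof -
  have "leq (\<alpha> \<otimes>\<^bsub>\<Gamma>\<^esub> inv\<^bsub>\<Gamma>\<^esub> \<alpha>) (\<beta> \<otimes>\<^bsub>\<Gamma>\<^esub> inv\<^bsub>\<Gamma>\<^esub> \<alpha>)"
    using assms by (intro leq_mult leq_refl) auto
  then show ?thesis
    using assms F_one F_mono[of "\<one>\<^bsub>\<Gamma>\<^esub>" "\<beta> \<otimes>\<^bsub>\<Gamma>\<^esub> inv\<^bsub>\<Gamma>\<^esub> \<alpha>"] by (auto simp: filt_hom_def)
qed

text \<open>The inner \<beta> cancels in the product of the two degrees. If one of the inequalities
  fails, one factor is zero, and zero lies in every morphism set.\<close>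

lemma mult_filt_hom:
  assumes \<alpha>: "\<alpha> \<in> carrier \<Gamma>" and \<beta>: "\<beta> \<in> carrier \<Gamma>" and \<gamma>: "\<gamma> \<in> carrier \<Gamma>"
    and f: "f \<in> filt_hom \<Gamma> leq R F \<alpha> \<beta>" and g: "g \<in> filt_hom \<Gamma> leq R F \<beta> \<gamma>"
  shows "g \<otimes>\<^bsub>R\<^esub> f \<in> filt_hom \<Gamma> leq R F \<alpha> \<gamma>"
proof (cases "leq \<alpha> \<beta> \<and> leq \<beta> \<gamma>")
  case True
  have "(\<gamma> \<otimes>\<^bsub>\<Gamma>\<^esub> inv\<^bsub>\<Gamma>\<^esub> \<beta>) \<otimes>\<^bsub>\<Gamma>\<^esub> (\<beta> \<otimes>\<^bsub>\<Gamma>\<^esub> inv\<^bsub>\<Gamma>\<^esub> \<alpha>) = \<gamma> \<otimes>\<^bsub>\<Gamma>\<^esub> inv\<^bsub>\<Gamma>\<^esub> \<alpha>"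
    using \<alpha> \<beta> \<gamma> by (metis inv_closed m_assoc m_closed l_inv l_one)
  moreover have "g \<otimes>\<^bsub>R\<^esub> f \<in> F ((\<gamma> \<otimes>\<^bsub>\<Gamma>\<^esub> inv\<^bsub>\<Gamma>\<^esub> \<beta>) \<otimes>\<^bsub>\<Gamma>\<^esub> (\<beta> \<otimes>\<^bsub>\<Gamma>\<^esub> inv\<^bsub>\<Gamma>\<^esub> \<alpha>))"
    using True f g \<alpha> \<beta> \<gamma> by (intro F_mult) (auto simp: filt_hom_def)
  moreover have "leq \<alpha> \<gamma>" using leq_trans[OF \<alpha> \<beta> \<gamma>] True by blast
  ultimately show ?thesis by (simp add: filt_hom_def)
next
  case False
  have "f \<in> carrier R" "g \<in> carrier R"
    using additive_subgroup.a_Hcarr[OF filt_hom_subgroup] assms by blast+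
  then have "g \<otimes>\<^bsub>R\<^esub> f = \<zero>\<^bsub>R\<^esub>" using False f g by (auto simp: filt_hom_def split: if_splits)
  then show ?thesis using additive_subgroup.zero_closed[OF filt_hom_subgroup[OF \<alpha> \<gamma>]] by simp
qed

lemma torsionfree_modules_filt_cat:
  assumes \<Lambda>: "\<Lambda> \<subseteq> carrier \<Gamma>" and r: "universe_card r" "|carrier R| <o r" "|\<Lambda>| <o r"
  shows "torsionfree_modules r (filt_cat \<Gamma> leq R F \<Lambda>) {(\<alpha>, \<beta>, \<one>\<^bsub>R\<^esub>) | \<alpha> \<beta>. \<alpha> \<in> \<Lambda> \<and> \<beta> \<in> \<Lambda> \<and> leq \<alpha> \<beta>}"
proof -
  interpret universe r by unfold_locales fact
  have sub: "filt_hom \<Gamma> leq R F \<alpha> \<beta> \<subseteq> carrier R" if "\<alpha> \<in> \<Lambda>" "\<beta> \<in> \<Lambda>" for \<alpha> \<beta>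
    using additive_subgroup.a_subset[OF filt_hom_subgroup] that \<Lambda> by blast
  have "preadditive_category (filt_cat \<Gamma> leq R F \<Lambda>)"
    unfolding filt_cat_def using \<Lambda>
    by (intro R.preadditive_of_additive_subgroups filt_hom_subgroup one_filt_hom mult_filt_hom leq_refl) auto
  then show ?thesis
    using \<Lambda> r(3) small_subset[OF r(2) sub]
    by (intro torsionfree_modules.intro torsionfree_modules_axioms.intro universe_axioms)
      (auto simp: filt_cat_def one_filt_hom subset_iff)
qed

lemma torsionfree_modules_filt_cat_inf:
  assumes \<Lambda>: "\<Lambda> \<subseteq> carrier \<Gamma>" and r: "universe_card r" "|carrier R| <o r" "|\<Lambda>| <o r"
  defines "obs \<equiv> insert None (Some ` \<Lambda>)"
  shows "torsionfree_modules r (filt_cat_inf \<Gamma> leq R F \<Lambda>)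
    {(a, b, \<one>\<^bsub>R\<^esub>) | a b. a \<in> obs \<and> b \<in> obs \<and> leq_inf leq a b}"
proof -
  interpret universe r by unfold_locales fact
  define H where "H a b = (case b of None \<Rightarrow> carrier R
    | Some \<beta> \<Rightarrow> (case a of None \<Rightarrow> {\<zero>\<^bsub>R\<^esub>} | Some \<alpha> \<Rightarrow> filt_hom \<Gamma> leq R F \<alpha> \<beta>))" for a b
  have triv: "additive_subgroup {\<zero>\<^bsub>R\<^esub>} R"
    by (intro additive_subgroup.intro R.add.triv_subgroup[simplified])
  have full: "additive_subgroup (carrier R) R"
    by (intro additive_subgroup.intro R.add.subgroup_self[simplified])
  have sub: "additive_subgroup (H a b) R" if "a \<in> obs" "b \<in> obs" for a b
    using that \<Lambda> triv full by (auto simp: H_def obs_def filt_hom_subgroup subset_iff split: option.splits)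
  have one: "\<one>\<^bsub>R\<^esub> \<in> H a b" if "a \<in> obs" "b \<in> obs" "leq_inf leq a b" for a b
    using that \<Lambda> by (auto simp: H_def obs_def leq_inf_def one_filt_hom subset_iff)
  have mult: "g \<otimes>\<^bsub>R\<^esub> f \<in> H a c" if abc: "a \<in> obs" "b \<in> obs" "c \<in> obs" and f: "f \<in> H a b" and g: "g \<in> H b c" for a b c f g
  proof -
    have fg: "f \<in> carrier R" "g \<in> carrier R"
      using additive_subgroup.a_Hcarr[OF sub] abc f g by blast+
    \<comment> \<open>Into infinity every ring element is allowed, and from infinity to a finite
      object only zero; so the filtration matters only in the last case.\<close>
    consider "c = None" | \<gamma> where "c = Some \<gamma>" "b = None"
      | \<gamma> \<beta> where "c = Some \<gamma>" "b = Some \<beta>" "a = None"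
      | \<gamma> \<beta> \<alpha> where "c = Some \<gamma>" "b = Some \<beta>" "a = Some \<alpha>" by (cases a; cases b; cases c) auto
    then show ?thesis
    proof cases
      case 2
      then have "g \<otimes>\<^bsub>R\<^esub> f = \<zero>\<^bsub>R\<^esub>" using g fg by (simp add: H_def)
      then show ?thesis using additive_subgroup.zero_closed[OF sub[OF abc(1,3)]] by simp
    next
      case 4
      then show ?thesis
        using f g abc \<Lambda> mult_filt_hom[of \<alpha> \<beta> \<gamma> f g] by (auto simp: H_def obs_def)
    qed (use f g fg in \<open>auto simp: H_def\<close>)
  qed
  have cat: "filt_cat_inf \<Gamma> leq R F \<Lambda> = \<lparr>Ob = obs, Hom = H, Idt = (\<lambda>_. \<one>\<^bsub>R\<^esub>), Cmp = (\<lambda>_ _ _ g f. g \<otimes>\<^bsub>R\<^esub> f),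
    Plus = (\<lambda>_ _ f g. f \<oplus>\<^bsub>R\<^esub> g), Zer = (\<lambda>_ _. \<zero>\<^bsub>R\<^esub>)\<rparr>"
    by (simp add: filt_cat_inf_def obs_def H_def[abs_def])
  have "leq_inf leq a a" if "a \<in> obs" for a
    using that \<Lambda> leq_refl by (auto simp: leq_inf_def obs_def)
  then have "preadditive_category (filt_cat_inf \<Gamma> leq R F \<Lambda>)"
    unfolding cat by (intro R.preadditive_of_additive_subgroups sub mult one)
  moreover have "small obs"
  proof -
    have "obs = {None} \<union> Some ` \<Lambda>" by (auto simp: obs_def)
    moreover have "small ({None} \<union> Some ` \<Lambda>)"
      by (rule card_of_Un_ordLess_infinite_Field[OF infinite_Field_r Card_order_r small_finite small_image[OF r(3)]]) simp
    ultimately show ?thesis by simp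
  qed
  moreover have "small (H a b)" if "a \<in> obs" "b \<in> obs" for a b
    by (rule small_subset[OF r(2) additive_subgroup.a_subset[OF sub[OF that]]])
  ultimately show ?thesis
    by (intro torsionfree_modules.intro torsionfree_modules_axioms.intro universe_axioms)
      (auto simp: cat one)
qed

end

theorem proposition5p15:
  fixes \<Gamma> :: "('g, 'a) monoid_scheme" and leq :: "'g \<Rightarrow> 'g \<Rightarrow> bool"
    and R :: "('c, 'b) ring_scheme" and F :: "'g \<Rightarrow> 'c set"
    and \<Lambda> :: "'g set" and r :: "'u rel"
  assumes "filtered_ring \<Gamma> leq R F"
    and "\<Lambda> \<subseteq> carrier \<Gamma>"
    and "universe_card r"
    and "|carrier R| <o r"
    and "|\<Lambda>| <o r"
  shows "grothendieck_quasi_abelian r (Preglid r \<Gamma> leq R F \<Lambda>)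
    \<and> grothendieck_quasi_abelian r (Prefrag r \<Gamma> leq R F \<Lambda>)"
proof
  interpret glid: torsionfree_modules r "filt_cat_inf \<Gamma> leq R F \<Lambda>"
    "{(a, b, \<one>\<^bsub>R\<^esub>) | a b. a \<in> insert None (Some ` \<Lambda>) \<and> b \<in> insert None (Some ` \<Lambda>) \<and> leq_inf leq a b}"
    by (rule filtered_ring.torsionfree_modules_filt_cat_inf[OF assms])
  have "Preglid r \<Gamma> leq R F \<Lambda> = glid.TF"
    unfolding Preglid_def by (rule glid.full_subcategory_eq_TF) blast
  then show "grothendieck_quasi_abelian r (Preglid r \<Gamma> leq R F \<Lambda>)"
    by (simp only: glid.grothendieck_TF)
  interpret frag: torsionfree_modules r "filt_cat \<Gamma> leq R F \<Lambda>"
    "{(\<alpha>, \<beta>, \<one>\<^bsub>R\<^esub>) | \<alpha> \<beta>. \<alpha> \<in> \<Lambda> \<and> \<beta> \<in> \<Lambda> \<and> leq \<alpha> \<beta>}"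
    by (rule filtered_ring.torsionfree_modules_filt_cat[OF assms])
  have "Prefrag r \<Gamma> leq R F \<Lambda> = frag.TF"
    unfolding Prefrag_def by (rule frag.full_subcategory_eq_TF) blast
  then show "grothendieck_quasi_abelian r (Prefrag r \<Gamma> leq R F \<Lambda>)"
    by (simp only: frag.grothendieck_TF)
qed

end
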